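(* Let $\Gamma$ be a discrete group and let $\Lambda$ be a subgroup of $\Gamma$. Assume that $\Lambda$ is normal. Then, for $N\geqslant 4$, $\widehat{\Gamma}\wr_{\ast, \widehat{\Lambda}}S_{N}^{+}$ is topologically generated by its quantum subgroups $\widehat{\Gamma}\times S_{N}^{+}$ and $\widehat{\Gamma/\Lambda}\wr_{\ast}S_{N}^{+}$.
   Context: A CQG-algebra is a Hopf $*$-algebra spanned by the coefficients of its finite-dimensional unitary corepresentations; it is written $\mathcal{O}(\mathbb{G})$ and said to correspond to the compact quantum group $\mathbb{G}$. A (finite-dimensional) representation of $\mathbb{G}$ is an invertible $v\in M_{n}(\mathcal{O}(\mathbb{G}))$ with $\Delta(v_{ij})=\sum_{k}v_{ik}\otimes v_{kj}$; $\mathrm{Mor}_{\mathbb{G}}(v,w)$ is the space of linear maps $T$ with $Tv=wT$. $\mathbb{K}$ is a quantum subgroup of $\mathbb{G}$ if there is a surjective Hopf $*$-homomorphism $\mathcal{O}(\mathbb{G})\to\mathcal{O}(\mathbb{K})$; representations of $\mathbb{G}$ are then viewed as representations of $\mathbb{K}$ by applying this map to coefficients. $\mathbb{G}$ is topologically generated by quantum subgroups $(\mathbb{H}_{i})_{i\in I}$ if for all representations $u,v$ of $\mathbb{G}$, $\mathrm{Mor}_{\mathbb{G}}(u,v)=\bigcap_{i\in I}\mathrm{Mor}_{\mathbb{H}_{i}}(u,v)$. For a discrete group $\Gamma$, $\mathcal{O}(\widehat{\Gamma})=\mathbb{C}[\Gamma]$, $\Delta(g)=g\otimes g$, $g^*=g^{-1}$.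 $\mathcal{O}(S_{N}^{+})$ is the universal unital $*$-algebra generated by $(p_{ij})_{1\leqslant i,j\leqslant N}$ with $p_{ij}^{2}=p_{ij}=p_{ij}^{*}$, $\sum_{k}p_{ik}=1=\sum_{k}p_{kj}$, $p_{ik}p_{jk}=\delta_{ij}p_{ik}$, $p_{ki}p_{kj}=\delta_{ij}p_{kj}$, with $\Delta(p_{ij})=\sum_{k}p_{ik}\otimes p_{kj}$. For a subgroup $\Lambda<\Gamma$, $\mathcal{O}(\widehat{\Gamma}\wr_{\ast,\widehat{\Lambda}}S_{N}^{+})$ is the quotient of $\mathbb{C}[\Gamma]^{\ast_{\mathbb{C}[\Lambda]}^{N}}\ast\mathcal{O}(S_{N}^{+})$ ($N$-fold free product of $\mathbb{C}[\Gamma]$ amalgamated over $\mathbb{C}[\Lambda]$, free product with $\mathcal{O}(S_{N}^{+})$) by the relations $\nu_{i}(x)p_{ij}=p_{ij}\nu_{i}(x)$ for all $i,j$ and $x\in\mathbb{C}[\Gamma]$, where $\nu_{i}$ is the canonical map onto the $i$-th copy; its coproduct is determined by $\Delta(p_{ij})=\sum_{k}p_{ik}\otimes p_{kj}$ and $\Delta(\nu_{i}(g))=\sum_{k}\nu_{i}(g)p_{ik}\otimes\nu_{k}(g)$. $\widehat{\Theta}\wr_{\ast}S_{N}^{+}$ is the case of the trivial subgroup of $\Theta$. The two quantum subgroups are given by the surjections: onto $\mathcal{O}(\widehat{\Gamma}\times S_{N}^{+})=\mathbb{C}[\Gamma]\otimes\mathcal{O}(S_{N}^{+})$, $\nu_{i}(g)\mapsto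 g\otimes 1$, $p_{ij}\mapsto 1\otimes p_{ij}$; and onto $\mathcal{O}(\widehat{\Gamma/\Lambda}\wr_{\ast}S_{N}^{+})$, $\nu_{i}(g)\mapsto\nu_{i}([g])$, $p_{ij}\mapsto p_{ij}$, where $[g]$ is the class of $g$ in $\Gamma/\Lambda$. *)

theory Defs
  imports
    Complex_Main
    "HOL-Algebra.QuotRing"
    "HOL-Algebra.Module"
    "HOL-Library.Poly_Mapping"
begin

section \<open>Unital complex \<open>*\<close>-algebras\<close>

text \<open>
  Algebras are carrier-based, as in HOL-Algebra, because the algebras below depend on the terms
  \<open>\<Gamma>\<close>, \<open>\<Lambda>\<close> and \<open>N\<close>. Multiplication need not be commutative.
\<close>

record 'a star_algebra = "(complex, 'a) module" +
  star :: "'a \<Rightarrow> 'a"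

definition star_hom ::
  "('a, 'c) star_algebra_scheme \<Rightarrow> ('b, 'd) star_algebra_scheme \<Rightarrow> ('a \<Rightarrow> 'b) \<Rightarrow> bool"
  where "star_hom A B f \<longleftrightarrow>
     f \<in> ring_hom A B \<and>
     (\<forall>c. \<forall>x\<in>carrier A. f (c \<odot>\<^bsub>A\<^esub> x) = c \<odot>\<^bsub>B\<^esub> f x) \<and>
     (\<forall>x\<in>carrier A. f (star A x) = star B (f x))"

text \<open>
  The unital \<open>*\<close>-homomorphism with property \<open>P\<close>. It is only used when \<open>P\<close> prescribes the values
  on a generating set, so that there is at most one such map; extensionality pins down its values
  outside the carrier.
\<close>

definition the_star_hom ::
  "('a, 'c) star_algebra_scheme \<Rightarrow> ('b, 'd) star_algebra_scheme \<Rightarrow> (('a \<Rightarrow> 'b) \<Rightarrow> bool) \<Rightarrow> 'a \<Rightarrow> 'b"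
  where "the_star_hom A B P = (THE f. f \<in> extensional (carrier A) \<and> star_hom A B f \<and> P f)"

text \<open>
  The \<open>*\<close>-algebra of finitely supported functions on a monoid with convolution product; \<open>\<sigma>\<close> is
  an antimultiplicative involution of the monoid, extended antilinearly.
\<close>

definition monoid_star_algebra ::
  "('m, 'c) monoid_scheme \<Rightarrow> ('m \<Rightarrow> 'm) \<Rightarrow> ('m \<Rightarrow>\<^sub>0 complex) star_algebra"
  where "monoid_star_algebra M \<sigma> =
    \<lparr>carrier = {f. Poly_Mapping.keys f \<subseteq> carrier M},
     mult = (\<lambda>f g. \<Sum>s\<in>Poly_Mapping.keys f. \<Sum>t\<in>Poly_Mapping.keys g.
               Poly_Mapping.single (s \<otimes>\<^bsub>M\<^esub> t) (Poly_Mapping.lookup f s * Poly_Mapping.lookup g t)),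
     one = Poly_Mapping.single \<one>\<^bsub>M\<^esub> 1,
     zero = 0,
     add = (+),
     smult = (\<lambda>c. Poly_Mapping.map ((*) c)),
     star = (\<lambda>f. \<Sum>s\<in>Poly_Mapping.keys f.
               Poly_Mapping.single (\<sigma> s) (cnj (Poly_Mapping.lookup f s)))\<rparr>"

definition group_algebra :: "('g, 'c) monoid_scheme \<Rightarrow> ('g \<Rightarrow>\<^sub>0 complex) star_algebra"
  where "group_algebra \<Gamma> = monoid_star_algebra \<Gamma> (m_inv \<Gamma>)"

abbreviation group_elem :: "'g \<Rightarrow> 'g \<Rightarrow>\<^sub>0 complex"
  where "group_elem g \<equiv> Poly_Mapping.single g 1"


subsection \<open>Quotients and universal \<open>*\<close>-algebras\<close>

text \<open>A two-sided ideal of a unital algebra is automatically closed under scalar multiplication.\<close>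

definition star_ideal :: "('a, 'c) star_algebra_scheme \<Rightarrow> 'a set \<Rightarrow> 'a set"
  where "star_ideal A R = genideal A (R \<union> star A ` R)"

definition star_quot :: "('a, 'c) star_algebra_scheme \<Rightarrow> 'a set \<Rightarrow> 'a set star_algebra"
  where "star_quot A R = (let I = star_ideal A R in
    \<lparr>carrier = carrier (A Quot I),
     mult = mult (A Quot I),
     one = one (A Quot I),
     zero = zero (A Quot I),
     add = add (A Quot I),
     smult = (\<lambda>c X. \<Union>x\<in>X. I +>\<^bsub>A\<^esub> (c \<odot>\<^bsub>A\<^esub> x)),
     star = (\<lambda>X. \<Union>x\<in>X. I +>\<^bsub>A\<^esub> star A x)\<rparr>)"

definition star_class :: "('a, 'c) star_algebra_scheme \<Rightarrow> 'a set \<Rightarrow> 'a \<Rightarrow> 'a set"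
  where "star_class A R x = star_ideal A R +>\<^bsub>A\<^esub> x"

text \<open>
  The free unital \<open>*\<close>-algebra on \<open>X\<close>: noncommutative polynomials in letters \<open>(x, False)\<close>,
  standing for \<open>x\<close>, and \<open>(x, True)\<close>, standing for the formal adjoint of \<open>x\<close>.
\<close>

definition free_star_algebra :: "'x set \<Rightarrow> (('x \<times> bool) list \<Rightarrow>\<^sub>0 complex) star_algebra"
  where "free_star_algebra X =
    monoid_star_algebra
      \<lparr>carrier = lists (X \<times> UNIV), mult = (@), one = []\<rparr>
      (\<lambda>w. rev (map (\<lambda>(x, b). (x, \<not> b)) w))"

definition free_gen :: "'x \<Rightarrow> ('x \<times> bool) list \<Rightarrow>\<^sub>0 complex"
  where "free_gen x = Poly_Mapping.single [(x, False)] 1"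

text \<open>Relations in \<open>F\<close> expressing that \<open>\<phi>\<close> is a unital \<open>*\<close>-homomorphism on \<open>A\<close>.\<close>

definition hom_relations ::
  "('a, 'c) star_algebra_scheme \<Rightarrow> ('f, 'd) star_algebra_scheme \<Rightarrow> ('a \<Rightarrow> 'f) \<Rightarrow> 'f set"
  where "hom_relations A F \<phi> =
     {\<phi> (a \<oplus>\<^bsub>A\<^esub> b) \<ominus>\<^bsub>F\<^esub> (\<phi> a \<oplus>\<^bsub>F\<^esub> \<phi> b) | a b. a \<in> carrier A \<and> b \<in> carrier A} \<union>
     {\<phi> (c \<odot>\<^bsub>A\<^esub> a) \<ominus>\<^bsub>F\<^esub> (c \<odot>\<^bsub>F\<^esub> \<phi> a) | c a. a \<in> carrier A} \<union>
     {\<phi> (a \<otimes>\<^bsub>A\<^esub> b) \<ominus>\<^bsub>F\<^esub> (\<phi> a \<otimes>\<^bsub>F\<^esub> \<phi> b) | a b. a \<in> carrier A \<and> b \<in> carrier A} \<union>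
     {\<phi> \<one>\<^bsub>A\<^esub> \<ominus>\<^bsub>F\<^esub> \<one>\<^bsub>F\<^esub>} \<union>
     {\<phi> (star A a) \<ominus>\<^bsub>F\<^esub> star F (\<phi> a) | a. a \<in> carrier A}"


subsection \<open>Free products\<close>

definition free_prod_rels ::
  "('a, 'c) star_algebra_scheme \<Rightarrow> ('b, 'd) star_algebra_scheme \<Rightarrow>
   ((('a + 'b) \<times> bool) list \<Rightarrow>\<^sub>0 complex) set"
  where "free_prod_rels A B = (let F = free_star_algebra (carrier A <+> carrier B) in
     hom_relations A F (\<lambda>a. free_gen (Inl a)) \<union> hom_relations B F (\<lambda>b. free_gen (Inr b)))"

definition free_prod ::
  "('a, 'c) star_algebra_scheme \<Rightarrow> ('b, 'd) star_algebra_scheme \<Rightarrow>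
   ((('a + 'b) \<times> bool) list \<Rightarrow>\<^sub>0 complex) set star_algebra"
  where "free_prod A B =
     star_quot (free_star_algebra (carrier A <+> carrier B)) (free_prod_rels A B)"

definition free_inl ::
  "('a, 'c) star_algebra_scheme \<Rightarrow> ('b, 'd) star_algebra_scheme \<Rightarrow> 'a \<Rightarrow>
   ((('a + 'b) \<times> bool) list \<Rightarrow>\<^sub>0 complex) set"
  where "free_inl A B a =
     star_class (free_star_algebra (carrier A <+> carrier B)) (free_prod_rels A B) (free_gen (Inl a))"

definition free_inr ::
  "('a, 'c) star_algebra_scheme \<Rightarrow> ('b, 'd) star_algebra_scheme \<Rightarrow> 'b \<Rightarrow>
   ((('a + 'b) \<times> bool) list \<Rightarrow>\<^sub>0 complex) set"
  where "free_inr A B b =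
     star_class (free_star_algebra (carrier A <+> carrier B)) (free_prod_rels A B) (free_gen (Inr b))"

text \<open>
  The \<open>N\<close>-fold free product of \<open>A\<close> amalgamated over the subalgebra with underlying set \<open>B\<close>;
  the generator \<open>(i, a)\<close> is the element \<open>a\<close> of the \<open>i\<close>-th copy of \<open>A\<close>.
\<close>

definition amalg_rels ::
  "nat \<Rightarrow> ('a, 'c) star_algebra_scheme \<Rightarrow> 'a set \<Rightarrow> (((nat \<times> 'a) \<times> bool) list \<Rightarrow>\<^sub>0 complex) set"
  where "amalg_rels N A B = (let F = free_star_algebra ({1..N} \<times> carrier A) in
     (\<Union>i\<in>{1..N}. hom_relations A F (\<lambda>a. free_gen (i, a))) \<union>
     {free_gen (i, b) \<ominus>\<^bsub>F\<^esub> free_gen (j, b) | i j b. i \<in> {1..N} \<and> j \<in> {1..N} \<and> b \<in> B})"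

definition amalg_power ::
  "nat \<Rightarrow> ('a, 'c) star_algebra_scheme \<Rightarrow> 'a set \<Rightarrow>
   (((nat \<times> 'a) \<times> bool) list \<Rightarrow>\<^sub>0 complex) set star_algebra"
  where "amalg_power N A B = star_quot (free_star_algebra ({1..N} \<times> carrier A)) (amalg_rels N A B)"

definition amalg_copy ::
  "nat \<Rightarrow> ('a, 'c) star_algebra_scheme \<Rightarrow> 'a set \<Rightarrow> nat \<Rightarrow> 'a \<Rightarrow>
   (((nat \<times> 'a) \<times> bool) list \<Rightarrow>\<^sub>0 complex) set"
  where "amalg_copy N A B i a =
     star_class (free_star_algebra ({1..N} \<times> carrier A)) (amalg_rels N A B) (free_gen (i, a))"


subsection \<open>Tensor products\<close>

text \<open>
  The algebraic tensor product over \<open>\<complex>\<close>: the free vector space on pairs \<open>(a, b)\<close>, with product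
  \<open>(a, b)(a', b') = (aa', bb')\<close> and \<open>(a, b)\<^sup>* = (a\<^sup>*, b\<^sup>*)\<close>, modulo the bilinearity relations. The
  linear span of these relations is already a two-sided \<open>*\<close>-ideal, so the underlying vector space
  is the usual tensor product.
\<close>

type_synonym ('a, 'b) tensor = "('a \<times> 'b \<Rightarrow>\<^sub>0 complex) set"

definition pair_algebra ::
  "('a, 'c) star_algebra_scheme \<Rightarrow> ('b, 'd) star_algebra_scheme \<Rightarrow> ('a \<times> 'b \<Rightarrow>\<^sub>0 complex) star_algebra"
  where "pair_algebra A B = monoid_star_algebra (A \<times>\<times> B) (map_prod (star A) (star B))"

definition bilinear_rels ::
  "('a, 'c) star_algebra_scheme \<Rightarrow> ('b, 'd) star_algebra_scheme \<Rightarrow> ('a \<times> 'b \<Rightarrow>\<^sub>0 complex) set"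
  where "bilinear_rels A B = (let e = (\<lambda>a b. Poly_Mapping.single (a, b) (1::complex)) in
     {e (a \<oplus>\<^bsub>A\<^esub> a') b - e a b - e a' b | a a' b. a \<in> carrier A \<and> a' \<in> carrier A \<and> b \<in> carrier B} \<union>
     {e a (b \<oplus>\<^bsub>B\<^esub> b') - e a b - e a b' | a b b'. a \<in> carrier A \<and> b \<in> carrier B \<and> b' \<in> carrier B} \<union>
     {e (c \<odot>\<^bsub>A\<^esub> a) b - Poly_Mapping.single (a, b) c | c a b. a \<in> carrier A \<and> b \<in> carrier B} \<union>
     {e a (c \<odot>\<^bsub>B\<^esub> b) - Poly_Mapping.single (a, b) c | c a b. a \<in> carrier A \<and> b \<in> carrier B})"

definition tensor_algebra ::
  "('a, 'c) star_algebra_scheme \<Rightarrow> ('b, 'd) star_algebra_scheme \<Rightarrow> ('a, 'b) tensor star_algebra"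
  where "tensor_algebra A B = star_quot (pair_algebra A B) (bilinear_rels A B)"

definition pure_tensor ::
  "('a, 'c) star_algebra_scheme \<Rightarrow> ('b, 'd) star_algebra_scheme \<Rightarrow> 'a \<Rightarrow> 'b \<Rightarrow> ('a, 'b) tensor"
  where "pure_tensor A B a b =
     star_class (pair_algebra A B) (bilinear_rels A B) (Poly_Mapping.single (a, b) 1)"

definition tensor_map ::
  "('a, 'c) star_algebra_scheme \<Rightarrow> ('b, 'd) star_algebra_scheme \<Rightarrow>
   ('a1, 'c1) star_algebra_scheme \<Rightarrow> ('b1, 'd1) star_algebra_scheme \<Rightarrow>
   ('a \<Rightarrow> 'a1) \<Rightarrow> ('b \<Rightarrow> 'b1) \<Rightarrow> ('a, 'b) tensor \<Rightarrow> ('a1, 'b1) tensor"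
  where "tensor_map A B A1 B1 f g =
     the_star_hom (tensor_algebra A B) (tensor_algebra A1 B1)
       (\<lambda>h. \<forall>a\<in>carrier A. \<forall>b\<in>carrier B. h (pure_tensor A B a b) = pure_tensor A1 B1 (f a) (g b))"


section \<open>Compact quantum groups\<close>

text \<open>
  A compact quantum group is represented by its \<open>*\<close>-algebra of coefficients and its coproduct;
  counit and antipode of a Hopf algebra are determined by these, and are preserved by every
  homomorphism that preserves them.
\<close>

record 'a quantum_group = "'a star_algebra" +
  comult :: "'a \<Rightarrow> ('a, 'a) tensor"

definition with_comult :: "'a star_algebra \<Rightarrow> ('a \<Rightarrow> ('a, 'a) tensor) \<Rightarrow> 'a quantum_group"
  where "with_comult A \<Delta> = star_algebra.extend A (quantum_group.fields \<Delta>)"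

definition hopf_star_hom ::
  "('a, 'c) quantum_group_scheme \<Rightarrow> ('b, 'd) quantum_group_scheme \<Rightarrow> ('a \<Rightarrow> 'b) \<Rightarrow> bool"
  where "hopf_star_hom G K \<pi> \<longleftrightarrow>
     star_hom G K \<pi> \<and>
     (\<forall>x\<in>carrier G. comult K (\<pi> x) = tensor_map G G K K \<pi> \<pi> (comult G x))"

definition quantum_subgroup ::
  "('a, 'c) quantum_group_scheme \<Rightarrow> ('b, 'd) quantum_group_scheme \<Rightarrow> ('a \<Rightarrow> 'b) \<Rightarrow> bool"
  where "quantum_subgroup G K \<pi> \<longleftrightarrow> hopf_star_hom G K \<pi> \<and> \<pi> ` carrier G = carrier K"

text \<open>An \<open>n \<times> n\<close> matrix \<open>v\<close> is a function of two indices; only indices in \<open>{1..n}\<close> matter.\<close>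

definition representation ::
  "('a, 'c) quantum_group_scheme \<Rightarrow> nat \<Rightarrow> (nat \<Rightarrow> nat \<Rightarrow> 'a) \<Rightarrow> bool"
  where "representation G n v \<longleftrightarrow>
     (\<forall>i\<in>{1..n}. \<forall>j\<in>{1..n}. v i j \<in> carrier G) \<and>
     (\<exists>w. (\<forall>i\<in>{1..n}. \<forall>j\<in>{1..n}. w i j \<in> carrier G) \<and>
        (\<forall>i\<in>{1..n}. \<forall>j\<in>{1..n}.
           (\<Oplus>\<^bsub>G\<^esub>k\<in>{1..n}. v i k \<otimes>\<^bsub>G\<^esub> w k j) = (if i = j then \<one>\<^bsub>G\<^esub> else \<zero>\<^bsub>G\<^esub>) \<and>
           (\<Oplus>\<^bsub>G\<^esub>k\<in>{1..n}. w i k \<otimes>\<^bsub>G\<^esub> v k j) = (if i = j then \<one>\<^bsub>G\<^esub> else \<zero>\<^bsub>G\<^esub>))) \<and>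
     (\<forall>i\<in>{1..n}. \<forall>j\<in>{1..n}.
        comult G (v i j) =
          (\<Oplus>\<^bsub>tensor_algebra G G\<^esub>k\<in>{1..n}. pure_tensor G G (v i k) (v k j)))"

text \<open>
  Linear maps \<open>T : \<complex>\<^sup>n \<rightarrow> \<complex>\<^sup>m\<close> with \<open>T v = w T\<close>, as \<open>m \<times> n\<close> matrices extended by zero.
\<close>

definition Mor ::
  "('a, 'c) star_algebra_scheme \<Rightarrow> nat \<Rightarrow> (nat \<Rightarrow> nat \<Rightarrow> 'a) \<Rightarrow> nat \<Rightarrow> (nat \<Rightarrow> nat \<Rightarrow> 'a) \<Rightarrow>
   (nat \<Rightarrow> nat \<Rightarrow> complex) set"
  where "Mor G n v m w =
     {T. (\<forall>i j. i \<notin> {1..m} \<or> j \<notin> {1..n} \<longrightarrow> T i j = 0) \<and>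
         (\<forall>i\<in>{1..m}. \<forall>j\<in>{1..n}.
            (\<Oplus>\<^bsub>G\<^esub>k\<in>{1..n}. T i k \<odot>\<^bsub>G\<^esub> v k j) = (\<Oplus>\<^bsub>G\<^esub>k\<in>{1..m}. T k j \<odot>\<^bsub>G\<^esub> w i k))}"

text \<open>
  Topological generation by a family of two quantum subgroups, given by \<open>\<pi>\<^sub>1\<close> and \<open>\<pi>\<^sub>2\<close>. The two are
  separate arguments since their algebras have different types.
\<close>

definition topologically_generated_by_two ::
  "('a, 'c) quantum_group_scheme \<Rightarrow>
   ('b1, 'd1) quantum_group_scheme \<Rightarrow> ('a \<Rightarrow> 'b1) \<Rightarrow>
   ('b2, 'd2) quantum_group_scheme \<Rightarrow> ('a \<Rightarrow> 'b2) \<Rightarrow> bool"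
  where "topologically_generated_by_two G H1 \<pi>1 H2 \<pi>2 \<longleftrightarrow>
     quantum_subgroup G H1 \<pi>1 \<and> quantum_subgroup G H2 \<pi>2 \<and>
     (\<forall>n u m v. representation G n u \<longrightarrow> representation G m v \<longrightarrow>
        Mor G n u m v =
          Mor H1 n (\<lambda>i j. \<pi>1 (u i j)) m (\<lambda>i j. \<pi>1 (v i j)) \<inter>
          Mor H2 n (\<lambda>i j. \<pi>2 (u i j)) m (\<lambda>i j. \<pi>2 (v i j)))"

text \<open>
  The product \<open>G \<times> H\<close> has algebra \<open>\<O>(G) \<otimes> \<O>(H)\<close> with the coproduct for which \<open>a \<mapsto> a \<otimes> 1\<close> and
  \<open>b \<mapsto> 1 \<otimes> b\<close> preserve coproducts.
\<close>

definition product_quantum_group ::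
  "('a, 'c) quantum_group_scheme \<Rightarrow> ('b, 'd) quantum_group_scheme \<Rightarrow> ('a, 'b) tensor quantum_group"
  where "product_quantum_group G H =
    (let P = tensor_algebra G H;
         inl = (\<lambda>a. pure_tensor G H a \<one>\<^bsub>H\<^esub>);
         inr = (\<lambda>b. pure_tensor G H \<one>\<^bsub>G\<^esub> b)
     in with_comult P
       (the_star_hom P (tensor_algebra P P)
          (\<lambda>\<Delta>. (\<forall>a\<in>carrier G. \<Delta> (inl a) = tensor_map G G P P inl inl (comult G a)) \<and>
               (\<forall>b\<in>carrier H. \<Delta> (inr b) = tensor_map H H P P inr inr (comult H b)))))"

definition dual_group :: "('g, 'c) monoid_scheme \<Rightarrow> ('g \<Rightarrow>\<^sub>0 complex) quantum_group"
  where "dual_group \<Gamma> = (let A = group_algebra \<Gamma> in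
     with_comult A
       (the_star_hom A (tensor_algebra A A)
          (\<lambda>\<Delta>. \<forall>g\<in>carrier \<Gamma>. \<Delta> (group_elem g) = pure_tensor A A (group_elem g) (group_elem g))))"


subsection \<open>The quantum permutation group \<open>S\<^sub>N\<^sup>+\<close>\<close>

type_synonym qperm_elem = "(((nat \<times> nat) \<times> bool) list \<Rightarrow>\<^sub>0 complex) set"

definition qperm_rels :: "nat \<Rightarrow> (((nat \<times> nat) \<times> bool) list \<Rightarrow>\<^sub>0 complex) set"
  where "qperm_rels N =
    (let F = free_star_algebra ({1..N} \<times> {1..N});
         p = (\<lambda>i j. free_gen (i, j))
     in
     {p i j \<otimes>\<^bsub>F\<^esub> p i j \<ominus>\<^bsub>F\<^esub> p i j | i j. i \<in> {1..N} \<and> j \<in> {1..N}} \<union>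
     {star F (p i j) \<ominus>\<^bsub>F\<^esub> p i j | i j. i \<in> {1..N} \<and> j \<in> {1..N}} \<union>
     {(\<Oplus>\<^bsub>F\<^esub>k\<in>{1..N}. p i k) \<ominus>\<^bsub>F\<^esub> \<one>\<^bsub>F\<^esub> | i. i \<in> {1..N}} \<union>
     {(\<Oplus>\<^bsub>F\<^esub>k\<in>{1..N}. p k j) \<ominus>\<^bsub>F\<^esub> \<one>\<^bsub>F\<^esub> | j. j \<in> {1..N}} \<union>
     {p i k \<otimes>\<^bsub>F\<^esub> p j k \<ominus>\<^bsub>F\<^esub> (if i = j then p i k else \<zero>\<^bsub>F\<^esub>)
        | i j k. i \<in> {1..N} \<and> j \<in> {1..N} \<and> k \<in> {1..N}} \<union>
     {p k i \<otimes>\<^bsub>F\<^esub> p k j \<ominus>\<^bsub>F\<^esub> (if i = j then p k i else \<zero>\<^bsub>F\<^esub>)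
        | i j k. i \<in> {1..N} \<and> j \<in> {1..N} \<and> k \<in> {1..N}})"

definition qperm_algebra :: "nat \<Rightarrow> qperm_elem star_algebra"
  where "qperm_algebra N = star_quot (free_star_algebra ({1..N} \<times> {1..N})) (qperm_rels N)"

definition qperm_gen :: "nat \<Rightarrow> nat \<Rightarrow> nat \<Rightarrow> qperm_elem"
  where "qperm_gen N i j =
     star_class (free_star_algebra ({1..N} \<times> {1..N})) (qperm_rels N) (free_gen (i, j))"

definition quantum_perm_group :: "nat \<Rightarrow> qperm_elem quantum_group"
  where "quantum_perm_group N =
    (let A = qperm_algebra N; AA = tensor_algebra A A in
     with_comult A
       (the_star_hom A AA
          (\<lambda>\<Delta>. \<forall>i\<in>{1..N}. \<forall>j\<in>{1..N}.
             \<Delta> (qperm_gen N i j) =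
               (\<Oplus>\<^bsub>AA\<^esub>k\<in>{1..N}. pure_tensor A A (qperm_gen N i k) (qperm_gen N k j)))))"


subsection \<open>Amalgamated free wreath products\<close>

type_synonym 'g amalg_elem = "(((nat \<times> ('g \<Rightarrow>\<^sub>0 complex)) \<times> bool) list \<Rightarrow>\<^sub>0 complex) set"

type_synonym 'g prewreath_elem = "((('g amalg_elem + qperm_elem) \<times> bool) list \<Rightarrow>\<^sub>0 complex) set"

type_synonym 'g wreath_elem = "'g prewreath_elem set"

definition subgroup_algebra_set :: "('g, 'c) monoid_scheme \<Rightarrow> 'g set \<Rightarrow> ('g \<Rightarrow>\<^sub>0 complex) set"
  where "subgroup_algebra_set \<Gamma> \<Lambda> = carrier (group_algebra (\<Gamma>\<lparr>carrier := \<Lambda>\<rparr>))"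

definition group_amalg :: "('g, 'c) monoid_scheme \<Rightarrow> 'g set \<Rightarrow> nat \<Rightarrow> 'g amalg_elem star_algebra"
  where "group_amalg \<Gamma> \<Lambda> N = amalg_power N (group_algebra \<Gamma>) (subgroup_algebra_set \<Gamma> \<Lambda>)"

definition prewreath_algebra ::
  "('g, 'c) monoid_scheme \<Rightarrow> 'g set \<Rightarrow> nat \<Rightarrow> 'g prewreath_elem star_algebra"
  where "prewreath_algebra \<Gamma> \<Lambda> N = free_prod (group_amalg \<Gamma> \<Lambda> N) (qperm_algebra N)"

definition prewreath_nu ::
  "('g, 'c) monoid_scheme \<Rightarrow> 'g set \<Rightarrow> nat \<Rightarrow> nat \<Rightarrow> ('g \<Rightarrow>\<^sub>0 complex) \<Rightarrow> 'g prewreath_elem"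
  where "prewreath_nu \<Gamma> \<Lambda> N i x =
     free_inl (group_amalg \<Gamma> \<Lambda> N) (qperm_algebra N)
       (amalg_copy N (group_algebra \<Gamma>) (subgroup_algebra_set \<Gamma> \<Lambda>) i x)"

definition prewreath_p ::
  "('g, 'c) monoid_scheme \<Rightarrow> 'g set \<Rightarrow> nat \<Rightarrow> nat \<Rightarrow> nat \<Rightarrow> 'g prewreath_elem"
  where "prewreath_p \<Gamma> \<Lambda> N i j =
     free_inr (group_amalg \<Gamma> \<Lambda> N) (qperm_algebra N) (qperm_gen N i j)"

definition wreath_rels :: "('g, 'c) monoid_scheme \<Rightarrow> 'g set \<Rightarrow> nat \<Rightarrow> 'g prewreath_elem set"
  where "wreath_rels \<Gamma> \<Lambda> N =
    (let W = prewreath_algebra \<Gamma> \<Lambda> N; \<nu> = prewreath_nu \<Gamma> \<Lambda> N; p = prewreath_p \<Gamma> \<Lambda> N in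
     {(\<nu> i x \<otimes>\<^bsub>W\<^esub> p i j) \<ominus>\<^bsub>W\<^esub> (p i j \<otimes>\<^bsub>W\<^esub> \<nu> i x)
        | i j x. i \<in> {1..N} \<and> j \<in> {1..N} \<and> x \<in> carrier (group_algebra \<Gamma>)})"

definition wreath_algebra ::
  "('g, 'c) monoid_scheme \<Rightarrow> 'g set \<Rightarrow> nat \<Rightarrow> 'g wreath_elem star_algebra"
  where "wreath_algebra \<Gamma> \<Lambda> N = star_quot (prewreath_algebra \<Gamma> \<Lambda> N) (wreath_rels \<Gamma> \<Lambda> N)"

definition wreath_nu ::
  "('g, 'c) monoid_scheme \<Rightarrow> 'g set \<Rightarrow> nat \<Rightarrow> nat \<Rightarrow> ('g \<Rightarrow>\<^sub>0 complex) \<Rightarrow> 'g wreath_elem"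
  where "wreath_nu \<Gamma> \<Lambda> N i x =
     star_class (prewreath_algebra \<Gamma> \<Lambda> N) (wreath_rels \<Gamma> \<Lambda> N) (prewreath_nu \<Gamma> \<Lambda> N i x)"

definition wreath_p ::
  "('g, 'c) monoid_scheme \<Rightarrow> 'g set \<Rightarrow> nat \<Rightarrow> nat \<Rightarrow> nat \<Rightarrow> 'g wreath_elem"
  where "wreath_p \<Gamma> \<Lambda> N i j =
     star_class (prewreath_algebra \<Gamma> \<Lambda> N) (wreath_rels \<Gamma> \<Lambda> N) (prewreath_p \<Gamma> \<Lambda> N i j)"

definition amalg_free_wreath ::
  "('g, 'c) monoid_scheme \<Rightarrow> 'g set \<Rightarrow> nat \<Rightarrow> 'g wreath_elem quantum_group"
  where "amalg_free_wreath \<Gamma> \<Lambda> N =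
    (let A = wreath_algebra \<Gamma> \<Lambda> N; AA = tensor_algebra A A;
         \<nu> = wreath_nu \<Gamma> \<Lambda> N; p = wreath_p \<Gamma> \<Lambda> N
     in with_comult A
       (the_star_hom A AA
          (\<lambda>\<Delta>. (\<forall>i\<in>{1..N}. \<forall>j\<in>{1..N}.
                  \<Delta> (p i j) = (\<Oplus>\<^bsub>AA\<^esub>k\<in>{1..N}. pure_tensor A A (p i k) (p k j))) \<and>
               (\<forall>i\<in>{1..N}. \<forall>g\<in>carrier \<Gamma>.
                  \<Delta> (\<nu> i (group_elem g)) =
                    (\<Oplus>\<^bsub>AA\<^esub>k\<in>{1..N}.
                       pure_tensor A A (\<nu> i (group_elem g) \<otimes>\<^bsub>A\<^esub> p i k) (\<nu> k (group_elem g)))))))"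

definition free_wreath :: "('g, 'c) monoid_scheme \<Rightarrow> nat \<Rightarrow> 'g wreath_elem quantum_group"
  where "free_wreath \<Theta> N = amalg_free_wreath \<Theta> {\<one>\<^bsub>\<Theta>\<^esub>} N"


subsection \<open>The two quantum subgroups\<close>

definition wreath_to_product ::
  "('g, 'c) monoid_scheme \<Rightarrow> 'g set \<Rightarrow> nat \<Rightarrow> 'g wreath_elem \<Rightarrow> ('g \<Rightarrow>\<^sub>0 complex, qperm_elem) tensor"
  where "wreath_to_product \<Gamma> \<Lambda> N =
    (let A = group_algebra \<Gamma>; S = qperm_algebra N in
     the_star_hom (wreath_algebra \<Gamma> \<Lambda> N) (tensor_algebra A S)
       (\<lambda>\<pi>. (\<forall>i\<in>{1..N}. \<forall>g\<in>carrier \<Gamma>.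
               \<pi> (wreath_nu \<Gamma> \<Lambda> N i (group_elem g)) = pure_tensor A S (group_elem g) \<one>\<^bsub>S\<^esub>) \<and>
            (\<forall>i\<in>{1..N}. \<forall>j\<in>{1..N}.
               \<pi> (wreath_p \<Gamma> \<Lambda> N i j) = pure_tensor A S \<one>\<^bsub>A\<^esub> (qperm_gen N i j))))"

definition wreath_to_quotient ::
  "('g, 'c) monoid_scheme \<Rightarrow> 'g set \<Rightarrow> nat \<Rightarrow> 'g wreath_elem \<Rightarrow> 'g set wreath_elem"
  where "wreath_to_quotient \<Gamma> \<Lambda> N =
    (let \<Theta> = \<Gamma> Mod \<Lambda> in
     the_star_hom (wreath_algebra \<Gamma> \<Lambda> N) (free_wreath \<Theta> N)
       (\<lambda>\<pi>. (\<forall>i\<in>{1..N}. \<forall>g\<in>carrier \<Gamma>.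
               \<pi> (wreath_nu \<Gamma> \<Lambda> N i (group_elem g)) =
                 wreath_nu \<Theta> {\<one>\<^bsub>\<Theta>\<^esub>} N i (group_elem (\<Lambda> #>\<^bsub>\<Gamma>\<^esub> g))) \<and>
            (\<forall>i\<in>{1..N}. \<forall>j\<in>{1..N}.
               \<pi> (wreath_p \<Gamma> \<Lambda> N i j) = wreath_p \<Theta> {\<one>\<^bsub>\<Theta>\<^esub>} N i j)))"

end

theory Submission
  imports Defs
begin

text \<open>
  Let \<open>A = \<O>(\<Gamma> \<wr> S\<^sub>N\<^sup>+)\<close> be the amalgamated algebra and \<open>\<chi> : A \<rightarrow> \<complex>[\<Gamma>]\<close> the composite of \<open>\<pi>\<^sub>1\<close> with
  \<open>id \<otimes> \<epsilon>\<close>. A matrix that intertwines both \<open>\<pi>\<^sub>1(u), \<pi>\<^sub>1(v)\<close> and \<open>\<pi>\<^sub>2(u), \<pi>\<^sub>2(v)\<close> intertwines \<open>\<alpha>(u), \<alpha>(v)\<close> for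
  \<open>\<alpha> = (\<chi> \<otimes> \<pi>\<^sub>2)\<Delta>\<close>, so it suffices that \<open>\<alpha>\<close> is injective. The algebra \<open>A\<close> is \<open>\<Gamma>\<close>-graded and \<open>\<alpha>(a) = g \<otimes> \<pi>\<^sub>2(a)\<close>
  for \<open>a\<close> of degree \<open>g\<close>. The kernel of \<open>\<pi>\<^sub>2\<close> is the ideal generated by the elements \<open>\<lambda> - 1\<close> with \<open>\<lambda> \<in> \<Lambda>\<close>.
  Let \<open>s\<close> choose a representative in each coset of \<open>\<Lambda>\<close>. As \<open>\<lambda>a = a(g\<^sup>-\<^sup>1\<lambda>g)\<close> for \<open>a\<close> of degree \<open>g\<close>, the linear
  map \<open>L(a) = a g\<^sup>-\<^sup>1s(g)\<close> vanishes on that ideal. It is injective on each homogeneous component, so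
  \<open>\<pi>\<^sub>2\<close> is injective there too, and \<open>\<alpha>\<close> is injective.
\<close>

section \<open>Star algebras and their homomorphisms\<close>

text \<open>The obstacle is that \<open>\<pi>2\<close> forgets the \<Lambda>-part of a degree: its
  kernel contains \<lambda> - 1, a difference of elements of degrees \<lambda> and 1. The factor
  \<chi> keeps the degree that is lost. A common intertwiner passes to \<alpha> by moving it through
  a matrix product, as \<alpha>(u_ij) is the sum over k of \<chi>(u_ik) \<otimes>
  \<open>\<pi>2\<close>(u_kj). For the injectivity of \<alpha> it suffices that homogeneous elements
  span, because a linear left inverse can be written down: L factors through \<open>\<pi>2\<close>,
  the first tensor factor remembers g, and multiplying a g^-1 s(g) by s(g)^-1 g returns a. Both g^-1
  s(g) and its inverse lie in \<Lambda>, where all copies of \<Gamma> agree. Normality lets elements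
  of \<Lambda> be moved across homogeneous elements. Most of the work before that serves existence.
  The coproducts and the two surjections are defined as the unique homomorphisms with prescribed
  values, so each of them rests on a universal property of free algebras, quotients, tensor products
  or wreath products.\<close>

locale star_alg = ring A for A :: "('a, 'c) star_algebra_scheme" (structure) +
  assumes smult_closed [simp, intro]: "x \<in> carrier A \<Longrightarrow> c \<odot> x \<in> carrier A"
    and star_closed [simp, intro]: "x \<in> carrier A \<Longrightarrow> star A x \<in> carrier A"
    and smult_add: "x \<in> carrier A \<Longrightarrow> y \<in> carrier A \<Longrightarrow> c \<odot> (x \<oplus> y) = c \<odot> x \<oplus> c \<odot> y"
    and add_smult: "x \<in> carrier A \<Longrightarrow> (c + d) \<odot> x = c \<odot> x \<oplus> d \<odot> x"
    and smult_smult: "x \<in> carrier A \<Longrightarrow> c \<odot> (d \<odot> x) = (c * d) \<odot> x"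
    and smult_one [simp]: "x \<in> carrier A \<Longrightarrow> 1 \<odot> x = x"
    and smult_mult: "x \<in> carrier A \<Longrightarrow> y \<in> carrier A \<Longrightarrow> (c \<odot> x) \<otimes> y = c \<odot> (x \<otimes> y)"
    and mult_smult: "x \<in> carrier A \<Longrightarrow> y \<in> carrier A \<Longrightarrow> x \<otimes> (c \<odot> y) = c \<odot> (x \<otimes> y)"
    and star_star [simp]: "x \<in> carrier A \<Longrightarrow> star A (star A x) = x"
    and star_add: "x \<in> carrier A \<Longrightarrow> y \<in> carrier A \<Longrightarrow> star A (x \<oplus> y) = star A x \<oplus> star A y"
    and star_smult: "x \<in> carrier A \<Longrightarrow> star A (c \<odot> x) = cnj c \<odot> star A x"
    and star_mult: "x \<in> carrier A \<Longrightarrow> y \<in> carrier A \<Longrightarrow> star A (x \<otimes> y) = star A y \<otimes> star A x"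
begin

lemma diff_eq_zero_iff: "x \<in> carrier A \<Longrightarrow> y \<in> carrier A \<Longrightarrow> x \<ominus> y = \<zero> \<longleftrightarrow> x = y"
  by (metis a_minus_def add.inv_solve_right l_zero zero_closed)

lemma zero_smult [simp]: "x \<in> carrier A \<Longrightarrow> 0 \<odot> x = \<zero>"
  using add_smult[of x 0 0] by (metis add_0 local.smult_closed add.l_cancel_one)

lemma smult_zero [simp]: "c \<odot> \<zero> = \<zero>"
  using smult_add[of \<zero> \<zero> c] by (metis add.l_cancel_one add.r_one smult_closed zero_closed)

lemma minus_one_smult: "x \<in> carrier A \<Longrightarrow> (- 1) \<odot> x = \<ominus> x"
  using add_smult[of x "- 1" 1] by (simp add: minus_equality)

lemma smult_minus: "x \<in> carrier A \<Longrightarrow> c \<odot> (\<ominus> x) = \<ominus> (c \<odot> x)"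
  by (simp add: smult_smult flip: minus_one_smult)

lemma smult_diff: "x \<in> carrier A \<Longrightarrow> y \<in> carrier A \<Longrightarrow> c \<odot> (x \<ominus> y) = c \<odot> x \<ominus> c \<odot> y"
  by (simp add: a_minus_def smult_add smult_minus)

lemma star_zero [simp]: "star A \<zero> = \<zero>"
  using star_smult[of \<zero> 0] by simp

text \<open>Star is an antimultiplicative bijection, so it carries the unit to a unit.\<close>

lemma star_one [simp]: "star A \<one> = \<one>"
  by (metis l_one local.star_closed one_closed r_one star_mult star_star)

lemma star_minus: "x \<in> carrier A \<Longrightarrow> star A (\<ominus> x) = \<ominus> star A x"
  by (simp add: star_smult flip: minus_one_smult)

lemma star_diff: "x \<in> carrier A \<Longrightarrow> y \<in> carrier A \<Longrightarrow> star A (x \<ominus> y) = star A x \<ominus> star A y"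
  by (simp add: a_minus_def star_add star_minus)

lemma smult_finsum:
  "finite S \<Longrightarrow> f \<in> S \<rightarrow> carrier A \<Longrightarrow> c \<odot> (\<Oplus>i\<in>S. f i) = (\<Oplus>i\<in>S. c \<odot> f i)"
  by (induction S rule: finite_induct) (auto simp: Pi_def smult_add)

lemma star_finsum:
  "finite S \<Longrightarrow> f \<in> S \<rightarrow> carrier A \<Longrightarrow> star A (\<Oplus>i\<in>S. f i) = (\<Oplus>i\<in>S. star A (f i))"
  by (induction S rule: finite_induct) (auto simp: Pi_def star_add)

text \<open>Negatives come for free: \<open>\<ominus> x\<close> is \<open>\<ominus> \<one>\<close>
  times \<open>x\<close>.\<close>

lemma ideal_by_closure:
  assumes "I \<subseteq> carrier A" "\<zero> \<in> I" "\<And>x y. x \<in> I \<Longrightarrow> y \<in> I \<Longrightarrow> x \<oplus> y \<in> I"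
    and "\<And>a x. a \<in> I \<Longrightarrow> x \<in> carrier A \<Longrightarrow> x \<otimes> a \<in> I"
    and "\<And>a x. a \<in> I \<Longrightarrow> x \<in> carrier A \<Longrightarrow> a \<otimes> x \<in> I"
  shows "ideal I A"
proof (rule idealI)
  have "\<ominus> x \<in> I" if "x \<in> I" for x
    using assms(4)[OF that, of "\<ominus> \<one>"] that assms(1) l_minus[of \<one> x] by auto
  then show "subgroup I (add_monoid A)"
    using assms by (intro group.subgroupI) (auto simp: a_group a_inv_def)
qed (use assms ring_axioms in auto)

end

lemma star_homD:
  assumes "star_hom A B f"
  shows star_hom_closed: "x \<in> carrier A \<Longrightarrow> f x \<in> carrier B"
    and star_hom_add: "x \<in> carrier A \<Longrightarrow> y \<in> carrier A \<Longrightarrow> f (x \<oplus>\<^bsub>A\<^esub> y) = f x \<oplus>\<^bsub>B\<^esub> f y"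
    and star_hom_mult: "x \<in> carrier A \<Longrightarrow> y \<in> carrier A \<Longrightarrow> f (x \<otimes>\<^bsub>A\<^esub> y) = f x \<otimes>\<^bsub>B\<^esub> f y"
    and star_hom_one: "f \<one>\<^bsub>A\<^esub> = \<one>\<^bsub>B\<^esub>"
    and star_hom_smult: "x \<in> carrier A \<Longrightarrow> f (c \<odot>\<^bsub>A\<^esub> x) = c \<odot>\<^bsub>B\<^esub> f x"
    and star_hom_star: "x \<in> carrier A \<Longrightarrow> f (star A x) = star B (f x)"
  using assms by (auto simp: star_hom_def ring_hom_def)

lemma star_homI:
  assumes "\<And>x. x \<in> carrier A \<Longrightarrow> f x \<in> carrier B"
    and "\<And>x y. x \<in> carrier A \<Longrightarrow> y \<in> carrier A \<Longrightarrow> f (x \<oplus>\<^bsub>A\<^esub> y) = f x \<oplus>\<^bsub>B\<^esub> f y"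
    and "\<And>x y. x \<in> carrier A \<Longrightarrow> y \<in> carrier A \<Longrightarrow> f (x \<otimes>\<^bsub>A\<^esub> y) = f x \<otimes>\<^bsub>B\<^esub> f y"
    and "f \<one>\<^bsub>A\<^esub> = \<one>\<^bsub>B\<^esub>"
    and "\<And>c x. x \<in> carrier A \<Longrightarrow> f (c \<odot>\<^bsub>A\<^esub> x) = c \<odot>\<^bsub>B\<^esub> f x"
    and "\<And>x. x \<in> carrier A \<Longrightarrow> f (star A x) = star B (f x)"
  shows "star_hom A B f"
  using assms by (auto simp: star_hom_def ring_hom_def)

lemma star_hom_comp:
  "star_hom A B f \<Longrightarrow> star_hom B C g \<Longrightarrow> star_hom A C (\<lambda>x. g (f x))"
  by (rule star_homI) (simp_all add: star_homD)

lemma star_hom_id: "star_hom A A (\<lambda>x. x)"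
  by (rule star_homI) simp_all

locale star_alg_hom = A: star_alg A + B: star_alg B for A (structure) and B (structure) +
  fixes f
  assumes star_hom: "star_hom A B f"
begin

lemmas hom_closed [simp, intro] = star_hom_closed[OF star_hom]
  and hom_add = star_hom_add[OF star_hom]
  and hom_mult = star_hom_mult[OF star_hom]
  and hom_one [simp] = star_hom_one[OF star_hom]
  and hom_smult = star_hom_smult[OF star_hom]
  and hom_star = star_hom_star[OF star_hom]

lemma hom_zero [simp]: "f \<zero>\<^bsub>A\<^esub> = \<zero>\<^bsub>B\<^esub>"
  using hom_smult[of "\<one>\<^bsub>A\<^esub>" 0] by simp

lemma hom_minus: "x \<in> carrier A \<Longrightarrow> f (\<ominus>\<^bsub>A\<^esub> x) = \<ominus>\<^bsub>B\<^esub> f x"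
  by (simp add: hom_smult flip: A.minus_one_smult B.minus_one_smult)

lemma hom_diff:
  "x \<in> carrier A \<Longrightarrow> y \<in> carrier A \<Longrightarrow> f (x \<ominus>\<^bsub>A\<^esub> y) = f x \<ominus>\<^bsub>B\<^esub> f y"
  by (simp add: a_minus_def hom_add hom_minus)

lemma hom_finsum:
  "finite S \<Longrightarrow> h \<in> S \<rightarrow> carrier A \<Longrightarrow> f (\<Oplus>\<^bsub>A\<^esub>i\<in>S. h i) = (\<Oplus>\<^bsub>B\<^esub>i\<in>S. f (h i))"
  by (induction S rule: finite_induct) (auto simp: Pi_def hom_add)

lemma kernel_ideal: "ideal {x \<in> carrier A. f x = \<zero>\<^bsub>B\<^esub>} A"
  by (rule A.ideal_by_closure) (auto simp: hom_add hom_mult)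

end

lemma (in star_alg) star_ideal_ideal: "R \<subseteq> carrier A \<Longrightarrow> ideal (star_ideal A R) A"
  unfolding star_ideal_def by (rule genideal_ideal) auto

lemma (in star_alg) star_ideal_minimal:
  assumes "ideal I A" "R \<subseteq> I" "star A ` R \<subseteq> I"
  shows "star_ideal A R \<subseteq> I"
  unfolding star_ideal_def using assms by (intro genideal_minimal) auto

text \<open>A star homomorphism that kills a relation kills its adjoint too, so its kernel is an
  ideal containing all generators of the star ideal.\<close>

lemma (in star_alg_hom) star_ideal_kernel:
  assumes "R \<subseteq> carrier A" "\<And>r. r \<in> R \<Longrightarrow> f r = \<zero>\<^bsub>B\<^esub>" "x \<in> star_ideal A R"
  shows "f x = \<zero>\<^bsub>B\<^esub>"
proof -
  have "star_ideal A R \<subseteq> {x \<in> carrier A. f x = \<zero>\<^bsub>B\<^esub>}"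
    by (rule A.star_ideal_minimal[OF kernel_ideal]) (use assms(1,2) in \<open>auto simp: hom_star
        subset_iff\<close>)
  with assms(3) show ?thesis by auto
qed

text \<open>Turns a definition by description into usable facts. \<open>P\<close> is required of the
  restriction of \<open>f0\<close>, because the description only ranges over extensional
  functions.\<close>

lemma the_star_homI:
  assumes "star_alg A" "star_hom A B f0" "P (restrict f0 (carrier A))"
    and unique: "\<And>f g x. star_hom A B f \<Longrightarrow> star_hom A B g \<Longrightarrow> P f \<Longrightarrow> P g \<Longrightarrow> x \<in> carrier A \<Longrightarrow> f x
        = g x"
  shows "star_hom A B (the_star_hom A B P) \<and> P (the_star_hom A B P)"
proof -
  interpret star_alg A by fact
  let ?Q = "\<lambda>f. f \<in> extensional (carrier A) \<and> star_hom A B f \<and> P f"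
  have "star_hom A B (restrict f0 (carrier A))"
    by (rule star_homI) (simp_all add: star_homD[OF assms(2)])
  then have "?Q (restrict f0 (carrier A))" using assms(3) by simp
  moreover have "f = g" if "?Q f" "?Q g" for f g
    using that unique by (intro extensionalityI[of f "carrier A" g]) auto
  ultimately have "\<exists>!f. ?Q f" by blast
  from theI'[OF this] show ?thesis unfolding the_star_hom_def by blast
qed

section \<open>Generated star subalgebras\<close>

text \<open>Being inductive, it allows equality of homomorphisms, surjectivity and commutation to be
  checked on generators. Zero and negatives arise by scaling.\<close>

inductive_set star_span :: "('a, 'c) star_algebra_scheme \<Rightarrow> 'a set \<Rightarrow> 'a set"
  for A S where
  gen: "x \<in> S \<Longrightarrow> x \<in> star_span A S"
| one: "\<one>\<^bsub>A\<^esub> \<in> star_span A S"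
| add: "x \<in> star_span A S \<Longrightarrow> y \<in> star_span A S \<Longrightarrow> x \<oplus>\<^bsub>A\<^esub> y \<in> star_span A S"
| mult: "x \<in> star_span A S \<Longrightarrow> y \<in> star_span A S \<Longrightarrow> x \<otimes>\<^bsub>A\<^esub> y \<in> star_span A S"
| smult: "x \<in> star_span A S \<Longrightarrow> c \<odot>\<^bsub>A\<^esub> x \<in> star_span A S"
| star: "x \<in> star_span A S \<Longrightarrow> star A x \<in> star_span A S"

lemma star_span_mono:
  assumes "X \<subseteq> star_span A Y" shows "star_span A X \<subseteq> star_span A Y"
proof
  fix x assume "x \<in> star_span A X" then show "x \<in> star_span A Y"
    by (induction rule: star_span.induct) (use assms in \<open>auto intro: star_span.intros\<close>)
qed

lemma (in star_alg) star_span_closed: 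
  assumes "S \<subseteq> carrier A" shows "x \<in> star_span A S \<Longrightarrow> x \<in> carrier A"
  by (induction rule: star_span.induct) (use assms in auto)

lemma star_hom_unique:
  assumes "star_alg A" "S \<subseteq> carrier A" "carrier A \<subseteq> star_span A S" "star_hom A B f" "star_hom A B g"
    and "\<And>s. s \<in> S \<Longrightarrow> f s = g s" "x \<in> carrier A"
  shows "f x = g x"
proof -
  interpret star_alg A by fact
  have "x \<in> star_span A S" using assms by auto
  then show ?thesis
    by (induction rule: star_span.induct)
      (simp_all add: assms star_homD[OF assms(4)] star_homD[OF assms(5)] star_span_closed[OF
          assms(2)])
qed

lemma star_hom_image_span:
  assumes "star_alg A" "S \<subseteq> carrier A" "star_hom A B f" "x \<in> star_span A S"
  shows "f x \<in> star_span B (f ` S)"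
proof -
  interpret star_alg A by fact
  show ?thesis using assms(4)
    by (induction rule: star_span.induct)
      (auto simp add: assms star_homD[OF assms(3)] star_span_closed[OF assms(2)]
          intro: star_span.intros)
qed

lemma star_hom_span_subset:
  assumes "star_alg A" "S \<subseteq> carrier A" "carrier A \<subseteq> star_span A S" "star_hom A B f" "f ` S \<subseteq> Y"
  shows "f ` carrier A \<subseteq> star_span B Y"
proof -
  have "f ` carrier A \<subseteq> star_span B (f ` S)"
    using star_hom_image_span[OF assms(1,2,4)] assms(3) by blast
  also have "\<dots> \<subseteq> star_span B Y"
    using assms(5) by (intro star_span_mono) (auto intro: star_span.gen)
  finally show ?thesis .
qed

text \<open>The image of \<open>f\<close> is closed under every operation that builds the span, so
  it is enough to hit the generators.\<close>

lemma star_hom_surj: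
  assumes "star_alg A" "star_hom A B f" "S \<subseteq> f ` carrier A" "carrier B \<subseteq> star_span B S"
  shows "f ` carrier A = carrier B"
proof
  interpret star_alg A by fact
  show "f ` carrier A \<subseteq> carrier B" using star_homD[OF assms(2)] by auto
  have "x \<in> f ` carrier A" if "x \<in> star_span B S" for x
    using that
  proof (induction rule: star_span.induct)
    case (gen x) then show ?case using assms(3) by auto
  next
    case one then show ?case by (metis assms(2) image_eqI one_closed star_hom_one)
  next
    case (add x y) then show ?case by (auto simp flip: star_hom_add[OF assms(2)])
  next
    case (mult x y) then show ?case by (auto simp flip: star_hom_mult[OF assms(2)])
  next
    case (smult x c) then show ?case by (auto simp flip: star_hom_smult[OF assms(2)])
  next
    case (star x) then show ?case by (auto simp flip: star_hom_star[OF assms(2)])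
  qed
  then show "carrier B \<subseteq> f ` carrier A" using assms(4) by auto
qed

text \<open>Commutation with \<open>b\<close> and with its adjoint are proved together: taking
  adjoints turns \<open>x\<close> commuting with \<open>star A b\<close> into
  \<open>star A x\<close> commuting with \<open>b\<close>.\<close>

lemma (in star_alg) commute_span:
  assumes "S \<subseteq> carrier A" "b \<in> carrier A"
    and "\<And>s. s \<in> S \<Longrightarrow> s \<otimes> b = b \<otimes> s" "\<And>s. s \<in> S \<Longrightarrow> s \<otimes> star A b = star A b \<otimes> s"
    and "x \<in> star_span A S"
  shows "x \<otimes> b = b \<otimes> x \<and> x \<otimes> star A b = star A b \<otimes> x"
  using assms(5)
proof (induction rule: star_span.induct)
  case (mult x y)
  then have [simp]: "x \<in> carrier A" "y \<in> carrier A" using star_span_closed[OF assms(1)] by auto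
  from mult have 1: "x \<otimes> c = c \<otimes> x" "y \<otimes> c = c \<otimes> y" if "c \<in> {b, star A b}" for c using that by auto
  have "(x \<otimes> y) \<otimes> c = c \<otimes> (x \<otimes> y)" if "c \<in> {b, star A b}" "c \<in> carrier A" for c
    using that(2) 1[OF that(1)] by (simp add: m_assoc) (metis \<open>x \<in> carrier A\<close> \<open>y \<in> carrier A\<close>
        m_assoc)
  then show ?case using assms by auto
next
  case (star x)
  then have [simp]: "x \<in> carrier A" using star_span_closed[OF assms(1)] by auto
  have "star A x \<otimes> c = c \<otimes> star A x" if "c \<in> carrier A" "x \<otimes> star A c = star A c \<otimes> x" for c
    using arg_cong[OF that(2), of "star A"] that(1) by (simp add: star_mult)
  then show ?case using star assms(2) by auto
next
  case (add x y)
  then show ?case using star_span_closed[OF assms(1)] assms(2) by (simp add: l_distr r_distr)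
next
  case (smult x c)
  then show ?case using star_span_closed[OF assms(1)] assms(2) by (simp add: smult_mult mult_smult)
qed (use assms in auto)

text \<open>\<open>commute_span\<close> is used twice, for the span of \<open>S\<close> against a
  fixed element of \<open>T\<close> and then for the span of \<open>T\<close> against
  \<open>x\<close>. The second use needs commutation with \<open>star A x\<close>, which holds
  because \<open>star A x\<close> is again in the span of \<open>S\<close>.\<close>

lemma (in star_alg) commute_spans:
  assumes "S \<subseteq> carrier A" "T \<subseteq> carrier A"
    and "\<And>s t. s \<in> S \<Longrightarrow> t \<in> T \<Longrightarrow> s \<otimes> t = t \<otimes> s"
    and "\<And>s t. s \<in> S \<Longrightarrow> t \<in> T \<Longrightarrow> s \<otimes> star A t = star A t \<otimes> s"
    and "x \<in> star_span A S" "y \<in> star_span A T"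
  shows "x \<otimes> y = y \<otimes> x"
proof -
  have *: "z \<otimes> t = t \<otimes> z" if "z \<in> star_span A S" "t \<in> T" for z t
    using commute_span[of S t z] assms that by auto
  have x: "x \<in> carrier A" using assms(1,5) star_span_closed by auto
  have "y \<otimes> x = x \<otimes> y \<and> y \<otimes> star A x = star A x \<otimes> y"
    by (rule commute_span[OF assms(2) x _ _ assms(6)])
      (use assms(5) * star_span.star[OF assms(5)] in auto)
  then show ?thesis by simp
qed

section \<open>Quotients by star ideals and their universal property\<close>

locale star_presentation = star_alg A for A (structure) +
  fixes R
  assumes rels_closed: "R \<subseteq> carrier A"
begin

abbreviation I where "I \<equiv> star_ideal A R"

sublocale I: ideal I A
  using star_ideal_ideal[OF rels_closed] .

lemma star_ideal_smult: "x \<in> I \<Longrightarrow> c \<odot> x \<in> I"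
  using I.I_l_closed[of x "c \<odot> \<one>"] I.a_Hcarr[of x] by (simp add: smult_mult)

lemma star_ideal_gen: "r \<in> R \<Longrightarrow> r \<in> I" "r \<in> R \<Longrightarrow> star A r \<in> I"
  using genideal_self[of "R \<union> star A ` R"] rels_closed unfolding star_ideal_def by auto

text \<open>The elements whose adjoint lies in \<open>I\<close> form an ideal, and this ideal
  contains the self-adjoint generating set consisting of \<open>R\<close> and its adjoints.\<close>

lemma star_ideal_star: 
  assumes "x \<in> I" shows "star A x \<in> I"
proof -
  have "ideal {x \<in> carrier A. star A x \<in> I} A"
    by (rule ideal_by_closure)
      (auto simp: star_add star_mult I.I_l_closed I.I_r_closed)
  from star_ideal_minimal[OF this, of R] rels_closed star_ideal_gen
  have "I \<subseteq> {x \<in> carrier A. star A x \<in> I}" by (force simp: subset_iff)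
  with assms show ?thesis by auto
qed

abbreviation cls where "cls \<equiv> star_class A R"
abbreviation Q where "Q \<equiv> star_quot A R"

lemma cls_eq_iff: "x \<in> carrier A \<Longrightarrow> y \<in> carrier A \<Longrightarrow> cls x = cls y \<longleftrightarrow> x \<ominus> y \<in> I"
  unfolding star_class_def using quotient_eq_iff_same_a_r_cos[OF I.is_ideal] by simp

lemma cls_mem: "y \<in> cls x \<longleftrightarrow> y \<in> carrier A \<and> cls y = cls x" if "x \<in> carrier A"
proof
  assume "y \<in> cls x"
  then show "y \<in> carrier A \<and> cls y = cls x"
    unfolding star_class_def using that
    using I.a_elemrcos_carrier I.a_repr_independence' by blast
next
  assume "y \<in> carrier A \<and> cls y = cls x"
  then show "y \<in> cls x" unfolding star_class_def
    using I.a_rcos_self by blast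
qed

lemma quot_ring_simps:
  "carrier Q = cls ` carrier A"
  "x \<in> carrier A \<Longrightarrow> y \<in> carrier A \<Longrightarrow> cls x \<otimes>\<^bsub>Q\<^esub> cls y = cls (x \<otimes> y)"
  "x \<in> carrier A \<Longrightarrow> y \<in> carrier A \<Longrightarrow> cls x \<oplus>\<^bsub>Q\<^esub> cls y = cls (x \<oplus> y)"
  "\<one>\<^bsub>Q\<^esub> = cls \<one>" "\<zero>\<^bsub>Q\<^esub> = cls \<zero>"
proof -
  have Q: "carrier Q = carrier (A Quot I)" "mult Q = mult (A Quot I)" "add Q = add (A Quot I)"
    "one Q = one (A Quot I)" "zero Q = zero (A Quot I)"
    by (simp_all add: star_quot_def Let_def)
  show "carrier Q = cls ` carrier A"
    unfolding Q by (auto simp: FactRing_def A_RCOSETS_def' star_class_def)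
  show "\<one>\<^bsub>Q\<^esub> = cls \<one>" unfolding Q by (simp add: FactRing_def star_class_def)
  show "\<zero>\<^bsub>Q\<^esub> = cls \<zero>" unfolding Q
    using a_rcos_zero[OF I.is_ideal, of \<zero>] by (simp add: FactRing_def star_class_def)
  show "cls x \<otimes>\<^bsub>Q\<^esub> cls y = cls (x \<otimes> y)" "cls x \<oplus>\<^bsub>Q\<^esub> cls y = cls (x \<oplus> y)"
    if "x \<in> carrier A" "y \<in> carrier A" for x y
    unfolding Q star_class_def using that
    by (simp_all add: ring_hom_mult[OF I.rcos_ring_hom] ring_hom_add[OF I.rcos_ring_hom])
qed

text \<open>Scaling of a class is defined as a union over all its members; the content is that every
  member contributes the same class. The same holds for \<open>quot_star\<close>.\<close>

lemma quot_smult: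
  assumes "x \<in> carrier A" shows "c \<odot>\<^bsub>Q\<^esub> cls x = cls (c \<odot> x)"
proof -
  have "cls (c \<odot> y) = cls (c \<odot> x)" if "y \<in> cls x" for y
  proof -
    have y: "y \<in> carrier A" "cls y = cls x" using that assms by (auto simp: cls_mem)
    then have "c \<odot> (y \<ominus> x) \<in> I" using star_ideal_smult cls_eq_iff assms by blast
    then show ?thesis using y assms by (simp add: cls_eq_iff[of "c \<odot> y"] smult_diff)
  qed
  moreover have "x \<in> cls x" using assms by (simp add: cls_mem)
  ultimately have "(\<Union>y\<in>cls x. cls (c \<odot> y)) = cls (c \<odot> x)" by blast
  then show ?thesis by (simp add: star_quot_def Let_def star_class_def)
qed

lemma quot_star:
  assumes "x \<in> carrier A" shows "star Q (cls x) = cls (star A x)"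
proof -
  have "cls (star A y) = cls (star A x)" if "y \<in> cls x" for y
  proof -
    have y: "y \<in> carrier A" "cls y = cls x" using that assms by (auto simp: cls_mem)
    then have "star A (y \<ominus> x) \<in> I" using star_ideal_star cls_eq_iff assms by blast
    then show ?thesis using y assms by (simp add: cls_eq_iff[of "star A y"] star_diff)
  qed
  moreover have "x \<in> cls x" using assms by (simp add: cls_mem)
  ultimately have "(\<Union>y\<in>cls x. cls (star A y)) = cls (star A x)" by blast
  then show ?thesis by (simp add: star_quot_def Let_def star_class_def)
qed

lemmas quot_simps = quot_ring_simps quot_smult quot_star

lemma quot_star_alg: "star_alg Q"
proof (rule star_alg.intro)
  show "ring Q"
  proof (rule ringI)
    show "abelian_group Q"
    proof (rule abelian_groupI)
      fix x assume "x \<in> carrier Q"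
      then obtain y where "y \<in> carrier A" "x = cls y" by (auto simp: quot_ring_simps)
      then show "\<exists>z\<in>carrier Q. z \<oplus>\<^bsub>Q\<^esub> x = \<zero>\<^bsub>Q\<^esub>"
        by (intro bexI[of _ "cls (\<ominus> y)"]) (auto simp: quot_ring_simps l_neg)
    qed (auto simp: quot_ring_simps a_ac)
    show "Group.monoid Q"
      by (rule monoidI) (auto simp: quot_ring_simps m_assoc)
  qed (auto simp: quot_ring_simps l_distr r_distr)
  show "star_alg_axioms Q"
    by unfold_locales (auto simp: quot_simps smult_add add_smult smult_smult smult_mult mult_smult
        star_add star_smult star_mult)
qed

lemma star_hom_cls: "star_hom A Q cls"
  by (rule star_homI) (auto simp: quot_simps)

lemma cls_rel: "r \<in> R \<Longrightarrow> cls r = \<zero>\<^bsub>Q\<^esub>"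
  using star_ideal_gen(1)[of r] rels_closed by (auto simp: quot_simps cls_eq_iff a_minus_def)

lemma quot_span: "S \<subseteq> carrier A \<Longrightarrow> carrier A \<subseteq> star_span A S \<Longrightarrow> carrier Q \<subseteq> star_span Q (cls ` S)"
  using star_hom_image_span[OF star_alg_axioms _ star_hom_cls] by (auto simp: quot_simps)

lemma quot_universal:
  assumes "star_alg B" "star_hom A B f" "\<And>r. r \<in> R \<Longrightarrow> f r = \<zero>\<^bsub>B\<^esub>"
  obtains g where "star_hom Q B g" "\<And>x. x \<in> carrier A \<Longrightarrow> g (cls x) = f x"
proof -
  interpret B: star_alg B by fact
  interpret f: star_alg_hom A B f by unfold_locales fact
  have eq: "f x = f y" if "cls x = cls y" "x \<in> carrier A" "y \<in> carrier A" for x y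
  proof -
    have "f (x \<ominus> y) = \<zero>\<^bsub>B\<^esub>"
      using f.star_ideal_kernel[OF rels_closed assms(3)] that by (simp add: cls_eq_iff)
    then show ?thesis using that by (simp add: f.hom_diff B.diff_eq_zero_iff)
  qed
  \<comment> \<open>The choice of representative is harmless by \<open>eq\<close>.\<close>
  define g where "g X = f (SOME x. x \<in> carrier A \<and> cls x = X)" for X
  have g: "g (cls x) = f x" if "x \<in> carrier A" for x
  proof -
    have "(SOME y. y \<in> carrier A \<and> cls y = cls x) \<in> carrier A \<and> cls (SOME y. y \<in> carrier A \<and> cls y
        = cls x) = cls x"
      by (rule someI[of _ x]) (use that in auto)
    then show ?thesis unfolding g_def using eq that by blast
  qed
  moreover have "star_hom Q B g"
    by (rule star_homI) (auto simp: quot_simps g f.hom_add f.hom_mult f.hom_smult f.hom_star)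
  ultimately show thesis using that by blast
qed

end

section \<open>Monoid algebras\<close>

lemma keys_add_subset: "Poly_Mapping.keys f \<subseteq> S \<Longrightarrow> Poly_Mapping.keys g \<subseteq> S \<Longrightarrow>
    Poly_Mapping.keys (f + g) \<subseteq> S"
  using Poly_Mapping.keys_add[of f g] by blast

text \<open>Reduces identities that are additive in a finitely supported function to monomials,
  keeping track of the set in which the support lies.\<close>

lemma poly_mapping_span_induct [consumes 1, case_names zero single add]:
  assumes "Poly_Mapping.keys f \<subseteq> S" "P 0" "\<And>s c. s \<in> S \<Longrightarrow> P (Poly_Mapping.single s c)"
    and "\<And>f g. Poly_Mapping.keys f \<subseteq> S \<Longrightarrow> Poly_Mapping.keys g \<subseteq> S \<Longrightarrow> P f \<Longrightarrow> P g \<Longrightarrow> P (f + g)"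
  shows "P (f :: 'a \<Rightarrow>\<^sub>0 'b::comm_monoid_add)"
  using assms(1)
proof (induction f rule: Poly_Mapping.update_induct)
  case const show ?case by (rule assms(2))
next
  case (update f a b)
  \<comment> \<open>The key \<open>a\<close> is new, so updating at \<open>a\<close> amounts to
    adding a monomial.\<close>
  have eq: "Poly_Mapping.update a b f = f + Poly_Mapping.single a b"
    using update.hyps(1)
    by (intro poly_mapping_eqI) (auto simp: lookup_update lookup_add lookup_single
        not_in_keys_iff_lookup_eq_zero when_def)
  have "a \<in> S" "Poly_Mapping.keys f \<subseteq> S"
    using update.prems update.hyps by (auto simp: keys_update)
  then show ?case unfolding eq
    by (intro assms(4) assms(3) update.IH) auto
qed

section \<open>Linear extension from a basis\<close>

definition (in star_alg) lin_ext :: "('k \<Rightarrow> 'a) \<Rightarrow> ('k \<Rightarrow>\<^sub>0 complex) \<Rightarrow> 'a"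
  where "lin_ext b f = (\<Oplus>k\<in>Poly_Mapping.keys f. Poly_Mapping.lookup f k \<odot> b k)"

context star_alg begin

text \<open>Coefficients outside the support vanish. Summing over any larger finite set makes it
  possible to treat two functions over one index set, which is how additivity is obtained.\<close>

lemma lin_ext_superset:
  assumes "b \<in> K \<rightarrow> carrier A" "finite K" "Poly_Mapping.keys f \<subseteq> K"
  shows "lin_ext b f = (\<Oplus>k\<in>K. Poly_Mapping.lookup f k \<odot> b k)"
  unfolding lin_ext_def using assms
  by (intro add.finprod_mono_neutral_cong_left) (auto simp: not_in_keys_iff_lookup_eq_zero Pi_def)

lemma lin_ext_closed [simp]: "b \<in> S \<rightarrow> carrier A \<Longrightarrow> Poly_Mapping.keys f \<subseteq> S \<Longrightarrow>
    lin_ext b f \<in> carrier A"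
  unfolding lin_ext_def by (intro finsum_closed) auto

lemma lin_ext_0 [simp]: "lin_ext b 0 = \<zero>"
  by (simp add: lin_ext_def)

lemma lin_ext_single [simp]: "b s \<in> carrier A \<Longrightarrow> lin_ext b (Poly_Mapping.single s c) = c \<odot> b s"
  by (simp add: lin_ext_def)

lemma lin_ext_add:
  assumes "b \<in> S \<rightarrow> carrier A" "Poly_Mapping.keys f \<subseteq> S" "Poly_Mapping.keys g \<subseteq> S"
  shows "lin_ext b (f + g) = lin_ext b f \<oplus> lin_ext b g"
proof -
  let ?K = "Poly_Mapping.keys f \<union> Poly_Mapping.keys g"
  have b: "b \<in> ?K \<rightarrow> carrier A" using assms by auto
  then have "b k \<in> carrier A" if "k \<in> ?K" for k using that by blast
  then show ?thesis
    using Poly_Mapping.keys_add[of f g]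
    by (simp add: lin_ext_superset[OF b] lookup_add add_smult flip: finsum_addf cong: finsum_cong)
qed

end

lemma keys_scale_subset: "Poly_Mapping.keys f \<subseteq> S \<Longrightarrow> Poly_Mapping.keys (Poly_Mapping.map ((*) c)
    (f :: 'a \<Rightarrow>\<^sub>0 complex)) \<subseteq> S"
  by (auto simp: in_keys_iff Poly_Mapping.map.rep_eq when_def split: if_splits)

lemma scale_zero [simp]: "Poly_Mapping.map ((*) c) (0 :: 'a \<Rightarrow>\<^sub>0 complex) = 0"
  by (rule poly_mapping_eqI) (simp add: Poly_Mapping.map.rep_eq)

lemma scale_add: "Poly_Mapping.map ((*) c) (f + g :: 'a \<Rightarrow>\<^sub>0 complex)
    = Poly_Mapping.map ((*) c) f + Poly_Mapping.map ((*) c) g"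
  by (rule poly_mapping_eqI) (auto simp: Poly_Mapping.map.rep_eq when_def lookup_add simp flip:
      distrib_left)

lemma (in star_alg) lin_ext_scale:
  assumes "b \<in> S \<rightarrow> carrier A" "Poly_Mapping.keys f \<subseteq> S"
  shows "lin_ext b (Poly_Mapping.map ((*) c) f) = c \<odot> lin_ext b f"
  using assms(2)
proof (induction rule: poly_mapping_span_induct)
  case (single s d)
  then show ?case using assms(1) by (auto simp: smult_smult Pi_def)
next
  case (add f g)
  then show ?case
    using lin_ext_add[OF assms(1)] lin_ext_closed[OF assms(1)]
    by (simp add: scale_add keys_scale_subset smult_add)
qed simp

text \<open>Common source of three algebras: groups with inversion give group algebras, words with
  the reversed adjoint give free star algebras, and pairs with the componentwise star give the
  algebra from which the tensor product is cut out.\<close>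

locale involutive_monoid = monoid M for M (structure) +
  fixes \<sigma>
  assumes \<sigma>_closed [simp]: "x \<in> carrier M \<Longrightarrow> \<sigma> x \<in> carrier M"
    and \<sigma>_\<sigma> [simp]: "x \<in> carrier M \<Longrightarrow> \<sigma> (\<sigma> x) = x"
    and \<sigma>_mult: "x \<in> carrier M \<Longrightarrow> y \<in> carrier M \<Longrightarrow> \<sigma> (x \<otimes> y) = \<sigma> y \<otimes> \<sigma> x"
begin

abbreviation MA where "MA \<equiv> monoid_star_algebra M \<sigma>"

abbreviation (input) sg where "sg \<equiv> Poly_Mapping.single"

lemma MA_simps [simp]:
  "carrier MA = {f. Poly_Mapping.keys f \<subseteq> carrier M}"
  "\<one>\<^bsub>MA\<^esub> = sg \<one> 1" "\<zero>\<^bsub>MA\<^esub> = 0" "add MA = (+)" "module.smult MA c = Poly_Mapping.map ((*) c)"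
  by (simp_all add: monoid_star_algebra_def)

text \<open>The supports over which the product is defined do not behave additively; over common
  larger index sets distributivity becomes a statement about coefficients.\<close>

lemma MA_mult_sum:
  assumes "finite K" "finite L" "Poly_Mapping.keys f \<subseteq> K" "Poly_Mapping.keys g \<subseteq> L"
  shows "f \<otimes>\<^bsub>MA\<^esub> g = (\<Sum>s\<in>K. \<Sum>t\<in>L. sg (s \<otimes> t) (Poly_Mapping.lookup f s * Poly_Mapping.lookup g t))"
proof -
  have "f \<otimes>\<^bsub>MA\<^esub> g = (\<Sum>s\<in>Poly_Mapping.keys f. \<Sum>t\<in>L. sg (s \<otimes> t) (Poly_Mapping.lookup f s *
      Poly_Mapping.lookup g t))"
    unfolding monoid_star_algebra_def using assms
    by (auto intro!: sum.cong[OF refl] sum.mono_neutral_left simp: not_in_keys_iff_lookup_eq_zero)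
  also have "\<dots> = (\<Sum>s\<in>K. \<Sum>t\<in>L. sg (s \<otimes> t) (Poly_Mapping.lookup f s * Poly_Mapping.lookup g t))"
    using assms by (intro sum.mono_neutral_left) (auto simp: not_in_keys_iff_lookup_eq_zero)
  finally show ?thesis .
qed

lemma MA_mult_single: "sg s c \<otimes>\<^bsub>MA\<^esub> sg t d = sg (s \<otimes> t) (c * d)"
  by (subst MA_mult_sum[of "{s}" "{t}"]) auto

lemma MA_mult_0 [simp]: "0 \<otimes>\<^bsub>MA\<^esub> f = 0" "f \<otimes>\<^bsub>MA\<^esub> 0 = 0"
  by (simp_all add: monoid_star_algebra_def)

lemma MA_mult_addl: "(f + g) \<otimes>\<^bsub>MA\<^esub> h = f \<otimes>\<^bsub>MA\<^esub> h + g \<otimes>\<^bsub>MA\<^esub> h"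
  using Poly_Mapping.keys_add[of f g]
  by (simp add: MA_mult_sum[of "Poly_Mapping.keys f \<union> Poly_Mapping.keys g" "Poly_Mapping.keys h"]
      lookup_add distrib_right single_add sum.distrib)

lemma MA_mult_addr: "h \<otimes>\<^bsub>MA\<^esub> (f + g) = h \<otimes>\<^bsub>MA\<^esub> f + h \<otimes>\<^bsub>MA\<^esub> g"
  using Poly_Mapping.keys_add[of f g]
  by (simp add: MA_mult_sum[of "Poly_Mapping.keys h" "Poly_Mapping.keys f \<union> Poly_Mapping.keys g"]
      lookup_add distrib_left single_add sum.distrib)

lemma MA_star_sum:
  assumes "finite K" "Poly_Mapping.keys f \<subseteq> K"
  shows "star MA f = (\<Sum>s\<in>K. sg (\<sigma> s) (cnj (Poly_Mapping.lookup f s)))"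
    unfolding monoid_star_algebra_def using assms
    by (auto intro!: sum.mono_neutral_left simp: not_in_keys_iff_lookup_eq_zero)

lemma MA_star_single: "star MA (sg s c) = sg (\<sigma> s) (cnj c)"
  by (subst MA_star_sum[of "{s}"]) auto

lemma MA_star_0 [simp]: "star MA 0 = 0"
  by (simp add: monoid_star_algebra_def)

lemma MA_star_add: "star MA (f + g) = star MA f + star MA g"
  using Poly_Mapping.keys_add[of f g]
  by (simp add: MA_star_sum[of "Poly_Mapping.keys f \<union> Poly_Mapping.keys g"] lookup_add single_add
      sum.distrib)

lemma MA_mult_closed:
  assumes "Poly_Mapping.keys f \<subseteq> carrier M" "Poly_Mapping.keys g \<subseteq> carrier M"
  shows "Poly_Mapping.keys (f \<otimes>\<^bsub>MA\<^esub> g) \<subseteq> carrier M"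
  using assms(1)
proof (induction rule: poly_mapping_span_induct)
  case (single s c)
  from assms(2) show ?case
    by (induction rule: poly_mapping_span_induct)
      (use single in \<open>auto simp: MA_mult_single MA_mult_addr dest: keys_add_subset\<close>)
qed (auto simp: MA_mult_addl dest: keys_add_subset)

lemma MA_star_closed:
  assumes "Poly_Mapping.keys f \<subseteq> carrier M"
  shows "Poly_Mapping.keys (star MA f) \<subseteq> carrier M"
  using assms
  by (induction rule: poly_mapping_span_induct) (auto simp: MA_star_single MA_star_add dest:
      keys_add_subset)

lemma MA_bilinear_induct [consumes 2, case_names zero_left zero_right add_left add_right single]:
  assumes "Poly_Mapping.keys f \<subseteq> carrier M" "Poly_Mapping.keys g \<subseteq> carrier M"
    and "\<And>g. Poly_Mapping.keys g \<subseteq> carrier M \<Longrightarrow> P 0 g" "\<And>f. Poly_Mapping.keys f \<subseteq> carrier M \<Longrightarrow>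
        P f 0"
    and "\<And>f f' g. Poly_Mapping.keys f \<subseteq> carrier M \<Longrightarrow> Poly_Mapping.keys f' \<subseteq> carrier M \<Longrightarrow>
        Poly_Mapping.keys g \<subseteq> carrier M \<Longrightarrow> P f g \<Longrightarrow> P f' g \<Longrightarrow> P (f + f') g"
    and "\<And>f g g'. Poly_Mapping.keys f \<subseteq> carrier M \<Longrightarrow> Poly_Mapping.keys g \<subseteq> carrier M \<Longrightarrow>
        Poly_Mapping.keys g' \<subseteq> carrier M \<Longrightarrow> P f g \<Longrightarrow> P f g' \<Longrightarrow> P f (g + g')"
    and "\<And>s c t d. s \<in> carrier M \<Longrightarrow> t \<in> carrier M \<Longrightarrow> P (sg s c) (sg t d)"
  shows "P (f :: 'a \<Rightarrow>\<^sub>0 complex) (g :: 'a \<Rightarrow>\<^sub>0 complex)"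
  using assms(1)
proof (induction rule: poly_mapping_span_induct)
  case (single s c)
  from assms(2) show ?case
    by (induction rule: poly_mapping_span_induct) (use single in \<open>auto intro!: assms(3-7)
        split: if_splits\<close>)
qed (use assms in auto)

lemma MA_assoc:
  assumes "Poly_Mapping.keys f \<subseteq> carrier M" "Poly_Mapping.keys g \<subseteq> carrier M"
      "Poly_Mapping.keys h \<subseteq> carrier M"
  shows "(f \<otimes>\<^bsub>MA\<^esub> g) \<otimes>\<^bsub>MA\<^esub> h = f \<otimes>\<^bsub>MA\<^esub> (g \<otimes>\<^bsub>MA\<^esub> h)"
  using assms(1,2)
proof (induction rule: MA_bilinear_induct)
  case (single s c t d)
  from assms(3) show ?case
    by (induction rule: poly_mapping_span_induct) (use single in \<open>auto simp: MA_mult_single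
        MA_mult_addr m_assoc mult.assoc\<close>)
qed (simp_all add: MA_mult_addl MA_mult_addr)

sublocale MA: star_alg MA
proof (rule star_alg.intro)
  show "ring MA"
  proof (rule ringI)
    show "abelian_group MA"
    proof (rule abelian_groupI)
      fix f assume "f \<in> carrier MA"
      then show "\<exists>g\<in>carrier MA. g \<oplus>\<^bsub>MA\<^esub> f = \<zero>\<^bsub>MA\<^esub>"
        by (intro bexI[of _ "- f"]) (auto simp: in_keys_iff)
    qed (auto dest: keys_add_subset simp: algebra_simps)
    show "Group.monoid MA"
    proof (rule monoidI)
      fix f assume "f \<in> carrier MA"
      then have f: "Poly_Mapping.keys f \<subseteq> carrier M" by simp
      then show "\<one>\<^bsub>MA\<^esub> \<otimes>\<^bsub>MA\<^esub> f = f"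
        by (induction rule: poly_mapping_span_induct) (auto simp: MA_mult_single MA_mult_addr)
      from f show "f \<otimes>\<^bsub>MA\<^esub> \<one>\<^bsub>MA\<^esub> = f"
        by (induction rule: poly_mapping_span_induct) (auto simp: MA_mult_single MA_mult_addl)
    qed (use MA_mult_closed MA_assoc in auto)
  qed (auto simp: MA_mult_addl MA_mult_addr)
  show "star_alg_axioms MA"
  proof
    fix f g c assume f: "f \<in> carrier MA" and g: "g \<in> carrier MA"
    then have fg: "Poly_Mapping.keys f \<subseteq> carrier M" "Poly_Mapping.keys g \<subseteq> carrier M" by auto
    then show "c \<odot>\<^bsub>MA\<^esub> f \<otimes>\<^bsub>MA\<^esub> g = c \<odot>\<^bsub>MA\<^esub> (f \<otimes>\<^bsub>MA\<^esub> g)"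
      by (induction rule: MA_bilinear_induct) (auto simp: MA_mult_single MA_mult_addl MA_mult_addr
          scale_add mult.assoc)
    from fg show "f \<otimes>\<^bsub>MA\<^esub> (c \<odot>\<^bsub>MA\<^esub> g) = c \<odot>\<^bsub>MA\<^esub> (f \<otimes>\<^bsub>MA\<^esub> g)"
      by (induction rule: MA_bilinear_induct) (auto simp: MA_mult_single MA_mult_addl MA_mult_addr
          scale_add mult.left_commute)
    from fg show "star MA (f \<otimes>\<^bsub>MA\<^esub> g) = star MA g \<otimes>\<^bsub>MA\<^esub> star MA f"
      by (induction rule: MA_bilinear_induct) 
        (auto simp: MA_mult_single MA_mult_addl MA_mult_addr MA_star_single MA_star_add \<sigma>_mult
            mult.commute)
    show "star MA (f \<oplus>\<^bsub>MA\<^esub> g) = star MA f \<oplus>\<^bsub>MA\<^esub> star MA g" by (simp add: MA_star_add)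
    from fg(1) show "star MA (star MA f) = f" 
      by (induction rule: poly_mapping_span_induct) (auto simp: MA_star_single MA_star_add)
    from fg(1) show "star MA (c \<odot>\<^bsub>MA\<^esub> f) = cnj c \<odot>\<^bsub>MA\<^esub> star MA f"
      by (induction rule: poly_mapping_span_induct) (auto simp: MA_star_single MA_star_add
          scale_add)
    from f show "c \<odot>\<^bsub>MA\<^esub> f \<in> carrier MA" by (auto dest: keys_scale_subset)
    from f show "star MA f \<in> carrier MA" using MA_star_closed by auto
  qed (auto simp: scale_add intro!: poly_mapping_eqI simp: Poly_Mapping.map.rep_eq when_def
      lookup_add algebra_simps)
qed

lemma MA_minus:
  assumes "f \<in> carrier MA" "g \<in> carrier MA"
  shows "f \<ominus>\<^bsub>MA\<^esub> g = f - g"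
proof -
  have "- g \<in> carrier MA" using assms(2) by (auto simp: in_keys_iff)
  then have "\<ominus>\<^bsub>MA\<^esub> g = - g" using assms(2) MA.minus_equality[of "- g" g] by simp
  then show ?thesis by (simp add: a_minus_def)
qed

lemma MA_diff_closed: "f \<in> carrier MA \<Longrightarrow> g \<in> carrier MA \<Longrightarrow> f - g \<in> carrier MA"
  using MA.minus_closed[of f g] MA_minus by metis

lemma single_star_span:
  assumes "sg s 1 \<in> star_span MA S"
  shows "sg s c \<in> star_span MA S"
  using star_span.smult[OF assms, of c] by simp

lemma MA_star_span:
  assumes "\<And>s. s \<in> carrier M \<Longrightarrow> sg s 1 \<in> star_span MA S"
  shows "carrier MA \<subseteq> star_span MA S"
proof
  fix f assume "f \<in> carrier MA"
  then have "Poly_Mapping.keys f \<subseteq> carrier M" by simp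
  then show "f \<in> star_span MA S"
  proof (induction rule: poly_mapping_span_induct)
    case zero
    have "sg \<one> 0 \<in> star_span MA S" by (rule single_star_span) (use assms in auto)
    then show ?case by simp
  next
    case (add f g)
    then show ?case using star_span.add[of f MA S g] by simp
  qed (use assms single_star_span in auto)
qed

text \<open>All homomorphism laws are additive in each argument, so they only have to be compared on
  monomials, where they are the hypotheses on \<open>\<phi>\<close>.\<close>

lemma MA_universal:
  assumes "star_alg B" and \<phi>: "\<And>s. s \<in> carrier M \<Longrightarrow> \<phi> s \<in> carrier B"
    "\<And>s t. s \<in> carrier M \<Longrightarrow> t \<in> carrier M \<Longrightarrow> \<phi> (s \<otimes> t) = \<phi> s \<otimes>\<^bsub>B\<^esub> \<phi> t" "\<phi> \<one> = \<one>\<^bsub>B\<^esub>"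
    "\<And>s. s \<in> carrier M \<Longrightarrow> \<phi> (\<sigma> s) = star B (\<phi> s)"
  shows "star_hom MA B (star_alg.lin_ext B \<phi>)"
proof -
  interpret B: star_alg B by fact
  let ?f = "B.lin_ext \<phi>"
  have Pi: "\<phi> \<in> carrier M \<rightarrow> carrier B" using \<phi> by auto
  note add = B.lin_ext_add[OF Pi] and cl = B.lin_ext_closed[OF Pi]
  show ?thesis
  proof (rule star_homI)
    fix f g c assume "f \<in> carrier MA" "g \<in> carrier MA"
    then have fg: "Poly_Mapping.keys f \<subseteq> carrier M" "Poly_Mapping.keys g \<subseteq> carrier M" by auto
    show "?f f \<in> carrier B" using fg cl by simp
    show "?f (f \<oplus>\<^bsub>MA\<^esub> g) = ?f f \<oplus>\<^bsub>B\<^esub> ?f g" using add fg by simp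
    from fg show "?f (f \<otimes>\<^bsub>MA\<^esub> g) = ?f f \<otimes>\<^bsub>B\<^esub> ?f g"
    proof (induction rule: MA_bilinear_induct)
      case (single s c t d)
      then show ?case by (simp add: MA_mult_single \<phi> B.smult_mult B.mult_smult B.smult_smult
          mult.commute)
    qed (simp_all add: MA_mult_addl MA_mult_addr add MA_mult_closed cl B.l_distr B.r_distr)
    show "?f (c \<odot>\<^bsub>MA\<^esub> f) = c \<odot>\<^bsub>B\<^esub> ?f f" using B.lin_ext_scale[OF Pi fg(1)] by simp
    from fg(1) show "?f (star MA f) = star B (?f f)"
      by (induction rule: poly_mapping_span_induct)
        (simp_all add: MA_star_single MA_star_add add cl MA_star_closed B.star_add B.star_smult \<phi>)
  qed (simp add: \<phi>)
qed

end

section \<open>The relations that make a map a homomorphism\<close>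

text \<open>Needed in both directions: from left to right for the canonical maps into amalgamated
  and free products, from right to left for maps out of them.\<close>

lemma hom_relations_vanish_iff:
  assumes "star_alg A" "star_alg_hom F B h" "\<And>a. a \<in> carrier A \<Longrightarrow> \<phi> a \<in> carrier F"
  shows "(\<forall>r\<in>hom_relations A F \<phi>. h r = \<zero>\<^bsub>B\<^esub>) \<longleftrightarrow> star_hom A B (\<lambda>a. h (\<phi> a))"
proof -
  interpret A: star_alg A by fact
  interpret h: star_alg_hom F B h by fact
  have 1: "h (x \<ominus>\<^bsub>F\<^esub> y) = \<zero>\<^bsub>B\<^esub> \<longleftrightarrow> h x = h y" if "x \<in> carrier F" "y \<in> carrier F" for x y
    using that by (simp add: h.hom_diff h.B.diff_eq_zero_iff)
  show ?thesis
  proof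
    assume *: "\<forall>r\<in>hom_relations A F \<phi>. h r = \<zero>\<^bsub>B\<^esub>"
    show "star_hom A B (\<lambda>a. h (\<phi> a))"
    proof (rule star_homI)
      fix x y c assume [simp]: "x \<in> carrier A" "y \<in> carrier A"
      have "h (\<phi> (x \<oplus>\<^bsub>A\<^esub> y) \<ominus>\<^bsub>F\<^esub> (\<phi> x \<oplus>\<^bsub>F\<^esub> \<phi> y)) = \<zero>\<^bsub>B\<^esub>"
        by (rule *[rule_format]) (unfold hom_relations_def, use \<open>x \<in> carrier A\<close> \<open>y \<in> carrier A\<close> in
            blast)
      then show "h (\<phi> (x \<oplus>\<^bsub>A\<^esub> y)) = h (\<phi> x) \<oplus>\<^bsub>B\<^esub> h (\<phi> y)"
        by (simp add: 1 assms(3) h.hom_add)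
      have "h (\<phi> (x \<otimes>\<^bsub>A\<^esub> y) \<ominus>\<^bsub>F\<^esub> (\<phi> x \<otimes>\<^bsub>F\<^esub> \<phi> y)) = \<zero>\<^bsub>B\<^esub>"
        by (rule *[rule_format]) (unfold hom_relations_def, use \<open>x \<in> carrier A\<close> \<open>y \<in> carrier A\<close> in
            blast)
      then show "h (\<phi> (x \<otimes>\<^bsub>A\<^esub> y)) = h (\<phi> x) \<otimes>\<^bsub>B\<^esub> h (\<phi> y)"
        by (simp add: 1 assms(3) h.hom_mult)
      have "h (\<phi> (c \<odot>\<^bsub>A\<^esub> x) \<ominus>\<^bsub>F\<^esub> (c \<odot>\<^bsub>F\<^esub> \<phi> x)) = \<zero>\<^bsub>B\<^esub>"
        by (rule *[rule_format]) (unfold hom_relations_def, use \<open>x \<in> carrier A\<close> \<open>y \<in> carrier A\<close> in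
            blast)
      then show "h (\<phi> (c \<odot>\<^bsub>A\<^esub> x)) = c \<odot>\<^bsub>B\<^esub> h (\<phi> x)"
        by (simp add: 1 assms(3) h.hom_smult)
      have "h (\<phi> (star A x) \<ominus>\<^bsub>F\<^esub> star F (\<phi> x)) = \<zero>\<^bsub>B\<^esub>"
        by (rule *[rule_format]) (unfold hom_relations_def, use \<open>x \<in> carrier A\<close> \<open>y \<in> carrier A\<close> in
            blast)
      then show "h (\<phi> (star A x)) = star B (h (\<phi> x))"
        by (simp add: 1 assms(3) h.hom_star)
      show "h (\<phi> x) \<in> carrier B" using assms(3) by simp
    next
      have "h (\<phi> \<one>\<^bsub>A\<^esub> \<ominus>\<^bsub>F\<^esub> \<one>\<^bsub>F\<^esub>) = \<zero>\<^bsub>B\<^esub>"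
        by (rule *[rule_format]) (unfold hom_relations_def, blast)
      then show "h (\<phi> \<one>\<^bsub>A\<^esub>) = \<one>\<^bsub>B\<^esub>"
        by (simp add: 1 assms(3))
    qed
  next
    assume hom: "star_hom A B (\<lambda>a. h (\<phi> a))"
    note f = star_homD[OF hom]
    show "\<forall>r\<in>hom_relations A F \<phi>. h r = \<zero>\<^bsub>B\<^esub>"
      unfolding hom_relations_def
      by (auto simp: 1 assms(3) h.hom_add h.hom_mult h.hom_smult h.hom_star f)
  qed
qed

lemma hom_relations_closed:
  assumes "star_alg A" "star_alg F" "\<And>a. a \<in> carrier A \<Longrightarrow> \<phi> a \<in> carrier F"
  shows "hom_relations A F \<phi> \<subseteq> carrier F"
proof -
  interpret A: star_alg A by fact
  interpret F: star_alg F by fact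
  show ?thesis unfolding hom_relations_def using assms(3) by auto
qed

section \<open>Free algebras\<close>

definition word_adj :: "('x \<times> bool) list \<Rightarrow> ('x \<times> bool) list"
  where "word_adj w = rev (map (\<lambda>(x, b). (x, \<not> b)) w)"

lemma word_adj_simps [simp]:
  "word_adj [] = []" "word_adj (u @ v) = word_adj v @ word_adj u"
  "word_adj ((x, b) # w) = word_adj w @ [(x, \<not> b)]"
  by (simp_all add: word_adj_def)

lemma word_adj_adj [simp]: "word_adj (word_adj w) = w"
  by (induction w) auto

lemma word_adj_lists: "w \<in> lists (X \<times> UNIV) \<Longrightarrow> word_adj w \<in> lists (X \<times> UNIV)"
  by (induction w) auto

abbreviation word_monoid :: "'x set \<Rightarrow> ('x \<times> bool) list monoid"
  where "word_monoid X \<equiv> \<lparr>carrier = lists (X \<times> UNIV), mult = (@), one = []\<rparr>"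

interpretation word: involutive_monoid "word_monoid X" word_adj for X
  by unfold_locales (auto simp: word_adj_lists simp del: in_lists_conv_set)

lemma free_star_algebra_eq: "free_star_algebra X = monoid_star_algebra (word_monoid X) word_adj"
  unfolding free_star_algebra_def by (simp add: word_adj_def[abs_def])

lemma star_alg_free [simp, intro]: "star_alg (free_star_algebra X)"
  unfolding free_star_algebra_eq by (rule word.MA.star_alg_axioms)

lemma free_gen_closed [simp, intro]: "x \<in> X \<Longrightarrow> free_gen x \<in> carrier (free_star_algebra X)"
  by (auto simp: free_star_algebra_eq free_gen_def)

text \<open>A word is the product of its letters, and the letter \<open>(x, True)\<close> is the
  adjoint of the generator \<open>free_gen x\<close>.\<close>

lemma free_span: "carrier (free_star_algebra X) \<subseteq> star_span (free_star_algebra X) (free_gen ` X)"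
  unfolding free_star_algebra_eq
proof (rule word.MA_star_span)
  fix w :: "('a \<times> bool) list"
  let ?F = "monoid_star_algebra (word_monoid X) word_adj"
  let ?S = "star_span ?F (free_gen ` X)"
  assume "w \<in> carrier (word_monoid X)"
  then have "w \<in> lists (X \<times> UNIV)" by simp
  then show "Poly_Mapping.single w 1 \<in> ?S"
  proof (induction w rule: lists.induct)
    case Nil
    show ?case using star_span.one[of ?F "free_gen ` X"] by simp
  next
    case (Cons l w)
    obtain x b where l: "l = (x, b)" by (cases l)
    with Cons have x: "free_gen x \<in> ?S" by (auto intro: star_span.gen)
    have "Poly_Mapping.single [(x, True)] 1 = star ?F (free_gen x)"
      by (simp add: free_gen_def word.MA_star_single)
    with star_span.star[OF x] x have "Poly_Mapping.single [l] 1 \<in> ?S"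
      unfolding l by (cases b) (auto simp: free_gen_def)
    from star_span.mult[OF this Cons.IH] show ?case
      by (simp add: word.MA_mult_single)
  qed
qed

lemma free_universal:
  assumes "star_alg B" "\<And>x. x \<in> X \<Longrightarrow> f x \<in> carrier B"
  obtains h where "star_hom (free_star_algebra X) B h" "\<And>x. x \<in> X \<Longrightarrow> h (free_gen x) = f x"
proof -
  interpret B: star_alg B by fact
  \<comment> \<open>\<open>l\<close> evaluates a letter, sending the formal adjoint of
    \<open>x\<close> to the adjoint of \<open>f x\<close>; \<open>\<phi>\<close> multiplies the
    values along a word.\<close>
  define l where "l = (\<lambda>(x, b). if b then star B (f x) else f x)"
  define \<phi> where "\<phi> w = foldr (\<lambda>a y. l a \<otimes>\<^bsub>B\<^esub> y) w \<one>\<^bsub>B\<^esub>" for w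
  have [simp]: "\<phi> [] = \<one>\<^bsub>B\<^esub>" "\<phi> (a # w) = l a \<otimes>\<^bsub>B\<^esub> \<phi> w" for a w by (simp_all add: \<phi>_def)
  have l [simp]: "l a \<in> carrier B" if "a \<in> X \<times> UNIV" for a using that assms(2) by (auto simp: l_def)
  have cl: "\<phi> w \<in> carrier B" if "w \<in> lists (X \<times> UNIV)" for w
    using that by (induction w rule: lists.induct) auto
  have app: "\<phi> (u @ v) = \<phi> u \<otimes>\<^bsub>B\<^esub> \<phi> v" if "u \<in> lists (X \<times> UNIV)" "v \<in> lists (X \<times> UNIV)" for u v
    using that by (induction u rule: lists.induct) (auto simp: cl B.m_assoc simp del:
        in_lists_conv_set)
  have adj: "\<phi> (word_adj w) = star B (\<phi> w)" if "w \<in> lists (X \<times> UNIV)" for w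
    using that
  proof (induction w rule: lists.induct)
    case (Cons a w)
    obtain x b where a: "a = (x, b)" by (cases a)
    with Cons have [simp]: "x \<in> X" by auto
    have "\<phi> (word_adj (a # w)) = \<phi> (word_adj w) \<otimes>\<^bsub>B\<^esub> \<phi> [(x, \<not> b)]"
      unfolding a word_adj_simps using Cons by (intro app word_adj_lists) auto
    also have "\<phi> [(x, \<not> b)] = star B (l a)" by (auto simp: a l_def assms(2))
    finally show ?case using Cons by (simp add: B.star_mult cl)
  qed simp
  have "star_hom (monoid_star_algebra (word_monoid X) word_adj) B (B.lin_ext \<phi>)"
    by (rule word.MA_universal[OF assms(1)]) (simp_all add: cl app adj del: in_lists_conv_set)
  then show thesis unfolding free_star_algebra_eq[symmetric]
    by (rule that) (simp add: free_gen_def l_def assms(2))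
qed

section \<open>Tensor products\<close>

text \<open>Linear and bilinear maps are treated alongside homomorphisms because the map L and the
  left inverse of \<alpha> are constructed as linear maps only.\<close>

definition bilinear_map ::
  "('a, 'c) star_algebra_scheme \<Rightarrow> ('b, 'd) star_algebra_scheme \<Rightarrow> ('v, 'e) star_algebra_scheme \<Rightarrow>
   ('a \<Rightarrow> 'b \<Rightarrow> 'v) \<Rightarrow> bool"
  where "bilinear_map A B V \<beta> \<longleftrightarrow>
    (\<forall>a\<in>carrier A. \<forall>b\<in>carrier B. \<beta> a b \<in> carrier V) \<and>
    (\<forall>a\<in>carrier A. \<forall>a'\<in>carrier A. \<forall>b\<in>carrier B. \<beta> (a \<oplus>\<^bsub>A\<^esub> a') b = \<beta> a b \<oplus>\<^bsub>V\<^esub> \<beta> a' b) \<and>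
    (\<forall>a\<in>carrier A. \<forall>b\<in>carrier B. \<forall>b'\<in>carrier B. \<beta> a (b \<oplus>\<^bsub>B\<^esub> b') = \<beta> a b \<oplus>\<^bsub>V\<^esub> \<beta> a b') \<and>
    (\<forall>c. \<forall>a\<in>carrier A. \<forall>b\<in>carrier B. \<beta> (c \<odot>\<^bsub>A\<^esub> a) b = c \<odot>\<^bsub>V\<^esub> \<beta> a b) \<and>
    (\<forall>c. \<forall>a\<in>carrier A. \<forall>b\<in>carrier B. \<beta> a (c \<odot>\<^bsub>B\<^esub> b) = c \<odot>\<^bsub>V\<^esub> \<beta> a b)"

definition linear_map ::
  "('a, 'c) star_algebra_scheme \<Rightarrow> ('v, 'e) star_algebra_scheme \<Rightarrow> ('a \<Rightarrow> 'v) \<Rightarrow> bool"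
  where "linear_map A V f \<longleftrightarrow>
    (\<forall>a\<in>carrier A. f a \<in> carrier V) \<and>
    (\<forall>a\<in>carrier A. \<forall>b\<in>carrier A. f (a \<oplus>\<^bsub>A\<^esub> b) = f a \<oplus>\<^bsub>V\<^esub> f b) \<and>
    (\<forall>c. \<forall>a\<in>carrier A. f (c \<odot>\<^bsub>A\<^esub> a) = c \<odot>\<^bsub>V\<^esub> f a)"

lemma bilinear_mapD:
  assumes "bilinear_map A B V \<beta>" "a \<in> carrier A" "b \<in> carrier B"
  shows "\<beta> a b \<in> carrier V"
    and "a' \<in> carrier A \<Longrightarrow> \<beta> (a \<oplus>\<^bsub>A\<^esub> a') b = \<beta> a b \<oplus>\<^bsub>V\<^esub> \<beta> a' b"
    and "b' \<in> carrier B \<Longrightarrow> \<beta> a (b \<oplus>\<^bsub>B\<^esub> b') = \<beta> a b \<oplus>\<^bsub>V\<^esub> \<beta> a b'"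
    and "\<beta> (c \<odot>\<^bsub>A\<^esub> a) b = c \<odot>\<^bsub>V\<^esub> \<beta> a b" "\<beta> a (c \<odot>\<^bsub>B\<^esub> b) = c \<odot>\<^bsub>V\<^esub> \<beta> a b"
  using assms by (auto simp: bilinear_map_def)

lemma linear_mapD:
  assumes "linear_map A V f" "a \<in> carrier A"
  shows "f a \<in> carrier V" "b \<in> carrier A \<Longrightarrow> f (a \<oplus>\<^bsub>A\<^esub> b) = f a \<oplus>\<^bsub>V\<^esub> f b" "f (c \<odot>\<^bsub>A\<^esub> a) = c \<odot>\<^bsub>V\<^esub> f a"
  using assms by (auto simp: linear_map_def)

lemma (in star_alg) lin_ext_diff:
  assumes "b \<in> S \<rightarrow> carrier A" "Poly_Mapping.keys f \<subseteq> S" "Poly_Mapping.keys g \<subseteq> S"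
  shows "lin_ext b (f - g) = lin_ext b f \<ominus> lin_ext b g"
proof -
  have k: "Poly_Mapping.keys (f - g) \<subseteq> S" using assms(2,3)
    by (intro order.trans[OF _ Un_least[OF assms(2,3)]] subsetI, unfold Un_iff in_keys_iff)
        (auto simp: lookup_minus)
  have "lin_ext b (f - g) \<oplus> lin_ext b g = lin_ext b f"
    using lin_ext_add[OF assms(1) k assms(3)] by simp
  then show ?thesis 
    using lin_ext_closed[OF assms(1)] assms k by (metis a_minus_def add.inv_solve_right)
qed

locale star_alg_pair = A: star_alg A + B: star_alg B for A (structure) and B (structure)
begin

abbreviation P where "P \<equiv> pair_algebra A B"
abbreviation T where "T \<equiv> tensor_algebra A B"
abbreviation pt where "pt \<equiv> pure_tensor A B"
abbreviation R where "R \<equiv> bilinear_rels A B"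

sublocale pair: involutive_monoid "A \<times>\<times> B" "map_prod (star A) (star B)"
proof -
  interpret M: monoid "A \<times>\<times> B"
    by (rule DirProd_monoid) (rule A.monoid_axioms B.monoid_axioms)+
  show "involutive_monoid (A \<times>\<times> B) (map_prod (star A) (star B))"
    by unfold_locales (auto simp: A.star_mult B.star_mult)
qed

lemma P_eq: "P = pair.MA" by (simp add: pair_algebra_def)

lemma single_closed [simp]: "a \<in> carrier A \<Longrightarrow> b \<in> carrier B \<Longrightarrow>
    Poly_Mapping.single (a, b) c \<in> carrier P"
  by (simp add: P_eq)

lemma diff_closed: "f \<in> carrier P \<Longrightarrow> g \<in> carrier P \<Longrightarrow> f - g \<in> carrier P"
  unfolding P_eq by (rule pair.MA_diff_closed)

lemma bilinear_relsI:
  assumes "a \<in> carrier A" "b \<in> carrier B"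
  shows "a' \<in> carrier A \<Longrightarrow> Poly_Mapping.single (a \<oplus>\<^bsub>A\<^esub> a', b) 1 - Poly_Mapping.single (a, b)
      1 - Poly_Mapping.single (a', b) 1 \<in> R"
    "b' \<in> carrier B \<Longrightarrow> Poly_Mapping.single (a, b \<oplus>\<^bsub>B\<^esub> b') 1 - Poly_Mapping.single (a, b)
        1 - Poly_Mapping.single (a, b') 1 \<in> R"
    "Poly_Mapping.single (c \<odot>\<^bsub>A\<^esub> a, b) 1 - Poly_Mapping.single (a, b) c \<in> R"
    "Poly_Mapping.single (a, c \<odot>\<^bsub>B\<^esub> b) 1 - Poly_Mapping.single (a, b) c \<in> R"
  unfolding bilinear_rels_def Let_def
  subgoal by (rule UnI1, rule UnI1, rule UnI1, rule CollectI, (rule exI)+, rule conjI, rule refl)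
      (simp add: assms)
  subgoal by (rule UnI1, rule UnI1, rule UnI2, rule CollectI, (rule exI)+, rule conjI, rule refl)
      (simp add: assms)
  subgoal by (rule UnI1, rule UnI2, rule CollectI, (rule exI)+, rule conjI, rule refl) (simp add:
      assms)
  subgoal by (rule UnI2, rule CollectI, (rule exI)+, rule conjI, rule refl) (simp add: assms)
  done

lemma bilinear_rels_closed: "R \<subseteq> carrier P"
  unfolding bilinear_rels_def Let_def
  by (auto intro!: diff_closed single_closed simp del: pair.MA_simps)

sublocale P: star_alg P
  unfolding P_eq by (rule pair.MA.star_alg_axioms)

sublocale T: star_presentation P R
  by unfold_locales (rule bilinear_rels_closed)

sublocale T: star_alg T
  unfolding tensor_algebra_def by (rule T.quot_star_alg)

lemma pt_eq: "pt a b = T.cls (Poly_Mapping.single (a, b) 1)"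
  by (simp add: pure_tensor_def)

lemmas T_simps = T.quot_simps[folded tensor_algebra_def]

lemma pt_closed [simp, intro]: "a \<in> carrier A \<Longrightarrow> b \<in> carrier B \<Longrightarrow> pt a b \<in> carrier T"
  by (auto simp: pt_eq T_simps)

lemma pt_mult:
  "a \<in> carrier A \<Longrightarrow> b \<in> carrier B \<Longrightarrow> a' \<in> carrier A \<Longrightarrow> b' \<in> carrier B \<Longrightarrow>
   pt a b \<otimes>\<^bsub>T\<^esub> pt a' b' = pt (a \<otimes>\<^bsub>A\<^esub> a') (b \<otimes>\<^bsub>B\<^esub> b')"
  by (simp add: pt_eq T_simps) (simp add: P_eq pair.MA_mult_single)

lemma pt_one: "\<one>\<^bsub>T\<^esub> = pt \<one>\<^bsub>A\<^esub> \<one>\<^bsub>B\<^esub>"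
  by (simp add: pt_eq T_simps) (simp add: P_eq one_DirProd)

lemma pt_star: "a \<in> carrier A \<Longrightarrow> b \<in> carrier B \<Longrightarrow> star T (pt a b) = pt (star A a) (star B b)"
  by (simp add: pt_eq T_simps) (simp add: P_eq pair.MA_star_single)

lemma P_add: "f \<oplus>\<^bsub>P\<^esub> g = f + g" and P_smult: "c \<odot>\<^bsub>P\<^esub> f = Poly_Mapping.map ((*) c) f"
  by (simp_all add: P_eq)

lemma cls_eqI:
  assumes "f \<in> carrier P" "g \<in> carrier P" "f - g \<in> R"
  shows "T.cls f = T.cls g"
  using T.star_ideal_gen(1)[OF assms(3)] pair.MA_minus[of f g, folded P_eq, OF assms(1,2)]
  by (simp add: T.cls_eq_iff assms(1,2))

lemma pt_add_left:
  assumes "a \<in> carrier A" "a' \<in> carrier A" "b \<in> carrier B"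
  shows "pt (a \<oplus>\<^bsub>A\<^esub> a') b = pt a b \<oplus>\<^bsub>T\<^esub> pt a' b"
proof -
  have "T.cls (Poly_Mapping.single (a \<oplus>\<^bsub>A\<^esub> a', b) 1)
      = T.cls (Poly_Mapping.single (a, b) 1 \<oplus>\<^bsub>P\<^esub> Poly_Mapping.single (a', b) 1)"
    using assms bilinear_relsI by (intro cls_eqI P.a_closed single_closed) (simp_all add: P_add
        diff_diff_eq[symmetric])
  then show ?thesis using assms by (simp add: pt_eq T_simps)
qed

lemma pt_add_right:
  assumes "a \<in> carrier A" "b \<in> carrier B" "b' \<in> carrier B"
  shows "pt a (b \<oplus>\<^bsub>B\<^esub> b') = pt a b \<oplus>\<^bsub>T\<^esub> pt a b'"
proof -
  have "T.cls (Poly_Mapping.single (a, b \<oplus>\<^bsub>B\<^esub> b') 1)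
      = T.cls (Poly_Mapping.single (a, b) 1 \<oplus>\<^bsub>P\<^esub> Poly_Mapping.single (a, b') 1)"
    using assms bilinear_relsI by (intro cls_eqI P.a_closed single_closed) (simp_all add: P_add
        diff_diff_eq[symmetric])
  then show ?thesis using assms by (simp add: pt_eq T_simps)
qed

lemma pt_smult_left:
  assumes "a \<in> carrier A" "b \<in> carrier B"
  shows "pt (c \<odot>\<^bsub>A\<^esub> a) b = c \<odot>\<^bsub>T\<^esub> pt a b"
proof -
  have "T.cls (Poly_Mapping.single (c \<odot>\<^bsub>A\<^esub> a, b) 1) = T.cls (c \<odot>\<^bsub>P\<^esub> Poly_Mapping.single (a, b) 1)"
    using assms bilinear_relsI by (intro cls_eqI P.smult_closed single_closed) (simp_all add:
        P_smult)
  then show ?thesis using assms by (simp add: pt_eq T_simps)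
qed

lemma pt_smult_right:
  assumes "a \<in> carrier A" "b \<in> carrier B"
  shows "pt a (c \<odot>\<^bsub>B\<^esub> b) = c \<odot>\<^bsub>T\<^esub> pt a b"
proof -
  have "T.cls (Poly_Mapping.single (a, c \<odot>\<^bsub>B\<^esub> b) 1) = T.cls (c \<odot>\<^bsub>P\<^esub> Poly_Mapping.single (a, b) 1)"
    using assms bilinear_relsI by (intro cls_eqI P.smult_closed single_closed) (simp_all add:
        P_smult)
  then show ?thesis using assms by (simp add: pt_eq T_simps)
qed

lemma pt_zero [simp]:
  "b \<in> carrier B \<Longrightarrow> pt \<zero>\<^bsub>A\<^esub> b = \<zero>\<^bsub>T\<^esub>" "a \<in> carrier A \<Longrightarrow> pt a \<zero>\<^bsub>B\<^esub> = \<zero>\<^bsub>T\<^esub>"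
  using pt_smult_left[of "\<zero>\<^bsub>A\<^esub>" b 0] pt_smult_right[of a "\<zero>\<^bsub>B\<^esub>" 0] by simp_all

lemma pt_finsum_left:
  "finite S \<Longrightarrow> f \<in> S \<rightarrow> carrier A \<Longrightarrow> b \<in> carrier B \<Longrightarrow> pt (\<Oplus>\<^bsub>A\<^esub>i\<in>S. f i) b = (\<Oplus>\<^bsub>T\<^esub>i\<in>S. pt (f i) b)"
  by (induction S rule: finite_induct) (auto simp: Pi_def pt_add_left)

lemma pt_finsum_right:
  "finite S \<Longrightarrow> f \<in> S \<rightarrow> carrier B \<Longrightarrow> a \<in> carrier A \<Longrightarrow> pt a (\<Oplus>\<^bsub>B\<^esub>i\<in>S. f i) = (\<Oplus>\<^bsub>T\<^esub>i\<in>S. pt a (f i))"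
  by (induction S rule: finite_induct) (auto simp: Pi_def pt_add_right)

lemma star_hom_left: "star_hom A T (\<lambda>a. pt a \<one>\<^bsub>B\<^esub>)"
  by (rule star_homI) (auto simp: pt_add_left pt_mult pt_one pt_smult_left pt_star)

lemma star_hom_right: "star_hom B T (\<lambda>b. pt \<one>\<^bsub>A\<^esub> b)"
  by (rule star_homI) (auto simp: pt_add_right pt_mult pt_one pt_smult_right pt_star)

lemma pt_split: "a \<in> carrier A \<Longrightarrow> b \<in> carrier B \<Longrightarrow> pt a b = pt a \<one>\<^bsub>B\<^esub> \<otimes>\<^bsub>T\<^esub> pt \<one>\<^bsub>A\<^esub> b"
  by (simp add: pt_mult)

lemma tensor_span_pt: "carrier T \<subseteq> star_span T {pt a b | a b. a \<in> carrier A \<and> b \<in> carrier B}"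
proof -
  let ?S = "(\<lambda>(a, b). Poly_Mapping.single (a, b) 1) ` (carrier A \<times> carrier B)"
  have S: "?S \<subseteq> carrier P" by auto
  have "carrier P \<subseteq> star_span P ?S"
    unfolding P_eq by (rule pair.MA_star_span) (auto intro!: star_span.gen)
  moreover have "T.cls ` ?S = {pt a b | a b. a \<in> carrier A \<and> b \<in> carrier B}"
    unfolding pt_eq by (force simp: image_iff)
  ultimately show ?thesis
    using T.quot_span[OF S] unfolding tensor_algebra_def[symmetric] by simp
qed

text \<open>Every pure tensor splits as \<open>pt a \<one>\<close> times \<open>pt \<one> b\<close>,
  so generators of the two factors generate the tensor product.\<close>

lemma tensor_span:
  assumes "S \<subseteq> carrier A" "carrier A \<subseteq> star_span A S" "S' \<subseteq> carrier B" "carrier B \<subseteq> star_span B S'"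
  shows "carrier T \<subseteq> star_span T ((\<lambda>a. pt a \<one>\<^bsub>B\<^esub>) ` S \<union> (\<lambda>b. pt \<one>\<^bsub>A\<^esub> b) ` S')" (is "_ \<subseteq> star_span T ?G")
proof -
  have "pt a \<one>\<^bsub>B\<^esub> \<in> star_span T ?G" if "a \<in> carrier A" for a
    using star_hom_span_subset[OF A.star_alg_axioms assms(1,2) star_hom_left, of ?G] that by auto
  moreover have "pt \<one>\<^bsub>A\<^esub> b \<in> star_span T ?G" if "b \<in> carrier B" for b
    using star_hom_span_subset[OF B.star_alg_axioms assms(3,4) star_hom_right, of ?G] that by auto
  ultimately have "pt a \<one>\<^bsub>B\<^esub> \<otimes>\<^bsub>T\<^esub> pt \<one>\<^bsub>A\<^esub> b \<in> star_span T ?G" if "a \<in> carrier A" "b \<in> carrier B" for a b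
    using that by (blast intro: star_span.mult)
  then have "{pt a b | a b. a \<in> carrier A \<and> b \<in> carrier B} \<subseteq> star_span T ?G"
  proof clarify
    fix a b assume *: "\<And>a b. a \<in> carrier A \<Longrightarrow> b \<in> carrier B \<Longrightarrow> pt a \<one>\<^bsub>B\<^esub> \<otimes>\<^bsub>T\<^esub> pt \<one>\<^bsub>A\<^esub> b \<in> star_span T ?G"
      and ab: "a \<in> carrier A" "b \<in> carrier B"
    show "pt a b \<in> star_span T ?G" unfolding pt_split[OF ab] by (rule *[OF ab])
  qed
  from star_span_mono[OF this] tensor_span_pt show ?thesis by blast
qed

lemma P_single_simps:
  "star P (f - g) = star P f - star P g"
  "star P (Poly_Mapping.single (a, b) c) = Poly_Mapping.single (star A a, star B b) (cnj c)"
  using pair.MA_star_add[of "f - g" g] by (simp_all add: P_eq pair.MA_star_single)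

text \<open>Star maps each of the four families to itself, conjugating the scalar in the last two.
  Thus the star ideal of the relations needs no control beyond the relations themselves.\<close>

lemma star_bilinear_rels: "star P ` R \<subseteq> R"
proof -
  have "star P r \<in> R" if "r \<in> R" for r
    using that[unfolded bilinear_rels_def Let_def]
  proof (elim UnE CollectE exE conjE, goal_cases)
    case 1 then show ?case using bilinear_relsI(1) by (simp add: P_single_simps A.star_add)
  next
    case 2 then show ?case using bilinear_relsI(2) by (simp add: P_single_simps B.star_add)
  next
    case 3 then show ?case using bilinear_relsI(3) by (simp add: P_single_simps A.star_smult)
  next
    case 4 then show ?case using bilinear_relsI(4) by (simp add: P_single_simps B.star_smult)
  qed
  then show ?thesis by blast
qed

section \<open>Maps out of a tensor product\<close>

text \<open>This makes the quotient by a star ideal the usual tensor product of vector spaces.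
  Multiplying by a pair (s, t) before extending \<open>\<beta>\<close> is the same, up to a scalar,
  as extending the shifted map \<open>\<beta> (s a) (t b)\<close>, which is again bilinear.\<close>

lemma bilinear_ext_vanish:
  assumes "star_alg V" "bilinear_map A B V \<beta>" "f \<in> star_ideal P R"
  shows "star_alg.lin_ext V (case_prod \<beta>) f = \<zero>\<^bsub>V\<^esub>"
proof -
  interpret V: star_alg V by fact
  \<comment> \<open>All bilinear maps are taken at once: for a single \<open>\<beta>\<close> the set
    need not be an ideal, since multiplication replaces \<open>\<beta>\<close> by a shifted
    map.\<close>
  let ?J = "{f \<in> carrier P. \<forall>\<beta>. bilinear_map A B V \<beta> \<longrightarrow> V.lin_ext (case_prod \<beta>) f = \<zero>\<^bsub>V\<^esub>}"
  have Pi: "case_prod \<beta> \<in> carrier (A \<times>\<times> B) \<rightarrow> carrier V" if "bilinear_map A B V \<beta>" for \<beta>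
    using that by (auto simp: bilinear_map_def)
  note ext_add = V.lin_ext_add[OF Pi] and diff = V.lin_ext_diff[OF Pi] and cl
      = V.lin_ext_closed[OF Pi]
  have shift_left: "bilinear_map A B V (\<lambda>a b. \<beta> (s \<otimes>\<^bsub>A\<^esub> a) (t \<otimes>\<^bsub>B\<^esub> b))"
    if "bilinear_map A B V \<beta>" "s \<in> carrier A" "t \<in> carrier B" for \<beta> s t
    using that by (simp add: bilinear_map_def A.r_distr B.r_distr A.mult_smult B.mult_smult)
  have shift_right: "bilinear_map A B V (\<lambda>a b. \<beta> (a \<otimes>\<^bsub>A\<^esub> s) (b \<otimes>\<^bsub>B\<^esub> t))"
    if "bilinear_map A B V \<beta>" "s \<in> carrier A" "t \<in> carrier B" for \<beta> s t
    using that by (simp add: bilinear_map_def A.l_distr B.l_distr A.smult_mult B.smult_mult)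
  have left: "V.lin_ext (case_prod \<beta>) (Poly_Mapping.single (s, t) c \<otimes>\<^bsub>P\<^esub> f)
      = c \<odot>\<^bsub>V\<^esub> V.lin_ext (\<lambda>(a, b). \<beta> (s \<otimes>\<^bsub>A\<^esub> a) (t \<otimes>\<^bsub>B\<^esub> b)) f"
    if \<beta>: "bilinear_map A B V \<beta>" and st: "s \<in> carrier A" "t \<in> carrier B" and f: "f \<in> carrier P"
        for \<beta> s t f c
  proof -
    have "Poly_Mapping.keys f \<subseteq> carrier (A \<times>\<times> B)" using f by (simp add: P_eq)
    then show ?thesis unfolding P_eq
    proof (induction rule: poly_mapping_span_induct)
      case (single s' d)
      then show ?case
        using st by (auto simp: pair.MA_mult_single bilinear_mapD[OF \<beta>] V.smult_smult)
    next
      case (add f g)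
      then have k: "Poly_Mapping.keys (Poly_Mapping.single (s, t) c \<otimes>\<^bsub>pair.MA\<^esub> h) \<subseteq> carrier (A \<times>\<times> B)"
        if "h \<in> {f, g}" for h using that st by (intro pair.MA_mult_closed) auto
      from add show ?case
        using shift_left[OF \<beta> st] k
        by (simp add: pair.MA_mult_addr \<beta> V.smult_add V.lin_ext_add[OF Pi] V.lin_ext_closed[OF Pi])
    qed simp
  qed
  have right: "V.lin_ext (case_prod \<beta>) (f \<otimes>\<^bsub>P\<^esub> Poly_Mapping.single (s, t) c)
      = c \<odot>\<^bsub>V\<^esub> V.lin_ext (\<lambda>(a, b). \<beta> (a \<otimes>\<^bsub>A\<^esub> s) (b \<otimes>\<^bsub>B\<^esub> t)) f"
    if \<beta>: "bilinear_map A B V \<beta>" and st: "s \<in> carrier A" "t \<in> carrier B" and f: "f \<in> carrier P"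
        for \<beta> s t f c
  proof -
    have "Poly_Mapping.keys f \<subseteq> carrier (A \<times>\<times> B)" using f by (simp add: P_eq)
    then show ?thesis unfolding P_eq
    proof (induction rule: poly_mapping_span_induct)
      case (single s' d)
      then show ?case
        using st by (auto simp: pair.MA_mult_single bilinear_mapD[OF \<beta>] V.smult_smult mult.commute)
    next
      case (add f g)
      then have k: "Poly_Mapping.keys (h \<otimes>\<^bsub>pair.MA\<^esub> Poly_Mapping.single (s, t) c) \<subseteq> carrier (A \<times>\<times> B)"
        if "h \<in> {f, g}" for h using that st by (intro pair.MA_mult_closed) auto
      from add show ?case
        using shift_right[OF \<beta> st] k
        by (simp add: pair.MA_mult_addl \<beta> V.smult_add V.lin_ext_add[OF Pi] V.lin_ext_closed[OF Pi])
    qed simp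
  qed
  have J_add: "f + g \<in> ?J" if "f \<in> ?J" "g \<in> ?J" for f g
    using that P.a_closed[of f g] by (auto simp: P_add) (simp add: P_eq ext_add)
  have J: "ideal ?J P"
  proof (rule P.ideal_by_closure)
    fix f x assume f: "f \<in> ?J" and x: "x \<in> carrier P"
    from x have "Poly_Mapping.keys x \<subseteq> carrier (A \<times>\<times> B)" by (simp add: P_eq)
    then show "x \<otimes>\<^bsub>P\<^esub> f \<in> ?J"
    proof (induction rule: poly_mapping_span_induct)
      case zero then show ?case by (simp add: P_eq)
    next
      case (single s c)
      then show ?case using f shift_left
        by (cases s) (auto simp: left intro!: P.m_closed)
    next
      case (add g h)
      then show ?case using f
        using J_add[OF add.IH] by (simp add: P_eq pair.MA_mult_addl)
    qed
    from x have "Poly_Mapping.keys x \<subseteq> carrier (A \<times>\<times> B)" by (simp add: P_eq)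
    then show "f \<otimes>\<^bsub>P\<^esub> x \<in> ?J"
    proof (induction rule: poly_mapping_span_induct)
      case zero then show ?case by (simp add: P_eq)
    next
      case (single s c)
      then show ?case using f shift_right
        by (cases s) (auto simp: right intro!: P.m_closed)
    next
      case (add g h)
      then show ?case using f
        using J_add[OF add.IH] by (simp add: P_eq pair.MA_mult_addr)
    qed
  qed (use J_add in \<open>auto simp: P_add\<close>, simp add: P_eq)
  have ext_diff: "V.lin_ext (case_prod \<beta>) (f - g)
      = V.lin_ext (case_prod \<beta>) f \<ominus>\<^bsub>V\<^esub> V.lin_ext (case_prod \<beta>) g"
    if "bilinear_map A B V \<beta>" "f \<in> carrier P" "g \<in> carrier P" for \<beta> f g
    using that diff by (simp add: P_eq)
  have cancel: "(x \<oplus>\<^bsub>V\<^esub> y) \<ominus>\<^bsub>V\<^esub> x \<ominus>\<^bsub>V\<^esub> y = \<zero>\<^bsub>V\<^esub>" if "x \<in> carrier V" "y \<in> carrier V" for x y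
    using that by algebra
  have "V.lin_ext (case_prod \<beta>) r = \<zero>\<^bsub>V\<^esub>" if \<beta>: "bilinear_map A B V \<beta>" and r: "r \<in> R" for \<beta> r
    using r unfolding bilinear_rels_def Let_def
    by (auto simp: ext_diff[OF \<beta>] diff_closed bilinear_mapD[OF \<beta>] cancel V.diff_eq_zero_iff)
  then have "R \<subseteq> ?J" using bilinear_rels_closed by blast
  moreover from this have "star P ` R \<subseteq> ?J" using star_bilinear_rels by blast
  ultimately have "star_ideal P R \<subseteq> ?J" by (rule P.star_ideal_minimal[OF J])
  with assms show ?thesis by auto
qed

text \<open>The commuting ranges make \<open>f a \<otimes> g b\<close> multiplicative and
  star-preserving on pairs; bilinearity then makes its extension kill the relations.\<close>

lemma tensor_hom_universal:
  assumes "star_alg C" "star_hom A C f" "star_hom B C g"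
    and comm: "\<And>a b. a \<in> carrier A \<Longrightarrow> b \<in> carrier B \<Longrightarrow> f a \<otimes>\<^bsub>C\<^esub> g b = g b \<otimes>\<^bsub>C\<^esub> f a"
  obtains h where "star_hom T C h" "\<And>a b. a \<in> carrier A \<Longrightarrow> b \<in> carrier B \<Longrightarrow> h (pt a b) = f a \<otimes>\<^bsub>C\<^esub> g b"
proof -
  interpret C: star_alg C by fact
  interpret f: star_alg_hom A C f by unfold_locales fact
  interpret g: star_alg_hom B C g by unfold_locales fact
  let ?\<beta> = "\<lambda>a b. f a \<otimes>\<^bsub>C\<^esub> g b"
  have \<beta>: "bilinear_map A B C ?\<beta>"
    by (simp add: bilinear_map_def f.hom_add g.hom_add f.hom_smult g.hom_smult C.l_distr C.r_distr
        C.smult_mult C.mult_smult)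
  have mult: "f (a \<otimes>\<^bsub>A\<^esub> a') \<otimes>\<^bsub>C\<^esub> g (b \<otimes>\<^bsub>B\<^esub> b') = (f a \<otimes>\<^bsub>C\<^esub> g b) \<otimes>\<^bsub>C\<^esub> (f a' \<otimes>\<^bsub>C\<^esub> g b')"
    if "a \<in> carrier A" "a' \<in> carrier A" "b \<in> carrier B" "b' \<in> carrier B" for a a' b b'
  proof -
    have "(f a \<otimes>\<^bsub>C\<^esub> g b) \<otimes>\<^bsub>C\<^esub> (f a' \<otimes>\<^bsub>C\<^esub> g b') = f a \<otimes>\<^bsub>C\<^esub> (g b \<otimes>\<^bsub>C\<^esub> f a') \<otimes>\<^bsub>C\<^esub> g b'"
      using that by (simp add: C.m_assoc)
    also have "g b \<otimes>\<^bsub>C\<^esub> f a' = f a' \<otimes>\<^bsub>C\<^esub> g b" using comm that by simp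
    finally show ?thesis using that by (simp add: C.m_assoc f.hom_mult g.hom_mult)
  qed
  have "star_hom P C (C.lin_ext (case_prod ?\<beta>))"
    unfolding P_eq
  proof (rule pair.MA_universal[OF assms(1)], goal_cases)
    case (4 s) then show ?case by (auto simp: C.star_mult comm simp flip: f.hom_star g.hom_star)
  qed (auto simp: mult one_DirProd)
  moreover have "C.lin_ext (case_prod ?\<beta>) r = \<zero>\<^bsub>C\<^esub>" if "r \<in> R" for r
    using bilinear_ext_vanish[OF assms(1) \<beta>] T.star_ideal_gen(1)[OF that] by simp
  ultimately obtain h where h: "star_hom T C h" "\<And>x. x \<in> carrier P \<Longrightarrow> h (T.cls x)
      = C.lin_ext (case_prod ?\<beta>) x"
    using T.quot_universal[OF assms(1)] unfolding tensor_algebra_def by blast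
  from h(1) show thesis by (rule that) (simp add: pt_eq h(2))
qed

text \<open>The extension of \<open>\<beta>\<close> need not be multiplicative, so the universal
  property of star quotients does not apply. It still factors through classes, by
  \<open>bilinear_ext_vanish\<close>.\<close>

lemma tensor_linear_universal:
  assumes "star_alg V" "bilinear_map A B V \<beta>"
  obtains h where "linear_map T V h" "\<And>a b. a \<in> carrier A \<Longrightarrow> b \<in> carrier B \<Longrightarrow> h (pt a b) = \<beta> a b"
proof -
  interpret V: star_alg V by fact
  let ?l = "V.lin_ext (case_prod \<beta>)"
  have Pi: "case_prod \<beta> \<in> carrier A \<times> carrier B \<rightarrow> carrier V"
    using assms(2) by (auto simp: bilinear_map_def)
  have keys: "Poly_Mapping.keys x \<subseteq> carrier A \<times> carrier B" if "x \<in> carrier P" for x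
    using that by (simp add: P_eq)
  have eq: "?l x = ?l y" if "T.cls x = T.cls y" "x \<in> carrier P" "y \<in> carrier P" for x y
  proof -
    have "?l (x \<ominus>\<^bsub>P\<^esub> y) = \<zero>\<^bsub>V\<^esub>"
      using bilinear_ext_vanish[OF assms] that T.cls_eq_iff by blast
    then have "?l x \<ominus>\<^bsub>V\<^esub> ?l y = \<zero>\<^bsub>V\<^esub>"
      using pair.MA_minus[of x y, folded P_eq, OF that(2,3)] V.lin_ext_diff[OF Pi keys keys]
          that by simp
    then show ?thesis using V.diff_eq_zero_iff V.lin_ext_closed[OF Pi keys] that by simp
  qed
  define h where "h X = ?l (SOME x. x \<in> carrier P \<and> T.cls x = X)" for X
  have h: "h (T.cls x) = ?l x" if "x \<in> carrier P" for x
  proof -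
    have "(SOME y. y \<in> carrier P \<and> T.cls y = T.cls x) \<in> carrier P \<and> T.cls (SOME y. y \<in> carrier P \<and>
        T.cls y = T.cls x) = T.cls x"
      by (rule someI[of _ x]) (use that in auto)
    then show ?thesis unfolding h_def using eq that by blast
  qed
  have "linear_map T V h"
    unfolding linear_map_def
    using V.lin_ext_closed[OF Pi keys] V.lin_ext_add[OF Pi keys keys] V.lin_ext_scale[OF Pi keys]
    by (auto simp: T_simps h) (simp_all add: P_add P_smult)
  then show thesis by (rule that) (use assms(2) in \<open>simp add: pt_eq h bilinear_mapD\<close>)
qed

text \<open>Coproducts of generators are sums of pure tensors. Orthogonality in either tensor factor
  removes the cross terms, so the double sum becomes a single one.\<close>

lemma sum_pt_mult:
  assumes "finite S" and cl: "\<And>k. k \<in> S \<Longrightarrow> x k \<in> carrier A" "\<And>k. k \<in> S \<Longrightarrow> x' k \<in> carrier A"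
    "\<And>k. k \<in> S \<Longrightarrow> y k \<in> carrier B" "\<And>k. k \<in> S \<Longrightarrow> y' k \<in> carrier B"
    and orth: "\<And>k l. k \<in> S \<Longrightarrow> l \<in> S \<Longrightarrow> k \<noteq> l \<Longrightarrow> x k \<otimes>\<^bsub>A\<^esub> x' l = \<zero>\<^bsub>A\<^esub> \<or> y k \<otimes>\<^bsub>B\<^esub> y' l = \<zero>\<^bsub>B\<^esub>"
  shows "(\<Oplus>\<^bsub>T\<^esub>k\<in>S. pt (x k) (y k)) \<otimes>\<^bsub>T\<^esub> (\<Oplus>\<^bsub>T\<^esub>k\<in>S. pt (x' k) (y' k))
    = (\<Oplus>\<^bsub>T\<^esub>k\<in>S. pt (x k \<otimes>\<^bsub>A\<^esub> x' k) (y k \<otimes>\<^bsub>B\<^esub> y' k))"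
proof -
  let ?z = "\<lambda>k. pt (x k \<otimes>\<^bsub>A\<^esub> x' k) (y k \<otimes>\<^bsub>B\<^esub> y' k)"
  have "pt (x k) (y k) \<otimes>\<^bsub>T\<^esub> (\<Oplus>\<^bsub>T\<^esub>l\<in>S. pt (x' l) (y' l)) = ?z k" if k: "k \<in> S" for k
  proof -
    have "pt (x k) (y k) \<otimes>\<^bsub>T\<^esub> (\<Oplus>\<^bsub>T\<^esub>l\<in>S. pt (x' l) (y' l)) = (\<Oplus>\<^bsub>T\<^esub>l\<in>S. pt (x k) (y k) \<otimes>\<^bsub>T\<^esub> pt (x' l) (y' l))"
      using assms(1) cl k by (intro T.finsum_rdistr) auto
    also have "\<dots> = (\<Oplus>\<^bsub>T\<^esub>l\<in>S. if k = l then ?z l else \<zero>\<^bsub>T\<^esub>)"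
    proof (rule T.finsum_cong')
      fix l assume l: "l \<in> S"
      show "pt (x k) (y k) \<otimes>\<^bsub>T\<^esub> pt (x' l) (y' l) = (if k = l then ?z l else \<zero>\<^bsub>T\<^esub>)"
        using orth[OF k l] cl k l by (auto simp: pt_mult)
    qed (use cl in auto)
    also have "\<dots> = ?z k" using assms(1) cl k by (intro T.finsum_singleton) auto
    finally show ?thesis .
  qed
  then show ?thesis
    using assms(1) cl by (subst T.finsum_ldistr) (simp_all add: Pi_def cong: T.finsum_cong)
qed

end

lemma star_alg_tensor [simp]:
  assumes "star_alg A" "star_alg B" shows "star_alg (tensor_algebra A B)"
proof -
  interpret star_alg_pair A B using assms by (simp add: star_alg_pair_def)
  show ?thesis by (rule T.star_alg_axioms)
qed

text \<open>The maps sending a to f(a) \<otimes> 1 and b to 1 \<otimes> g(b) have commuting ranges,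
  which gives existence; uniqueness holds because pure tensors generate.\<close>

lemma tensor_map:
  assumes "star_alg A" "star_alg B" "star_alg A1" "star_alg B1" "star_hom A A1 f" "star_hom B B1 g"
  shows "star_hom (tensor_algebra A B) (tensor_algebra A1 B1) (tensor_map A B A1 B1 f g)"
    and "a \<in> carrier A \<Longrightarrow> b \<in> carrier B \<Longrightarrow>
      tensor_map A B A1 B1 f g (pure_tensor A B a b) = pure_tensor A1 B1 (f a) (g b)"
proof -
  interpret X: star_alg_pair A B using assms by (simp add: star_alg_pair_def)
  interpret Y: star_alg_pair A1 B1 using assms by (simp add: star_alg_pair_def)
  note f = star_homD[OF assms(5)] and g = star_homD[OF assms(6)]
  obtain h where h: "star_hom X.T Y.T h"
    "\<And>a b. a \<in> carrier A \<Longrightarrow> b \<in> carrier B \<Longrightarrow> h (X.pt a b) = Y.pt (f a) \<one>\<^bsub>B1\<^esub> \<otimes>\<^bsub>Y.T\<^esub> Y.pt \<one>\<^bsub>A1\<^esub> (g b)"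
    by (rule X.tensor_hom_universal[OF Y.T.star_alg_axioms star_hom_comp[OF assms(5)
        Y.star_hom_left]
          star_hom_comp[OF assms(6) Y.star_hom_right]]) (auto simp: Y.pt_mult f g)
  let ?P = "\<lambda>h. \<forall>a\<in>carrier A. \<forall>b\<in>carrier B. h (X.pt a b) = Y.pt (f a) (g b)"
  have "star_hom X.T Y.T (tensor_map A B A1 B1 f g) \<and> ?P (tensor_map A B A1 B1 f g)"
    unfolding tensor_map_def
  proof (rule the_star_homI[OF X.T.star_alg_axioms h(1)])
    show "?P (restrict h (carrier X.T))"
      by (simp add: h(2) Y.pt_mult f g)
    show "k x = l x" if kl: "star_hom X.T Y.T k" "star_hom X.T Y.T l" "?P k" "?P l"
        "x \<in> carrier X.T" for k l x
      by (rule star_hom_unique[OF X.T.star_alg_axioms _ X.tensor_span_pt kl(1,2) _ kl(5)])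
        (use kl(3,4) in auto)
  qed
  then show "star_hom X.T Y.T (tensor_map A B A1 B1 f g)"
    "a \<in> carrier A \<Longrightarrow> b \<in> carrier B \<Longrightarrow> tensor_map A B A1 B1 f g (X.pt a b) = Y.pt (f a) (g b)"
    by blast+
qed

text \<open>The index set \<open>{1..N}\<close> is opaque to the simplifier from here on.\<close>

declare One_nat_def [simp del] atLeastAtMost_iff [simp del]

lemma (in star_presentation) star_hom_cls_relations:
  assumes "star_alg A'" "\<And>a. a \<in> carrier A' \<Longrightarrow> \<phi> a \<in> carrier A" "hom_relations A' A \<phi> \<subseteq> R"
  shows "star_hom A' Q (\<lambda>a. cls (\<phi> a))"
proof -
  have "star_alg_hom A Q cls"
    using star_alg_axioms quot_star_alg star_hom_cls by (simp add: star_alg_hom_def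
        star_alg_hom_axioms_def)
  from hom_relations_vanish_iff[OF assms(1) this, of \<phi>, OF assms(2)] assms(3) cls_rel show ?thesis
      by auto
qed

lemma star_alg_hom_free:
  "star_alg B \<Longrightarrow> star_hom (free_star_algebra X) B h \<Longrightarrow> star_alg_hom (free_star_algebra X) B h"
  by (simp add: star_alg_hom_def star_alg_hom_axioms_def)

section \<open>Group algebras\<close>

text \<open>A homomorphism into the unitaries of \<open>B\<close>: together with the other clauses,
  the condition on inverses says that \<open>n g\<close> is unitary. These are the data of a star
  homomorphism out of the group algebra.\<close>

definition unitary_rep :: "('g, 'c) monoid_scheme \<Rightarrow> ('b, 'd) star_algebra_scheme \<Rightarrow> ('g \<Rightarrow> 'b) \<Rightarrow> bool"
  where "unitary_rep \<Gamma> B n \<longleftrightarrow> (\<forall>g\<in>carrier \<Gamma>. n g \<in> carrier B \<and> n (inv\<^bsub>\<Gamma>\<^esub> g) = star B (n g)) \<and>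
    n \<one>\<^bsub>\<Gamma>\<^esub> = \<one>\<^bsub>B\<^esub> \<and> (\<forall>g\<in>carrier \<Gamma>. \<forall>h\<in>carrier \<Gamma>. n (g \<otimes>\<^bsub>\<Gamma>\<^esub> h) = n g \<otimes>\<^bsub>B\<^esub> n h)"

lemma unitary_repD:
  assumes "unitary_rep \<Gamma> B n"
  shows "g \<in> carrier \<Gamma> \<Longrightarrow> n g \<in> carrier B" "g \<in> carrier \<Gamma> \<Longrightarrow> n (inv\<^bsub>\<Gamma>\<^esub> g) = star B (n g)"
    "n \<one>\<^bsub>\<Gamma>\<^esub> = \<one>\<^bsub>B\<^esub>"
    "g \<in> carrier \<Gamma> \<Longrightarrow> h \<in> carrier \<Gamma> \<Longrightarrow> n (g \<otimes>\<^bsub>\<Gamma>\<^esub> h) = n g \<otimes>\<^bsub>B\<^esub> n h"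
  using assms by (auto simp: unitary_rep_def)

lemma unitary_rep_hom:
  "unitary_rep \<Gamma> A n \<Longrightarrow> star_hom A B f \<Longrightarrow> unitary_rep \<Gamma> B (\<lambda>g. f (n g))"
  by (simp add: unitary_rep_def star_homD)

context group begin

interpretation inv: involutive_monoid G "m_inv G"
  by unfold_locales (simp_all add: inv_mult_group)

lemma group_algebra_eq: "group_algebra G = inv.MA"
  by (simp add: group_algebra_def)

lemma star_alg_group_algebra: "star_alg (group_algebra G)"
  unfolding group_algebra_eq by (rule inv.MA.star_alg_axioms)

lemma group_elem_closed: "g \<in> carrier G \<Longrightarrow> group_elem g \<in> carrier (group_algebra G)"
  by (simp add: group_algebra_eq)

lemma unitary_rep_group_elem: "unitary_rep G (group_algebra G) group_elem"
  by (simp add: unitary_rep_def group_algebra_eq inv.MA_mult_single inv.MA_star_single)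

lemma group_algebra_span: "carrier (group_algebra G) \<subseteq> star_span (group_algebra G) (group_elem `
    carrier G)"
  unfolding group_algebra_eq by (rule inv.MA_star_span) (auto intro: star_span.gen)

lemma group_algebra_universal:
  assumes "star_alg B" "unitary_rep G B n"
  shows "star_hom (group_algebra G) B (star_alg.lin_ext B n)"
    "g \<in> carrier G \<Longrightarrow> star_alg.lin_ext B n (group_elem g) = n g"
proof -
  interpret B: star_alg B by fact
  show "star_hom (group_algebra G) B (B.lin_ext n)"
    unfolding group_algebra_eq
    by (rule inv.MA_universal[OF assms(1)]) (simp_all add: unitary_repD[OF assms(2)])
  show "g \<in> carrier G \<Longrightarrow> B.lin_ext n (group_elem g) = n g"
    by (simp add: unitary_repD[OF assms(2)])
qed

lemma group_algebra_hom_unique: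
  assumes "star_hom (group_algebra G) B f" "star_hom (group_algebra G) B h"
    "\<And>g. g \<in> carrier G \<Longrightarrow> f (group_elem g) = h (group_elem g)" "x \<in> carrier (group_algebra G)"
  shows "f x = h x"
  by (rule star_hom_unique[OF star_alg_group_algebra _ group_algebra_span assms(1,2) _ assms(4)])
    (use assms(3) group_elem_closed in auto)

end

section \<open>Magic unitaries\<close>

text \<open>The defining relations of \<O>(S_N^+) for a matrix in \<open>A\<close>. Idempotency is
  the case \<open>i = j\<close> of the last two clauses.\<close>

definition magic :: "('a, 'c) star_algebra_scheme \<Rightarrow> nat \<Rightarrow> (nat \<Rightarrow> nat \<Rightarrow> 'a) \<Rightarrow> bool"
  where "magic A N p \<longleftrightarrow>
    (\<forall>i\<in>{1..N}. \<forall>j\<in>{1..N}. p i j \<in> carrier A \<and> star A (p i j) = p i j) \<and>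
    (\<forall>i\<in>{1..N}. (\<Oplus>\<^bsub>A\<^esub>k\<in>{1..N}. p i k) = \<one>\<^bsub>A\<^esub>) \<and>
    (\<forall>j\<in>{1..N}. (\<Oplus>\<^bsub>A\<^esub>k\<in>{1..N}. p k j) = \<one>\<^bsub>A\<^esub>) \<and>
    (\<forall>i\<in>{1..N}. \<forall>j\<in>{1..N}. \<forall>k\<in>{1..N}. p i k \<otimes>\<^bsub>A\<^esub> p j k = (if i = j then p i k else \<zero>\<^bsub>A\<^esub>)) \<and>
    (\<forall>i\<in>{1..N}. \<forall>j\<in>{1..N}. \<forall>k\<in>{1..N}. p k i \<otimes>\<^bsub>A\<^esub> p k j = (if i = j then p k i else \<zero>\<^bsub>A\<^esub>))"

lemma magicD:
  assumes "magic A N p"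
  shows "i \<in> {1..N} \<Longrightarrow> j \<in> {1..N} \<Longrightarrow> p i j \<in> carrier A"
    "i \<in> {1..N} \<Longrightarrow> j \<in> {1..N} \<Longrightarrow> star A (p i j) = p i j"
    "i \<in> {1..N} \<Longrightarrow> (\<Oplus>\<^bsub>A\<^esub>k\<in>{1..N}. p i k) = \<one>\<^bsub>A\<^esub>"
    "j \<in> {1..N} \<Longrightarrow> (\<Oplus>\<^bsub>A\<^esub>k\<in>{1..N}. p k j) = \<one>\<^bsub>A\<^esub>"
    "i \<in> {1..N} \<Longrightarrow> j \<in> {1..N} \<Longrightarrow> k \<in> {1..N} \<Longrightarrow> p i k \<otimes>\<^bsub>A\<^esub> p j k = (if i = j then p i k else \<zero>\<^bsub>A\<^esub>)"
    "i \<in> {1..N} \<Longrightarrow> j \<in> {1..N} \<Longrightarrow> k \<in> {1..N} \<Longrightarrow> p k i \<otimes>\<^bsub>A\<^esub> p k j = (if i = j then p k i else \<zero>\<^bsub>A\<^esub>)"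
  using assms unfolding magic_def by blast+

lemma (in star_alg_hom) magic_hom:
  assumes "magic A N p"
  shows "magic B N (\<lambda>i j. f (p i j))"
  unfolding magic_def
  by (intro conjI ballI)
    (simp_all add: magicD[OF assms] Pi_def if_distrib[of f] flip: hom_star hom_mult hom_finsum)

lemma qperm_rels_closed: "qperm_rels N \<subseteq> carrier (free_star_algebra ({1..N} \<times> {1..N}))"
proof -
  interpret star_alg "free_star_algebra ({1..N} \<times> {1..N})" by simp
  show ?thesis unfolding qperm_rels_def Let_def by (auto simp: Pi_def intro!: minus_closed)
qed

lemma qperm_rels_vanish_iff:
  assumes "star_alg_hom (free_star_algebra ({1..N} \<times> {1..N})) B h"
  shows "(\<forall>r\<in>qperm_rels N. h r = \<zero>\<^bsub>B\<^esub>) \<longleftrightarrow> magic B N (\<lambda>i j. h (free_gen (i, j)))"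
proof -
  let ?F = "free_star_algebra ({1..N} \<times> {1..N})"
  interpret h: star_alg_hom ?F B h by fact
  have 1: "h (x \<ominus>\<^bsub>?F\<^esub> y) = \<zero>\<^bsub>B\<^esub> \<longleftrightarrow> h x = h y" if "x \<in> carrier ?F" "y \<in> carrier ?F" for x y
    using that by (simp add: h.hom_diff h.B.diff_eq_zero_iff)
  \<comment> \<open>\<open>qperm_rels\<close> is a union of sets indexed by one, two or three
    numbers; in quantified form its six families can be compared with \<open>magic\<close> one at a
    time.\<close>
  have un: "(\<forall>r\<in>X \<union> Y. P r) \<longleftrightarrow> (\<forall>r\<in>X. P r) \<and> (\<forall>r\<in>Y. P r)" for X Y and P :: "'z \<Rightarrow> bool"
    by auto
  have col1: "(\<forall>r\<in>{f i |i. Q i}. P r) \<longleftrightarrow> (\<forall>i. Q i \<longrightarrow> P (f i))" for Q :: "nat \<Rightarrow> bool" and f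
      and P :: "'z \<Rightarrow> bool"
    by auto
  have col2: "(\<forall>r\<in>{f i j |i j. Q i j}. P r) \<longleftrightarrow> (\<forall>i j. Q i j \<longrightarrow> P (f i j))"
      for Q :: "nat \<Rightarrow> nat \<Rightarrow> bool" and f and P :: "'z \<Rightarrow> bool"
    by auto
  have col3: "(\<forall>r\<in>{f i j k |i j k. Q i j k}. P r) \<longleftrightarrow> (\<forall>i j k. Q i j k \<longrightarrow> P (f i j k))"
      for Q :: "nat \<Rightarrow> nat \<Rightarrow> nat \<Rightarrow> bool" and f and P :: "'z \<Rightarrow> bool"
    by auto
  note eqs = h.hom_mult h.hom_star h.hom_finsum if_distrib[of h]
  have E: "(\<forall>r\<in>qperm_rels N. h r = \<zero>\<^bsub>B\<^esub>) \<longleftrightarrow>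
    (\<forall>i j. i \<in> {1..N} \<and> j \<in> {1..N} \<longrightarrow> h (free_gen (i, j)) \<otimes>\<^bsub>B\<^esub> h (free_gen (i, j))
        = h (free_gen (i, j))) \<and>
    (\<forall>i j. i \<in> {1..N} \<and> j \<in> {1..N} \<longrightarrow> star B (h (free_gen (i, j))) = h (free_gen (i, j))) \<and>
    (\<forall>i. i \<in> {1..N} \<longrightarrow> (\<Oplus>\<^bsub>B\<^esub>k\<in>{1..N}. h (free_gen (i, k))) = \<one>\<^bsub>B\<^esub>) \<and>
    (\<forall>j. j \<in> {1..N} \<longrightarrow> (\<Oplus>\<^bsub>B\<^esub>k\<in>{1..N}. h (free_gen (k, j))) = \<one>\<^bsub>B\<^esub>) \<and>
    (\<forall>i j k. i \<in> {1..N} \<and> j \<in> {1..N} \<and> k \<in> {1..N} \<longrightarrow>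
       h (free_gen (i, k)) \<otimes>\<^bsub>B\<^esub> h (free_gen (j, k)) = (if i = j then h (free_gen (i, k)) else \<zero>\<^bsub>B\<^esub>)) \<and>
    (\<forall>i j k. i \<in> {1..N} \<and> j \<in> {1..N} \<and> k \<in> {1..N} \<longrightarrow>
       h (free_gen (k, i)) \<otimes>\<^bsub>B\<^esub> h (free_gen (k, j)) = (if i = j then h (free_gen (k, i)) else \<zero>\<^bsub>B\<^esub>))"
    unfolding qperm_rels_def Let_def un col1 col2 col3 conj_assoc
    by (intro conj_cong iff_allI imp_cong refl) (simp_all add: 1 eqs Pi_def)
  show ?thesis
    unfolding E magic_def by (auto 0 3)
qed

lemma qperm_presentation: "star_presentation (free_star_algebra ({1..N} \<times> {1..N})) (qperm_rels N)"
  by (intro star_presentation.intro star_alg_free star_presentation_axioms.intro qperm_rels_closed)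

lemmas qperm_quot = star_presentation.quot_star_alg[OF qperm_presentation]
  and qperm_cls = star_presentation.star_hom_cls[OF qperm_presentation]
  and qperm_cls_rel = star_presentation.cls_rel[OF qperm_presentation]
  and qperm_quot_span = star_presentation.quot_span[OF qperm_presentation]
  and qperm_quot_universal = star_presentation.quot_universal[OF qperm_presentation]

abbreviation qperm_class where
  "qperm_class N \<equiv> star_class (free_star_algebra ({1..N} \<times> {1..N})) (qperm_rels N)"

lemma star_alg_qperm [simp]: "star_alg (qperm_algebra N)"
  unfolding qperm_algebra_def by (rule qperm_quot)

lemma magic_qperm: "magic (qperm_algebra N) N (qperm_gen N)"
proof -
  have "star_alg_hom (free_star_algebra ({1..N} \<times> {1..N})) (qperm_algebra N) (qperm_class N)"
    by (rule star_alg_hom_free) (simp_all add: qperm_algebra_def qperm_cls qperm_quot)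
  from qperm_rels_vanish_iff[OF this] qperm_cls_rel show ?thesis
    by (simp add: qperm_algebra_def qperm_gen_def[abs_def])
qed

abbreviation qperm_gens where "qperm_gens N \<equiv> {qperm_gen N i j | i j. i \<in> {1..N} \<and> j \<in> {1..N}}"

lemma qperm_gens_closed: "qperm_gens N \<subseteq> carrier (qperm_algebra N)"
  using magicD(1)[OF magic_qperm] by blast

lemma qperm_span: "carrier (qperm_algebra N) \<subseteq> star_span (qperm_algebra N) (qperm_gens N)"
proof -
  have eq: "qperm_class N ` free_gen ` ({1..N} \<times> {1..N}) = qperm_gens N"
    unfolding qperm_gen_def by (auto simp: image_iff)
  have "free_gen ` ({1..N} \<times> {1..N}) \<subseteq> carrier (free_star_algebra ({1..N} \<times> {1..N}))"
    by auto
  from qperm_quot_span[OF this free_span] show ?thesis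
    unfolding eq qperm_algebra_def .
qed

lemma qperm_universal:
  assumes "star_alg B" "magic B N q"
  obtains f where "star_hom (qperm_algebra N) B f"
    "\<And>i j. i \<in> {1..N} \<Longrightarrow> j \<in> {1..N} \<Longrightarrow> f (qperm_gen N i j) = q i j"
proof -
  obtain h where h: "star_hom (free_star_algebra ({1..N} \<times> {1..N})) B h"
    "\<And>x. x \<in> {1..N} \<times> {1..N} \<Longrightarrow> h (free_gen x) = case_prod q x"
    by (rule free_universal[OF assms(1), of "{1..N} \<times> {1..N}"
        "case_prod q"]) (auto simp: magicD(1)[OF assms(2)])
  have "magic B N (\<lambda>i j. h (free_gen (i, j)))"
  proof -
    interpret B: star_alg B by fact
    show ?thesis using assms(2) h(2) unfolding magic_def
      by (simp add: Pi_def cong: B.finsum_cong)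
  qed
  then have "\<And>r. r \<in> qperm_rels N \<Longrightarrow> h r = \<zero>\<^bsub>B\<^esub>"
    using qperm_rels_vanish_iff[OF star_alg_hom_free[OF assms(1) h(1)]] by blast
  from qperm_quot_universal[OF assms(1) h(1) this] obtain g where
    g: "star_hom (qperm_algebra N) B g" "\<And>x. x \<in> carrier (free_star_algebra ({1..N} \<times> {1..N})) \<Longrightarrow>
        g (qperm_class N x) = h x"
    unfolding qperm_algebra_def by blast
  from g(1) show thesis by (rule that) (simp add: qperm_gen_def g(2) h(2))
qed

lemma qperm_hom_unique:
  assumes "star_hom (qperm_algebra N) B f" "star_hom (qperm_algebra N) B h"
    "\<And>i j. i \<in> {1..N} \<Longrightarrow> j \<in> {1..N} \<Longrightarrow> f (qperm_gen N i j) = h (qperm_gen N i j)"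
    "x \<in> carrier (qperm_algebra N)"
  shows "f x = h x"
  by (rule star_hom_unique[OF star_alg_qperm qperm_gens_closed qperm_span assms(1,2) _ assms(4)])
    (use assms(3) in auto)

section \<open>Amalgamated and free products\<close>

locale amalg = star_alg A for A (structure) +
  fixes N :: nat and S :: "'a set"
  assumes S_closed: "S \<subseteq> carrier A"
begin

abbreviation F where "F \<equiv> free_star_algebra ({1..N} \<times> carrier A)"

lemma amalg_rels_closed: "amalg_rels N A S \<subseteq> carrier F"
proof -
  interpret F: star_alg F by simp
  have "hom_relations A F (\<lambda>a. free_gen (i, a)) \<subseteq> carrier F" if "i \<in> {1..N}" for i
    using that by (intro hom_relations_closed star_alg_axioms) auto
  then show ?thesis using S_closed
    unfolding amalg_rels_def Let_def by (auto intro!: F.minus_closed)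
qed

sublocale am: star_presentation F "amalg_rels N A S"
  by (intro star_presentation.intro star_alg_free star_presentation_axioms.intro amalg_rels_closed)

lemma star_alg_amalg: "star_alg (amalg_power N A S)"
  unfolding amalg_power_def by (rule am.quot_star_alg)

lemma star_hom_copy:
  assumes "i \<in> {1..N}" shows "star_hom A (amalg_power N A S) (amalg_copy N A S i)"
  unfolding amalg_power_def amalg_copy_def
  by (rule am.star_hom_cls_relations) (use star_alg_axioms assms in \<open>auto simp: amalg_rels_def
      Let_def\<close>)

lemma copy_agree:
  assumes "i \<in> {1..N}" "j \<in> {1..N}" "b \<in> S"
  shows "amalg_copy N A S i b = amalg_copy N A S j b"
proof -
  have "free_gen (i, b) \<ominus>\<^bsub>F\<^esub> free_gen (j, b) \<in> amalg_rels N A S"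
    using assms unfolding amalg_rels_def Let_def by blast
  from am.star_ideal_gen(1)[OF this] show ?thesis
    unfolding amalg_copy_def using assms S_closed by (subst am.cls_eq_iff) auto
qed

lemma amalg_span:
  assumes "X \<subseteq> carrier A" "carrier A \<subseteq> star_span A X"
  shows "carrier (amalg_power N A S) \<subseteq> star_span (amalg_power N A S) {amalg_copy N A S i x | i x.
      i \<in> {1..N} \<and> x \<in> X}"
    (is "_ \<subseteq> star_span ?P ?G")
proof -
  have "am.cls ` free_gen ` ({1..N} \<times> carrier A) \<subseteq> star_span ?P ?G"
  proof clarify
    fix i a assume ia: "i \<in> {1..N}" "a \<in> carrier A"
    have "amalg_copy N A S i ` carrier A \<subseteq> star_span ?P ?G"
      by (rule star_hom_span_subset[OF star_alg_axioms assms star_hom_copy[OF ia(1)]]) (use ia in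
          blast)
    with ia show "am.cls (free_gen (i, a)) \<in> star_span ?P ?G" by (auto simp: amalg_copy_def)
  qed
  from star_span_mono[OF this] am.quot_span[OF _ free_span] show ?thesis
    unfolding amalg_power_def by auto
qed

lemma amalg_universal:
  assumes "star_alg B" "\<And>i. i \<in> {1..N} \<Longrightarrow> star_hom A B (f i)"
    "\<And>i j b. i \<in> {1..N} \<Longrightarrow> j \<in> {1..N} \<Longrightarrow> b \<in> S \<Longrightarrow> f i b = f j b"
  obtains h where "star_hom (amalg_power N A S) B h"
    "\<And>i a. i \<in> {1..N} \<Longrightarrow> a \<in> carrier A \<Longrightarrow> h (amalg_copy N A S i a) = f i a"
proof -
  obtain h where h: "star_hom F B h"
    "\<And>x. x \<in> {1..N} \<times> carrier A \<Longrightarrow> h (free_gen x) = case_prod f x"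
    by (rule free_universal[OF assms(1), of "{1..N} \<times> carrier A"
        "case_prod f"]) (auto simp: star_homD[OF assms(2)])
  interpret h: star_alg_hom F B h by (rule star_alg_hom_free[OF assms(1) h(1)])
  have "h r = \<zero>\<^bsub>B\<^esub>" if r: "r \<in> amalg_rels N A S" for r
    using r[unfolded amalg_rels_def Let_def]
  proof (elim UnE UN_E CollectE exE conjE)
    fix i assume i: "i \<in> {1..N}" and r: "r \<in> hom_relations A F (\<lambda>a. free_gen (i, a))"
    have "star_hom A B (\<lambda>a. h (free_gen (i, a)))"
      by (rule star_homI) (use i in \<open>simp_all add: h(2) star_homD[OF assms(2)[OF i]]\<close>)
    with hom_relations_vanish_iff[OF star_alg_axioms h.star_alg_hom_axioms, of "\<lambda>a. free_gen (i,
        a)"] r i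
    show ?thesis by auto
  next
    fix i j b assume "r = free_gen (i, b) \<ominus>\<^bsub>F\<^esub> free_gen (j, b)" "i \<in> {1..N}" "j \<in> {1..N}" "b \<in> S"
    then show ?thesis using S_closed assms(3)[of i j b] star_hom_closed[OF assms(2), of j b]
      by (auto simp: h.hom_diff h(2) h.B.diff_eq_zero_iff subset_iff)
  qed
  from am.quot_universal[OF assms(1) h(1) this] obtain g where
    g: "star_hom (amalg_power N A S) B g" "\<And>x. x \<in> carrier F \<Longrightarrow> g (am.cls x) = h x"
    unfolding amalg_power_def by blast
  from g(1) show thesis by (rule that) (simp add: amalg_copy_def g(2) h(2))
qed

end

section \<open>Free products of two algebras\<close>

context star_alg_pair begin

abbreviation FP where "FP \<equiv> free_star_algebra (carrier A <+> carrier B)"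

lemma free_prod_rels_closed: "free_prod_rels A B \<subseteq> carrier FP"
  unfolding free_prod_rels_def Let_def
  by (intro Un_least hom_relations_closed A.star_alg_axioms B.star_alg_axioms) auto

sublocale fp: star_presentation FP "free_prod_rels A B"
  by (intro star_presentation.intro star_alg_free star_presentation_axioms.intro
      free_prod_rels_closed)

lemma star_alg_free_prod: "star_alg (free_prod A B)"
  unfolding free_prod_def by (rule fp.quot_star_alg)

lemma star_hom_inl: "star_hom A (free_prod A B) (free_inl A B)"
  unfolding free_prod_def free_inl_def
  by (rule fp.star_hom_cls_relations) (use A.star_alg_axioms in \<open>auto simp: free_prod_rels_def
      Let_def\<close>)

lemma star_hom_inr: "star_hom B (free_prod A B) (free_inr A B)"
  unfolding free_prod_def free_inr_def
  by (rule fp.star_hom_cls_relations) (use B.star_alg_axioms in \<open>auto simp: free_prod_rels_def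
      Let_def\<close>)

lemma free_prod_span:
  assumes "X \<subseteq> carrier A" "carrier A \<subseteq> star_span A X" "Y \<subseteq> carrier B" "carrier B \<subseteq> star_span B Y"
  shows "carrier (free_prod A B) \<subseteq> star_span (free_prod A B) (free_inl A B ` X \<union> free_inr A B ` Y)"
    (is "_ \<subseteq> star_span ?P ?G")
proof -
  have "fp.cls ` free_gen ` (carrier A <+> carrier B) \<subseteq> star_span ?P ?G"
    using star_hom_span_subset[OF A.star_alg_axioms assms(1,2) star_hom_inl, of ?G]
      star_hom_span_subset[OF B.star_alg_axioms assms(3,4) star_hom_inr, of ?G]
    by (auto simp: free_inl_def free_inr_def)
  from star_span_mono[OF this] fp.quot_span[OF _ free_span] show ?thesis
    unfolding free_prod_def by auto
qed

lemma free_prod_universal: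
  assumes "star_alg C" "star_hom A C f" "star_hom B C g"
  obtains h where "star_hom (free_prod A B) C h"
    "\<And>a. a \<in> carrier A \<Longrightarrow> h (free_inl A B a) = f a" "\<And>b. b \<in> carrier B \<Longrightarrow> h (free_inr A B b) = g b"
proof -
  obtain h where h: "star_hom FP C h"
    "\<And>x. x \<in> carrier A <+> carrier B \<Longrightarrow> h (free_gen x) = case_sum f g x"
    by (rule free_universal[OF assms(1), of "carrier A <+> carrier B" "case_sum f g"])
      (auto simp: star_homD[OF assms(2)] star_homD[OF assms(3)])
  interpret h: star_alg_hom FP C h by (rule star_alg_hom_free[OF assms(1) h(1)])
  have "star_hom A C (\<lambda>a. h (free_gen (Inl a)))" "star_hom B C (\<lambda>b. h (free_gen (Inr b)))"
    by (rule star_homI; simp add: h(2) InlI InrI star_homD[OF assms(2)] star_homD[OF assms(3)])+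
  then have "h r = \<zero>\<^bsub>C\<^esub>" if r: "r \<in> free_prod_rels A B" for r
    using r hom_relations_vanish_iff[OF A.star_alg_axioms h.star_alg_hom_axioms, of "\<lambda>a. free_gen
        (Inl a)"]
      hom_relations_vanish_iff[OF B.star_alg_axioms h.star_alg_hom_axioms, of "\<lambda>a. free_gen (Inr
          a)"]
    by (auto simp: free_prod_rels_def Let_def InlI InrI)
  from fp.quot_universal[OF assms(1) h(1) this] obtain k where
    k: "star_hom (free_prod A B) C k" "\<And>x. x \<in> carrier FP \<Longrightarrow> k (fp.cls x) = h x"
    unfolding free_prod_def by blast
  from k(1) show thesis
    by (rule that) (simp_all add: free_inl_def free_inr_def k(2) h(2) InlI InrI free_gen_closed)
qed

end

section \<open>The universal property of amalgamated free wreath products\<close>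

text \<open>The data of a star homomorphism out of the wreath product. Agreement and commutation are
  demanded for group elements only, whereas the defining relations range over the group algebras;
  \<open>wreath_universal\<close> bridges the two.\<close>

definition wreath_data ::
  "('b, 'd) star_algebra_scheme \<Rightarrow> ('g, 'c) monoid_scheme \<Rightarrow> 'g set \<Rightarrow> nat \<Rightarrow>
   (nat \<Rightarrow> 'g \<Rightarrow> 'b) \<Rightarrow> (nat \<Rightarrow> nat \<Rightarrow> 'b) \<Rightarrow> bool"
  where "wreath_data B \<Gamma> \<Lambda> N n q \<longleftrightarrow>
    (\<forall>i\<in>{1..N}. unitary_rep \<Gamma> B (n i)) \<and>
    (\<forall>i\<in>{1..N}. \<forall>j\<in>{1..N}. \<forall>g\<in>\<Lambda>. n i g = n j g) \<and>
    magic B N q \<and>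
    (\<forall>i\<in>{1..N}. \<forall>j\<in>{1..N}. \<forall>g\<in>carrier \<Gamma>. n i g \<otimes>\<^bsub>B\<^esub> q i j = q i j \<otimes>\<^bsub>B\<^esub> n i g)"

lemma wreath_dataD:
  assumes "wreath_data B \<Gamma> \<Lambda> N n q"
  shows "i \<in> {1..N} \<Longrightarrow> unitary_rep \<Gamma> B (n i)"
    "i \<in> {1..N} \<Longrightarrow> j \<in> {1..N} \<Longrightarrow> g \<in> \<Lambda> \<Longrightarrow> n i g = n j g"
    "magic B N q"
    "i \<in> {1..N} \<Longrightarrow> j \<in> {1..N} \<Longrightarrow> g \<in> carrier \<Gamma> \<Longrightarrow> n i g \<otimes>\<^bsub>B\<^esub> q i j = q i j \<otimes>\<^bsub>B\<^esub> n i g"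
  using assms unfolding wreath_data_def by blast+

text \<open>The same setting serves twice: for \<Lambda> inside \<Gamma>, and for the trivial
  subgroup inside \<Gamma>/\<Lambda>.\<close>

locale wreath = group \<Gamma> for \<Gamma> :: "('g, 'c) monoid_scheme" (structure) +
  fixes \<Lambda> :: "'g set" and N :: nat
  assumes \<Lambda>_closed: "\<Lambda> \<subseteq> carrier \<Gamma>"
begin

abbreviation CG where "CG \<equiv> group_algebra \<Gamma>"
abbreviation CL where "CL \<equiv> subgroup_algebra_set \<Gamma> \<Lambda>"
abbreviation GA where "GA \<equiv> group_amalg \<Gamma> \<Lambda> N"
abbreviation SN where "SN \<equiv> qperm_algebra N"
abbreviation PW where "PW \<equiv> prewreath_algebra \<Gamma> \<Lambda> N"
abbreviation W where "W \<equiv> wreath_algebra \<Gamma> \<Lambda> N"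
abbreviation nu where "nu i g \<equiv> wreath_nu \<Gamma> \<Lambda> N i (group_elem g)"
abbreviation p where "p \<equiv> wreath_p \<Gamma> \<Lambda> N"

lemma CL_eq: "CL = {f. Poly_Mapping.keys f \<subseteq> \<Lambda>}"
  by (simp add: subgroup_algebra_set_def group_algebra_def monoid_star_algebra_def)

lemma amalg_CG: "amalg CG CL"
  using star_alg_group_algebra \<Lambda>_closed
  by (auto simp: amalg_def amalg_axioms_def CL_eq group_algebra_def monoid_star_algebra_def)

lemma star_alg_GA: "star_alg GA"
  unfolding group_amalg_def by (rule amalg.star_alg_amalg[OF amalg_CG])

lemma pair_GA_SN: "star_alg_pair GA SN"
  using star_alg_GA by (simp add: star_alg_pair_def)

lemma star_alg_PW: "star_alg PW"
  unfolding prewreath_algebra_def by (rule star_alg_pair.star_alg_free_prod[OF pair_GA_SN])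

lemma star_hom_prewreath_nu: 
  assumes "i \<in> {1..N}" shows "star_hom CG PW (prewreath_nu \<Gamma> \<Lambda> N i)"
  unfolding prewreath_nu_def prewreath_algebra_def
  using star_hom_comp[OF amalg.star_hom_copy[OF amalg_CG assms], folded group_amalg_def,
    OF star_alg_pair.star_hom_inl[OF pair_GA_SN]] .

lemma prewreath_p_closed: "i \<in> {1..N} \<Longrightarrow> j \<in> {1..N} \<Longrightarrow> prewreath_p \<Gamma> \<Lambda> N i j \<in> carrier PW"
  unfolding prewreath_p_def prewreath_algebra_def
  using star_hom_closed[OF star_alg_pair.star_hom_inr[OF pair_GA_SN]] magicD(1)[OF magic_qperm]
      by blast

lemma wreath_rels_closed: "wreath_rels \<Gamma> \<Lambda> N \<subseteq> carrier PW"
proof -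
  interpret PW: star_alg PW by (rule star_alg_PW)
  show ?thesis unfolding wreath_rels_def Let_def
    by (auto simp: prewreath_p_closed star_hom_closed[OF star_hom_prewreath_nu])
qed

lemma wreath_presentation: "star_presentation PW (wreath_rels \<Gamma> \<Lambda> N)"
  by (intro star_presentation.intro star_alg_PW star_presentation_axioms.intro wreath_rels_closed)

lemma star_alg_W: "star_alg W"
  unfolding wreath_algebra_def by (rule star_presentation.quot_star_alg[OF wreath_presentation])

abbreviation wcls where "wcls \<equiv> star_class PW (wreath_rels \<Gamma> \<Lambda> N)"

lemma star_hom_wcls: "star_hom PW W wcls"
  unfolding wreath_algebra_def by (rule star_presentation.star_hom_cls[OF wreath_presentation])

lemma wreath_data_W: "wreath_data W \<Gamma> \<Lambda> N nu p"
proof -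
  interpret W: star_alg W by (rule star_alg_W)
  interpret wcls: star_alg_hom PW W wcls
    by (intro star_alg_hom.intro star_alg_PW star_alg_W star_alg_hom_axioms.intro star_hom_wcls)
  have inr: "star_alg_hom SN PW (free_inr GA SN)"
    unfolding prewreath_algebra_def
    by (intro star_alg_hom.intro star_alg_qperm star_alg_hom_axioms.intro
      star_alg_pair.star_alg_free_prod[OF pair_GA_SN] star_alg_pair.star_hom_inr[OF pair_GA_SN])
  have 1: "unitary_rep \<Gamma> W (nu i)" if "i \<in> {1..N}" for i
    unfolding wreath_nu_def
    by (rule unitary_rep_hom[OF unitary_rep_group_elem star_hom_comp[OF star_hom_prewreath_nu[OF
        that] star_hom_wcls]])
  have 2: "nu i g = nu j g" if "i \<in> {1..N}" "j \<in> {1..N}" "g \<in> \<Lambda>" for i j g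
    unfolding wreath_nu_def prewreath_nu_def
    using amalg.copy_agree[OF amalg_CG that(1,2), of "group_elem g"] that(3) by (simp add: CL_eq)
  have 3: "magic W N p"
    using wcls.magic_hom[OF star_alg_hom.magic_hom[OF inr magic_qperm]]
    by (simp add: wreath_p_def[abs_def] prewreath_p_def)
  have 4: "nu i g \<otimes>\<^bsub>W\<^esub> p i j = p i j \<otimes>\<^bsub>W\<^esub> nu i g" if "i \<in> {1..N}" "j \<in> {1..N}" "g \<in> carrier \<Gamma>" for i j g
  proof -
    let ?n = "prewreath_nu \<Gamma> \<Lambda> N i (group_elem g)" and ?p = "prewreath_p \<Gamma> \<Lambda> N i j"
    have cl: "?n \<in> carrier PW" "?p \<in> carrier PW"
      using that by (simp_all add: prewreath_p_closed star_hom_closed[OF star_hom_prewreath_nu]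
          group_elem_closed)
    have "(?n \<otimes>\<^bsub>PW\<^esub> ?p) \<ominus>\<^bsub>PW\<^esub> (?p \<otimes>\<^bsub>PW\<^esub> ?n) \<in> wreath_rels \<Gamma> \<Lambda> N"
      unfolding wreath_rels_def Let_def using that group_elem_closed by blast
    from star_presentation.cls_rel[OF wreath_presentation this]
    have "wcls (?n \<otimes>\<^bsub>PW\<^esub> ?p) \<ominus>\<^bsub>W\<^esub> wcls (?p \<otimes>\<^bsub>PW\<^esub> ?n) = \<zero>\<^bsub>W\<^esub>"
      using cl by (simp add: wcls.hom_diff wreath_algebra_def)
    then show ?thesis
      using cl by (simp add: W.diff_eq_zero_iff wcls.hom_mult wreath_nu_def wreath_p_def)
  qed
  show ?thesis unfolding wreath_data_def using 1 2 3 4 by blast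
qed

abbreviation wreath_gens where
  "wreath_gens \<equiv> {nu i g | i g. i \<in> {1..N} \<and> g \<in> carrier \<Gamma>} \<union> {p i j | i j. i \<in> {1..N} \<and> j \<in>
      {1..N}}"

lemma nu_closed [simp, intro]: "i \<in> {1..N} \<Longrightarrow> g \<in> carrier \<Gamma> \<Longrightarrow> nu i g \<in> carrier W"
  using unitary_repD(1)[OF wreath_dataD(1)[OF wreath_data_W]] .

lemma p_closed [simp, intro]: "i \<in> {1..N} \<Longrightarrow> j \<in> {1..N} \<Longrightarrow> p i j \<in> carrier W"
  using magicD(1)[OF wreath_dataD(3)[OF wreath_data_W]] .

lemma wreath_gens_closed: "wreath_gens \<subseteq> carrier W"
  by auto

lemma wreath_span: "carrier W \<subseteq> star_span W wreath_gens"
proof -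
  let ?c = "amalg_copy N CG CL"
  let ?X = "{?c i x | i x. i \<in> {1..N} \<and> x \<in> group_elem ` carrier \<Gamma>}"
  have "carrier GA \<subseteq> star_span GA ?X"
    unfolding group_amalg_def
    by (rule amalg.amalg_span[OF amalg_CG _ group_algebra_span]) (auto simp: group_elem_closed)
  moreover have X: "?X \<subseteq> carrier GA"
    unfolding group_amalg_def using star_hom_closed[OF amalg.star_hom_copy[OF amalg_CG]]
        group_elem_closed by blast
  ultimately have PW: "carrier PW \<subseteq> star_span PW (free_inl GA SN ` ?X \<union> free_inr GA SN `
      qperm_gens N)"
    unfolding prewreath_algebra_def
    by (intro star_alg_pair.free_prod_span[OF pair_GA_SN] qperm_gens_closed qperm_span)
  have "free_inl GA SN ` ?X \<subseteq> carrier PW" "free_inr GA SN ` qperm_gens N \<subseteq> carrier PW"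
    unfolding prewreath_algebra_def
    using star_hom_closed[OF star_alg_pair.star_hom_inl[OF pair_GA_SN]] X
      star_hom_closed[OF star_alg_pair.star_hom_inr[OF pair_GA_SN]] qperm_gens_closed by blast+
  then have *: "carrier W \<subseteq> star_span W (wcls ` (free_inl GA SN ` ?X \<union> free_inr GA SN ` qperm_gens
      N))"
    unfolding wreath_algebra_def
    by (intro star_presentation.quot_span[OF wreath_presentation _ PW]) simp
  have gens: "wcls (free_inl GA SN (?c i (group_elem g))) = nu i g"
      "wcls (free_inr GA SN (qperm_gen N i j)) = p i j" for i j g
    by (simp_all add: wreath_nu_def prewreath_nu_def wreath_p_def prewreath_p_def)
  have "wcls ` (free_inl GA SN ` ?X \<union> free_inr GA SN ` qperm_gens N) \<subseteq> wreath_gens"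
  proof (rule image_subsetI)
    fix y assume "y \<in> free_inl GA SN ` ?X \<union> free_inr GA SN ` qperm_gens N"
    then consider i g where "i \<in> {1..N}" "g \<in> carrier \<Gamma>" "y = free_inl GA SN (?c i (group_elem g))"
      | i j where "i \<in> {1..N}" "j \<in> {1..N}" "y = free_inr GA SN (qperm_gen N i j)"
      by blast
    then show "wcls y \<in> wreath_gens"
    proof cases
      case 1 show ?thesis unfolding 1(3) gens by (rule UnI1, rule CollectI, (rule exI)+,
          intro conjI, rule refl, rule 1(1), rule 1(2))
    next
      case 2 show ?thesis unfolding 2(3) gens by (rule UnI2, rule CollectI, (rule exI)+,
          intro conjI, rule refl, rule 2(1), rule 2(2))
    qed
  qed
  then have "star_span W (wcls ` (free_inl GA SN ` ?X \<union> free_inr GA SN ` qperm_gens N))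
      \<subseteq> star_span W wreath_gens"
    by (intro star_span_mono) (rule order.trans, assumption, rule subsetI, rule star_span.gen)
  with * show ?thesis by blast
qed

lemma wreath_hom_unique:
  assumes "star_hom W B f" "star_hom W B h"
    "\<And>i g. i \<in> {1..N} \<Longrightarrow> g \<in> carrier \<Gamma> \<Longrightarrow> f (nu i g) = h (nu i g)"
    "\<And>i j. i \<in> {1..N} \<Longrightarrow> j \<in> {1..N} \<Longrightarrow> f (p i j) = h (p i j)"
    "x \<in> carrier W"
  shows "f x = h x"
  by (rule star_hom_unique[OF star_alg_W wreath_gens_closed wreath_span assms(1,2) _ assms(5)])
    (use assms(3,4) in auto)

text \<open>The map is assembled along the construction of the algebra: linear extension on each
  copy of the group algebra, amalgamation over \<Lambda>, the free product with the quantum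
  permutation algebra, and finally the commutation relations.\<close>

lemma wreath_universal:
  assumes "star_alg B" and data: "wreath_data B \<Gamma> \<Lambda> N n q"
  obtains f where "star_hom W B f"
    "\<And>i g. i \<in> {1..N} \<Longrightarrow> g \<in> carrier \<Gamma> \<Longrightarrow> f (nu i g) = n i g"
    "\<And>i j. i \<in> {1..N} \<Longrightarrow> j \<in> {1..N} \<Longrightarrow> f (p i j) = q i j"
proof -
  interpret B: star_alg B by fact
  note D = wreath_dataD[OF data]
  let ?f = "\<lambda>i. B.lin_ext (n i)"
  have f: "star_hom CG B (?f i)" "\<And>g. g \<in> carrier \<Gamma> \<Longrightarrow> ?f i (group_elem g) = n i g"
      if i: "i \<in> {1..N}" for i
    using group_algebra_universal[OF assms(1) D(1)[OF i]] by blast+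
  \<comment> \<open>An element of \<open>CL\<close> is supported in \<Lambda>, so its extension only
    involves the values on which the representations agree.\<close>
  have agree: "?f i x = ?f j x" if "i \<in> {1..N}" "j \<in> {1..N}" "x \<in> CL" for i j x
    unfolding B.lin_ext_def
  proof (rule B.finsum_cong'[OF refl])
    show "(\<lambda>k. Poly_Mapping.lookup x k \<odot>\<^bsub>B\<^esub> n j k) \<in> Poly_Mapping.keys x \<rightarrow> carrier B"
      using that(3) \<Lambda>_closed unitary_repD(1)[OF D(1)[OF that(2)]] by (auto simp: CL_eq)
    fix g assume "g \<in> Poly_Mapping.keys x"
    then have "g \<in> \<Lambda>" using that(3) by (auto simp: CL_eq)
    then show "Poly_Mapping.lookup x g \<odot>\<^bsub>B\<^esub> n i g = Poly_Mapping.lookup x g \<odot>\<^bsub>B\<^esub> n j g"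
      using D(2)[OF that(1,2)] by simp
  qed
  obtain h1 where h1: "star_hom GA B h1"
    "\<And>i x. i \<in> {1..N} \<Longrightarrow> x \<in> carrier CG \<Longrightarrow> h1 (amalg_copy N CG CL i x) = ?f i x"
    unfolding group_amalg_def
    by (rule amalg.amalg_universal[where f = ?f, OF amalg_CG assms(1) f(1) agree]) blast+
  obtain h2 where h2: "star_hom SN B h2"
    "\<And>i j. i \<in> {1..N} \<Longrightarrow> j \<in> {1..N} \<Longrightarrow> h2 (qperm_gen N i j) = q i j"
    by (rule qperm_universal[OF assms(1) D(3)]) blast+
  obtain h where h: "star_hom PW B h" "\<And>a. a \<in> carrier GA \<Longrightarrow> h (free_inl GA SN a) = h1 a"
    "\<And>a. a \<in> carrier SN \<Longrightarrow> h (free_inr GA SN a) = h2 a"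
    unfolding prewreath_algebra_def
    by (rule star_alg_pair.free_prod_universal[OF pair_GA_SN assms(1) h1(1) h2(1)]) blast+
  have copy: "amalg_copy N CG CL i x \<in> carrier GA" if "i \<in> {1..N}" "x \<in> carrier CG" for i x
    unfolding group_amalg_def using star_hom_closed[OF amalg.star_hom_copy[OF amalg_CG]]
        that by blast
  have hn: "h (prewreath_nu \<Gamma> \<Lambda> N i x) = ?f i x" if "i \<in> {1..N}" "x \<in> carrier CG" for i x
    unfolding prewreath_nu_def using that by (simp add: h(2) copy h1(2))
  have hp: "h (prewreath_p \<Gamma> \<Lambda> N i j) = q i j" if "i \<in> {1..N}" "j \<in> {1..N}" for i j
    unfolding prewreath_p_def using that magicD(1)[OF magic_qperm] by (simp add: h(3) h2(2))
  interpret h: star_alg_hom PW B h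
    by (intro star_alg_hom.intro star_alg_PW assms(1) star_alg_hom_axioms.intro h(1))
  \<comment> \<open>Commutation spreads from group elements to the whole group algebra. The
    condition on adjoints in \<open>commute_span\<close> holds because \<open>q i j\<close> is
    self-adjoint.\<close>
  have comm: "?f i x \<otimes>\<^bsub>B\<^esub> q i j = q i j \<otimes>\<^bsub>B\<^esub> ?f i x" if "i \<in> {1..N}" "j \<in> {1..N}" "x \<in> carrier CG"
      for i j x
  proof -
    have "?f i x \<in> star_span B (n i ` carrier \<Gamma>)"
      using star_hom_span_subset[OF star_alg_group_algebra _ group_algebra_span f(1)[OF that(1)],
          of "n i ` carrier \<Gamma>"]
        that f(2) group_elem_closed by (auto simp: image_subset_iff)
    from B.commute_span[OF _ magicD(1)[OF D(3) that(1,2)] _ _ this]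
    show ?thesis using D(4)[OF that(1,2)] unitary_repD(1)[OF D(1)[OF that(1)]] magicD(2)[OF D(3)
        that(1,2)]
      by auto
  qed
  have "h r = \<zero>\<^bsub>B\<^esub>" if r: "r \<in> wreath_rels \<Gamma> \<Lambda> N" for r
  proof -
    obtain i j x where ijx: "i \<in> {1..N}" "j \<in> {1..N}" "x \<in> carrier CG"
      "r = (prewreath_nu \<Gamma> \<Lambda> N i x \<otimes>\<^bsub>PW\<^esub> prewreath_p \<Gamma> \<Lambda> N i j) \<ominus>\<^bsub>PW\<^esub> (prewreath_p \<Gamma> \<Lambda> N i j \<otimes>\<^bsub>PW\<^esub>
          prewreath_nu \<Gamma> \<Lambda> N i x)"
      using r unfolding wreath_rels_def Let_def by blast
    then have cl: "prewreath_nu \<Gamma> \<Lambda> N i x \<in> carrier PW" "prewreath_p \<Gamma> \<Lambda> N i j \<in> carrier PW"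
      by (simp_all add: prewreath_p_closed star_hom_closed[OF star_hom_prewreath_nu])
    have cl': "?f i x \<in> carrier B" "q i j \<in> carrier B"
      using star_hom_closed[OF f(1)] magicD(1)[OF D(3)] ijx by blast+
    show ?thesis unfolding ijx(4)
      using cl cl' comm[OF ijx(1-3)] ijx(1-3) by (simp add: h.hom_diff h.hom_mult hn hp
          B.diff_eq_zero_iff)
  qed
  from star_presentation.quot_universal[OF wreath_presentation assms(1) h(1) this] obtain g where
    g: "star_hom W B g" "\<And>x. x \<in> carrier PW \<Longrightarrow> g (wcls x) = h x"
    unfolding wreath_algebra_def by blast
  from g(1) show thesis
  proof (rule that)
    show "g (nu i a) = n i a" if "i \<in> {1..N}" "a \<in> carrier \<Gamma>" for i a
      unfolding wreath_nu_def using that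
      by (subst g(2)) (simp_all add: hn f(2) group_elem_closed star_hom_closed[OF
          star_hom_prewreath_nu])
    show "g (p i j) = q i j" if "i \<in> {1..N}" "j \<in> {1..N}" for i j
      unfolding wreath_p_def using that by (subst g(2)) (simp_all add: hp prewreath_p_closed)
  qed
qed

end

section \<open>Coproducts\<close>

lemma (in abelian_monoid) finsum_swap:
  assumes "finite S" "finite S'" "\<And>i j. i \<in> S \<Longrightarrow> j \<in> S' \<Longrightarrow> f i j \<in> carrier G"
  shows "(\<Oplus>i\<in>S. \<Oplus>j\<in>S'. f i j) = (\<Oplus>j\<in>S'. \<Oplus>i\<in>S. f i j)"
  using assms(1,3)
proof (induction S rule: finite_induct)
  case (insert x F)
  have "(\<Oplus>i\<in>insert x F. \<Oplus>j\<in>S'. f i j) = (\<Oplus>j\<in>S'. f x j) \<oplus> (\<Oplus>i\<in>F. \<Oplus>j\<in>S'. f i j)"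
    using insert.hyps insert.prems by (intro finsum_insert) auto
  also have "\<dots> = (\<Oplus>j\<in>S'. f x j) \<oplus> (\<Oplus>j\<in>S'. \<Oplus>i\<in>F. f i j)"
    using insert by simp
  also have "\<dots> = (\<Oplus>j\<in>S'. f x j \<oplus> (\<Oplus>i\<in>F. f i j))"
    using insert.prems by (intro finsum_addf[symmetric]) auto
  also have "\<dots> = (\<Oplus>j\<in>S'. \<Oplus>i\<in>insert x F. f i j)"
    using insert.hyps insert.prems by (intro finsum_cong' refl) (auto simp: Pi_def)
  finally show ?case .
qed simp

context star_alg_pair begin

abbreviation sum_pt where "sum_pt (N::nat) x y \<equiv> (\<Oplus>\<^bsub>T\<^esub>k\<in>{1..N}. pt (x k) (y k))"

lemma sum_pt_closed:
  "(\<And>k. k \<in> {1..N} \<Longrightarrow> x k \<in> carrier A) \<Longrightarrow> (\<And>k. k \<in> {1..N} \<Longrightarrow> y k \<in> carrier B) \<Longrightarrow>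
      sum_pt N x y \<in> carrier T"
  by (intro T.finsum_closed) auto

lemma sum_pt_cong:
  assumes "\<And>k. k \<in> {1..N} \<Longrightarrow> x' k \<in> carrier A" "\<And>k. k \<in> {1..N} \<Longrightarrow> y' k \<in> carrier B"
    "\<And>k. k \<in> {1..N} \<Longrightarrow> x k = x' k" "\<And>k. k \<in> {1..N} \<Longrightarrow> y k = y' k"
  shows "sum_pt N x y = sum_pt N x' y'"
  using assms by (intro T.finsum_cong'[OF refl]) auto

lemma sum_pt_star:
  assumes "\<And>k. k \<in> {1..N} \<Longrightarrow> x k \<in> carrier A" "\<And>k. k \<in> {1..N} \<Longrightarrow> y k \<in> carrier B"
  shows "star T (sum_pt N x y) = sum_pt N (\<lambda>k. star A (x k)) (\<lambda>k. star B (y k))"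
  using assms by (subst T.star_finsum) (auto intro!: T.finsum_cong'[OF refl] simp: pt_star)

lemma sum_pt_const_right:
  assumes "\<And>k. k \<in> {1..N} \<Longrightarrow> x k \<in> carrier A" "b \<in> carrier B"
  shows "sum_pt N x (\<lambda>k. b) = pt (\<Oplus>\<^bsub>A\<^esub>k\<in>{1..N}. x k) b"
  using assms by (subst pt_finsum_left) auto

lemma sum_pt_zero: "(\<And>k. k \<in> {1..N} \<Longrightarrow> y k \<in> carrier B) \<Longrightarrow> sum_pt N (\<lambda>k. \<zero>\<^bsub>A\<^esub>) y = \<zero>\<^bsub>T\<^esub>"
  "(\<And>k. k \<in> {1..N} \<Longrightarrow> x k \<in> carrier A) \<Longrightarrow> sum_pt N x (\<lambda>k. \<zero>\<^bsub>B\<^esub>) = \<zero>\<^bsub>T\<^esub>"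
  by (auto intro!: T.add.finprod_one_eqI)

text \<open>The matrix product of two magic unitaries placed in different tensor factors, which is
  the shape of the coproduct of \<open>p\<close>. For entries in one column the cross terms vanish
  in the second factor, for entries in one row they vanish in the first.\<close>

lemma magic_tensor:
  assumes p: "magic A N p" and q: "magic B N q"
  shows "magic T N (\<lambda>i j. sum_pt N (p i) (\<lambda>k. q k j))"
  unfolding magic_def
proof (intro conjI ballI)
  note P = magicD[OF p] and Q = magicD[OF q]
  fix i assume i: "i \<in> {1..N}"
  have "(\<Oplus>\<^bsub>T\<^esub>j\<in>{1..N}. sum_pt N (p i) (\<lambda>k. q k j)) = (\<Oplus>\<^bsub>T\<^esub>k\<in>{1..N}. \<Oplus>\<^bsub>T\<^esub>j\<in>{1..N}. pt (p i k) (q k j))"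
    using i P(1) Q(1) by (intro T.finsum_swap) auto
  also have "\<dots> = sum_pt N (p i) (\<lambda>k. \<one>\<^bsub>B\<^esub>)"
  proof (rule T.finsum_cong'[OF refl])
    fix k assume k: "k \<in> {1..N}"
    have "(\<Oplus>\<^bsub>T\<^esub>j\<in>{1..N}. pt (p i k) (q k j)) = pt (p i k) (\<Oplus>\<^bsub>B\<^esub>j\<in>{1..N}. q k j)"
      using i k P(1) Q(1) by (subst pt_finsum_right) auto
    then show "(\<Oplus>\<^bsub>T\<^esub>j\<in>{1..N}. pt (p i k) (q k j)) = pt (p i k) \<one>\<^bsub>B\<^esub>" using k by (simp add: Q(3))
  qed (use i P(1) in auto)
  also have "\<dots> = \<one>\<^bsub>T\<^esub>" using i P(1) by (subst sum_pt_const_right) (auto simp: P(3) pt_one)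
  finally show "(\<Oplus>\<^bsub>T\<^esub>j\<in>{1..N}. sum_pt N (p i) (\<lambda>k. q k j)) = \<one>\<^bsub>T\<^esub>" .
next
  note P = magicD[OF p] and Q = magicD[OF q]
  fix j assume j: "j \<in> {1..N}"
  have "(\<Oplus>\<^bsub>T\<^esub>i\<in>{1..N}. sum_pt N (p i) (\<lambda>k. q k j)) = (\<Oplus>\<^bsub>T\<^esub>k\<in>{1..N}. \<Oplus>\<^bsub>T\<^esub>i\<in>{1..N}. pt (p i k) (q k j))"
    using j P(1) Q(1) by (intro T.finsum_swap) auto
  also have "\<dots> = (\<Oplus>\<^bsub>T\<^esub>k\<in>{1..N}. pt \<one>\<^bsub>A\<^esub> (q k j))"
  proof (rule T.finsum_cong'[OF refl])
    fix k assume k: "k \<in> {1..N}"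
    have "(\<Oplus>\<^bsub>T\<^esub>i\<in>{1..N}. pt (p i k) (q k j)) = pt (\<Oplus>\<^bsub>A\<^esub>i\<in>{1..N}. p i k) (q k j)"
      using j k P(1) Q(1) by (subst pt_finsum_left) auto
    then show "(\<Oplus>\<^bsub>T\<^esub>i\<in>{1..N}. pt (p i k) (q k j)) = pt \<one>\<^bsub>A\<^esub> (q k j)" using k by (simp add: P(4))
  qed (use j Q(1) in auto)
  also have "\<dots> = \<one>\<^bsub>T\<^esub>" using j Q(1) by (subst pt_finsum_right[symmetric]) (auto simp: Q(4) pt_one)
  finally show "(\<Oplus>\<^bsub>T\<^esub>i\<in>{1..N}. sum_pt N (p i) (\<lambda>k. q k j)) = \<one>\<^bsub>T\<^esub>" .
next
  note P = magicD[OF p] and Q = magicD[OF q]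
  fix i j k assume ijk: "i \<in> {1..N}" "j \<in> {1..N}" "k \<in> {1..N}"
  have "sum_pt N (p i) (\<lambda>l. q l k) \<otimes>\<^bsub>T\<^esub> sum_pt N (p j) (\<lambda>l. q l k)
    = sum_pt N (\<lambda>l. p i l \<otimes>\<^bsub>A\<^esub> p j l) (\<lambda>l. q l k \<otimes>\<^bsub>B\<^esub> q l k)"
    using ijk P(1) Q(1) by (intro sum_pt_mult) (auto simp: Q(5))
  also have "\<dots> = sum_pt N (\<lambda>l. if i = j then p i l else \<zero>\<^bsub>A\<^esub>) (\<lambda>l. q l k)"
    using ijk P(1) Q(1) by (intro sum_pt_cong) (auto simp: P(5) Q(5))
  finally show "sum_pt N (p i) (\<lambda>l. q l k) \<otimes>\<^bsub>T\<^esub> sum_pt N (p j) (\<lambda>l. q l k)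
    = (if i = j then sum_pt N (p i) (\<lambda>l. q l k) else \<zero>\<^bsub>T\<^esub>)"
    using ijk Q(1) by (simp add: sum_pt_zero)
  have "sum_pt N (p k) (\<lambda>l. q l i) \<otimes>\<^bsub>T\<^esub> sum_pt N (p k) (\<lambda>l. q l j)
    = sum_pt N (\<lambda>l. p k l \<otimes>\<^bsub>A\<^esub> p k l) (\<lambda>l. q l i \<otimes>\<^bsub>B\<^esub> q l j)"
    using ijk P(1) Q(1) by (intro sum_pt_mult) (auto simp: P(6))
  also have "\<dots> = sum_pt N (p k) (\<lambda>l. if i = j then q l i else \<zero>\<^bsub>B\<^esub>)"
    using ijk P(1) Q(1) by (intro sum_pt_cong) (auto simp: P(6) Q(6))
  finally show "sum_pt N (p k) (\<lambda>l. q l i) \<otimes>\<^bsub>T\<^esub> sum_pt N (p k) (\<lambda>l. q l j)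
    = (if i = j then sum_pt N (p k) (\<lambda>l. q l i) else \<zero>\<^bsub>T\<^esub>)"
    using ijk P(1) by (simp add: sum_pt_zero)
next
  note P = magicD[OF p] and Q = magicD[OF q]
  fix i j assume ij: "i \<in> {1..N}" "j \<in> {1..N}"
  show "sum_pt N (p i) (\<lambda>k. q k j) \<in> carrier T"
    using ij P(1) Q(1) by (intro sum_pt_closed) auto
  have "star T (sum_pt N (p i) (\<lambda>k. q k j)) = sum_pt N (\<lambda>k. star A (p i k)) (\<lambda>k. star B (q k j))"
    using ij P(1) Q(1) by (intro sum_pt_star) auto
  also have "\<dots> = sum_pt N (p i) (\<lambda>k. q k j)"
    using ij P Q by (intro sum_pt_cong) auto
  finally show "star T (sum_pt N (p i) (\<lambda>k. q k j)) = sum_pt N (p i) (\<lambda>k. q k j)" .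
qed

text \<open>The reason why the coproduct of the wreath product exists. Proving it for two algebras
  \<open>A\<close> and \<open>B\<close> keeps the relations of the two tensor factors apart.\<close>

lemma wreath_data_tensor:
  assumes "group \<Gamma>" "\<Lambda> \<subseteq> carrier \<Gamma>"
    and dA: "wreath_data A \<Gamma> \<Lambda> N n p" and dB: "wreath_data B \<Gamma> \<Lambda> N m q"
  shows "wreath_data T \<Gamma> \<Lambda> N (\<lambda>i g. sum_pt N (\<lambda>k. n i g \<otimes>\<^bsub>A\<^esub> p i k) (\<lambda>k. m k g))
    (\<lambda>i j. sum_pt N (p i) (\<lambda>k. q k j))"
proof -
  interpret group \<Gamma> by fact
  note P = magicD[OF wreath_dataD(3)[OF dA]] and Q = magicD[OF wreath_dataD(3)[OF dB]]
  note n = unitary_repD[OF wreath_dataD(1)[OF dA]] and m = unitary_repD[OF wreath_dataD(1)[OF dB]]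
  note cA = wreath_dataD(4)[OF dA] and cB = wreath_dataD(4)[OF dB]
  note cl = P(1) Q(1) n(1) m(1)
  let ?D = "\<lambda>i g. sum_pt N (\<lambda>k. n i g \<otimes>\<^bsub>A\<^esub> p i k) (\<lambda>k. m k g)"
  \<comment> \<open>\<open>n i h\<close> commutes with row \<open>i\<close> of \<open>p\<close>, and
    the entries of that row are orthogonal. This makes the coproduct formula multiplicative in the
    group element.\<close>
  have move: "(n i g \<otimes>\<^bsub>A\<^esub> p i k) \<otimes>\<^bsub>A\<^esub> (n i h \<otimes>\<^bsub>A\<^esub> p i l) = n i (g \<otimes>\<^bsub>\<Gamma>\<^esub> h) \<otimes>\<^bsub>A\<^esub> (if k = l then p i k else \<zero>\<^bsub>A\<^esub>)"
    if "i \<in> {1..N}" "k \<in> {1..N}" "l \<in> {1..N}" "g \<in> carrier \<Gamma>" "h \<in> carrier \<Gamma>" for i k l g h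
  proof -
    have "(n i g \<otimes>\<^bsub>A\<^esub> p i k) \<otimes>\<^bsub>A\<^esub> (n i h \<otimes>\<^bsub>A\<^esub> p i l) = n i g \<otimes>\<^bsub>A\<^esub> (p i k \<otimes>\<^bsub>A\<^esub> n i h) \<otimes>\<^bsub>A\<^esub> p i l"
      using that cl by (simp add: A.m_assoc)
    also have "\<dots> = (n i g \<otimes>\<^bsub>A\<^esub> n i h) \<otimes>\<^bsub>A\<^esub> (p i k \<otimes>\<^bsub>A\<^esub> p i l)"
      using that cl by (simp add: A.m_assoc flip: cA)
    finally show ?thesis using that by (simp add: P(6) n(4))
  qed
  have urep: "unitary_rep \<Gamma> T (?D i)" if i: "i \<in> {1..N}" for i
    unfolding unitary_rep_def
  proof (intro conjI ballI)
    fix g assume g: "g \<in> carrier \<Gamma>"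
    show "?D i g \<in> carrier T" using i g cl by (intro sum_pt_closed) auto
    have "star T (?D i g) = sum_pt N (\<lambda>k. star A (n i g \<otimes>\<^bsub>A\<^esub> p i k)) (\<lambda>k. star B (m k g))"
      using i g cl by (intro sum_pt_star) auto
    also have "\<dots> = ?D i (inv\<^bsub>\<Gamma>\<^esub> g)"
    proof (rule sum_pt_cong)
      fix k assume k: "k \<in> {1..N}"
      show "star A (n i g \<otimes>\<^bsub>A\<^esub> p i k) = n i (inv\<^bsub>\<Gamma>\<^esub> g) \<otimes>\<^bsub>A\<^esub> p i k"
        using i k g cl cA[of i k "inv\<^bsub>\<Gamma>\<^esub> g"] by (simp add: A.star_mult P(2) n(2))
    qed (use i g cl m(2) in auto)
    finally show "?D i (inv\<^bsub>\<Gamma>\<^esub> g) = star T (?D i g)" ..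
  next
    have "?D i \<one>\<^bsub>\<Gamma>\<^esub> = sum_pt N (p i) (\<lambda>k. \<one>\<^bsub>B\<^esub>)"
      using i cl by (intro sum_pt_cong) (auto simp: n(3) m(3))
    also have "\<dots> = \<one>\<^bsub>T\<^esub>" using i cl by (subst sum_pt_const_right) (auto simp: P(3) pt_one)
    finally show "?D i \<one>\<^bsub>\<Gamma>\<^esub> = \<one>\<^bsub>T\<^esub>" .
  next
    fix g h assume gh: "g \<in> carrier \<Gamma>" "h \<in> carrier \<Gamma>"
    have "?D i g \<otimes>\<^bsub>T\<^esub> ?D i h = sum_pt N (\<lambda>k. (n i g \<otimes>\<^bsub>A\<^esub> p i k) \<otimes>\<^bsub>A\<^esub> (n i h \<otimes>\<^bsub>A\<^esub> p i k)) (\<lambda>k. m k g \<otimes>\<^bsub>B\<^esub> m k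
        h)"
      using i gh cl by (intro sum_pt_mult) (auto simp: move)
    also have "\<dots> = ?D i (g \<otimes>\<^bsub>\<Gamma>\<^esub> h)"
      using i gh cl by (intro sum_pt_cong) (auto simp: move m(4))
    finally show "?D i (g \<otimes>\<^bsub>\<Gamma>\<^esub> h) = ?D i g \<otimes>\<^bsub>T\<^esub> ?D i h" ..
  qed
  have agree: "?D i g = ?D j g" if ij: "i \<in> {1..N}" "j \<in> {1..N}" and g: "g \<in> \<Lambda>" for i j g
  proof -
    have g': "g \<in> carrier \<Gamma>" using g assms(2) by auto
    \<comment> \<open>On \<Lambda> the second factor does not depend on k, so the row sum of
      \<open>p\<close> collapses the formula to one pure tensor; independence of i can then be read
      off.\<close>
    have *: "?D i g = pt (n i g) (m i g)" if i: "i \<in> {1..N}" for i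
    proof -
      have "?D i g = sum_pt N (\<lambda>k. n i g \<otimes>\<^bsub>A\<^esub> p i k) (\<lambda>k. m i g)"
        by (rule sum_pt_cong) (use i g' cl in auto, rule wreath_dataD(2)[OF dB _ i g])
      also have "\<dots> = pt (\<Oplus>\<^bsub>A\<^esub>k\<in>{1..N}. n i g \<otimes>\<^bsub>A\<^esub> p i k) (m i g)"
        using i g' cl by (intro sum_pt_const_right) auto
      also have "(\<Oplus>\<^bsub>A\<^esub>k\<in>{1..N}. n i g \<otimes>\<^bsub>A\<^esub> p i k) = n i g"
        using i g' cl by (subst A.finsum_rdistr[symmetric]) (auto simp: P(3))
      finally show ?thesis .
    qed
    show ?thesis unfolding *[OF ij(1)] *[OF ij(2)]
      using wreath_dataD(2)[OF dA ij g] wreath_dataD(2)[OF dB ij g] by simp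
  qed
  have comm: "?D i g \<otimes>\<^bsub>T\<^esub> sum_pt N (p i) (\<lambda>k. q k j) = sum_pt N (p i) (\<lambda>k. q k j) \<otimes>\<^bsub>T\<^esub> ?D i g"
    if "i \<in> {1..N}" "j \<in> {1..N}" "g \<in> carrier \<Gamma>" for i j g
  proof -
    have "?D i g \<otimes>\<^bsub>T\<^esub> sum_pt N (p i) (\<lambda>k. q k j)
      = sum_pt N (\<lambda>k. (n i g \<otimes>\<^bsub>A\<^esub> p i k) \<otimes>\<^bsub>A\<^esub> p i k) (\<lambda>k. m k g \<otimes>\<^bsub>B\<^esub> q k j)"
      using that cl by (intro sum_pt_mult) (auto simp: A.m_assoc P(6))
    also have "\<dots> = sum_pt N (\<lambda>k. p i k \<otimes>\<^bsub>A\<^esub> (n i g \<otimes>\<^bsub>A\<^esub> p i k)) (\<lambda>k. q k j \<otimes>\<^bsub>B\<^esub> m k g)"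
      using that cl by (intro sum_pt_cong) (simp_all add: cA cB A.m_assoc P(6))
    also have "\<dots> = sum_pt N (p i) (\<lambda>k. q k j) \<otimes>\<^bsub>T\<^esub> ?D i g"
    proof (rule sum_pt_mult[symmetric])
      fix k l assume "k \<in> {1..N}" "l \<in> {1..N}" "k \<noteq> l"
      then show "p i k \<otimes>\<^bsub>A\<^esub> (n i g \<otimes>\<^bsub>A\<^esub> p i l) = \<zero>\<^bsub>A\<^esub> \<or> q k j \<otimes>\<^bsub>B\<^esub> m l g = \<zero>\<^bsub>B\<^esub>"
        using that cl by (simp add: cA P(6) flip: A.m_assoc)
    qed (use that cl in auto)
    finally show ?thesis .
  qed
  show ?thesis unfolding wreath_data_def
    using urep agree comm magic_tensor[OF wreath_dataD(3)[OF dA] wreath_dataD(3)[OF dB]] by blast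
qed

end

section \<open>Quantum groups and their underlying star algebras\<close>

lemma with_comult_sel [simp]:
  "carrier (with_comult A D) = carrier A" "mult (with_comult A D) = mult A" "one (with_comult A D)
      = one A"
  "zero (with_comult A D) = zero A" "add (with_comult A D) = add A"
  "module.smult (with_comult A D) = module.smult A" "star (with_comult A D) = star A"
  "comult (with_comult A D) = D"
  by (simp_all add: with_comult_def star_algebra.defs quantum_group.defs)

text \<open>A quantum group and its algebra are different records; these equations carry facts about
  the tensor product of the algebras over to the quantum groups.\<close>

lemma with_comult_tensor [simp]:
  "tensor_algebra (with_comult A D) (with_comult B E) = tensor_algebra A B"
  "pure_tensor (with_comult A D) (with_comult B E) = pure_tensor A B"
proof -
  have 1: "pair_algebra (with_comult A D) (with_comult B E) = pair_algebra A B"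
    by (simp add: pair_algebra_def DirProd_def)
  have 2: "bilinear_rels (with_comult A D) (with_comult B E) = bilinear_rels A B"
    by (simp add: bilinear_rels_def)
  show "tensor_algebra (with_comult A D) (with_comult B E) = tensor_algebra A B"
    unfolding tensor_algebra_def 1 2 ..
  show "pure_tensor (with_comult A D) (with_comult B E) = pure_tensor A B"
    unfolding pure_tensor_def[abs_def] 1 2 ..
qed

lemma star_hom_with_comult [simp]:
  "star_hom (with_comult A D) B f = star_hom A B f" "star_hom B (with_comult A D) h
      = star_hom B A h"
  by (simp_all add: star_hom_def ring_hom_def)

lemma the_star_hom_with_comult [simp]:
  "the_star_hom (with_comult A D) B P = the_star_hom A B P" "the_star_hom B (with_comult A D) P'
      = the_star_hom B A P'"
  by (simp_all add: the_star_hom_def)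

lemma tensor_map_with_comult [simp]:
  "tensor_map (with_comult A D) (with_comult B E) C C' f g = tensor_map A B C C' f g"
  "tensor_map C C' (with_comult A D) (with_comult B E) h k = tensor_map C C' A B h k"
  by (simp_all add: tensor_map_def)

lemma finsum_with_comult [simp]: "finsum (with_comult A D) f S = finsum A f S"
  by (simp add: finsum_def finprod_def)

lemma star_alg_homI: "star_alg A \<Longrightarrow> star_alg B \<Longrightarrow> star_hom A B f \<Longrightarrow> star_alg_hom A B f"
  by (simp add: star_alg_hom_def star_alg_hom_axioms_def)

lemma star_alg_pairI: "star_alg A \<Longrightarrow> star_alg B \<Longrightarrow> star_alg_pair A B"
  by (simp add: star_alg_pair_def)

lemma tensor_map_sum:
  assumes "star_alg A" "star_alg B" "star_alg A1" "star_alg B1" "star_hom A A1 f" "star_hom B B1 g"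
    and "finite S" "\<And>k. k \<in> S \<Longrightarrow> x k \<in> carrier A" "\<And>k. k \<in> S \<Longrightarrow> y k \<in> carrier B"
  shows "tensor_map A B A1 B1 f g (\<Oplus>\<^bsub>tensor_algebra A B\<^esub>k\<in>S. pure_tensor A B (x k) (y k))
    = (\<Oplus>\<^bsub>tensor_algebra A1 B1\<^esub>k\<in>S. pure_tensor A1 B1 (f (x k)) (g (y k)))"
proof -
  interpret X: star_alg_pair A B by (rule star_alg_pairI) fact+
  interpret Y: star_alg_pair A1 B1 by (rule star_alg_pairI) fact+
  interpret h: star_alg_hom X.T Y.T "tensor_map A B A1 B1 f g"
    by (intro star_alg_homI X.T.star_alg_axioms Y.T.star_alg_axioms tensor_map(1) assms)
  show ?thesis
    using assms star_homD(1)[OF assms(5)] star_homD(1)[OF assms(6)]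
    by (subst h.hom_finsum) (auto simp: tensor_map(2) intro!: Y.T.finsum_cong'[OF refl])
qed

section \<open>Existence of the coproducts\<close>

text \<open>Existence is \<open>magic_tensor\<close> applied to the matrix of generators with
  itself.\<close>

lemma comult_quantum_perm:
  shows "star_hom (qperm_algebra N) (tensor_algebra (qperm_algebra N) (qperm_algebra N))
      (comult (quantum_perm_group N))"
    and "i \<in> {1..N} \<Longrightarrow> j \<in> {1..N} \<Longrightarrow> comult (quantum_perm_group N) (qperm_gen N i j) =
      (\<Oplus>\<^bsub>tensor_algebra (qperm_algebra N) (qperm_algebra N)\<^esub>k\<in>{1..N}.
        pure_tensor (qperm_algebra N) (qperm_algebra N) (qperm_gen N i k) (qperm_gen N k j))"
proof -
  interpret X: star_alg_pair "qperm_algebra N" "qperm_algebra N" by (rule star_alg_pairI) simp_all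
  let ?P = "\<lambda>\<Delta>. \<forall>i\<in>{1..N}. \<forall>j\<in>{1..N}. \<Delta> (qperm_gen N i j) =
    X.sum_pt N (\<lambda>k. qperm_gen N i k) (\<lambda>k. qperm_gen N k j)"
  obtain h where h: "star_hom (qperm_algebra N) X.T h"
    "\<And>i j. i \<in> {1..N} \<Longrightarrow> j \<in> {1..N} \<Longrightarrow> h (qperm_gen N i j)
        = X.sum_pt N (qperm_gen N i) (\<lambda>k. qperm_gen N k j)"
    by (rule qperm_universal[OF X.T.star_alg_axioms X.magic_tensor[OF magic_qperm magic_qperm]])
        blast
  have "star_hom (qperm_algebra N) X.T (comult (quantum_perm_group N)) \<and> ?P (comult
      (quantum_perm_group N))"
    unfolding quantum_perm_group_def Let_def with_comult_sel
  proof (rule the_star_homI[OF star_alg_qperm h(1)])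
    show "?P (restrict h (carrier (qperm_algebra N)))"
      using h(2) magicD(1)[OF magic_qperm] by simp
  qed (rule qperm_hom_unique, auto)
  then show "star_hom (qperm_algebra N) X.T (comult (quantum_perm_group N))"
    "i \<in> {1..N} \<Longrightarrow> j \<in> {1..N} \<Longrightarrow> comult (quantum_perm_group N) (qperm_gen N i j) =
      X.sum_pt N (\<lambda>k. qperm_gen N i k) (\<lambda>k. qperm_gen N k j)" by blast+
qed

text \<open>Existence: sending g to g \<otimes> g is a unitary representation in the tensor
  square.\<close>

lemma (in group) comult_dual_group:
  shows "star_hom (group_algebra G) (tensor_algebra (group_algebra G) (group_algebra G))
      (comult (dual_group G))"
    and "g \<in> carrier G \<Longrightarrow> comult (dual_group G) (group_elem g) =
      pure_tensor (group_algebra G) (group_algebra G) (group_elem g) (group_elem g)"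
proof -
  let ?A = "group_algebra G"
  interpret X: star_alg_pair ?A ?A by (intro star_alg_pairI star_alg_group_algebra)
  let ?P = "\<lambda>\<Delta>. \<forall>g\<in>carrier G. \<Delta> (group_elem g) = X.pt (group_elem g) (group_elem g)"
  note u = unitary_repD[OF unitary_rep_group_elem]
  have "unitary_rep G X.T (\<lambda>g. X.pt (group_elem g) (group_elem g))"
    unfolding unitary_rep_def using u by (auto simp: X.pt_star X.pt_mult X.pt_one)
  note h = group_algebra_universal[OF X.T.star_alg_axioms this]
  have "star_hom ?A X.T (comult (dual_group G)) \<and> ?P (comult (dual_group G))"
    unfolding dual_group_def Let_def with_comult_sel
  proof (rule the_star_homI[OF star_alg_group_algebra h(1)])
    show "?P (restrict (X.T.lin_ext (\<lambda>g. X.pt (group_elem g) (group_elem g))) (carrier ?A))"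
      using h(2) u(1) by simp
  qed (rule group_algebra_hom_unique, auto)
  then show "star_hom ?A X.T (comult (dual_group G))"
    "g \<in> carrier G \<Longrightarrow> comult (dual_group G) (group_elem g) = X.pt (group_elem g) (group_elem g)"
        by blast+
qed

context wreath begin

abbreviation WW where "WW \<equiv> tensor_algebra W W"
abbreviation \<Delta> where "\<Delta> \<equiv> comult (amalg_free_wreath \<Gamma> \<Lambda> N)"

text \<open>Existence is \<open>wreath_data_tensor\<close> with the universal data in both tensor
  factors.\<close>

lemma comult_wreath:
  shows "star_hom W WW \<Delta>"
    and "i \<in> {1..N} \<Longrightarrow> j \<in> {1..N} \<Longrightarrow> \<Delta> (p i j) = (\<Oplus>\<^bsub>WW\<^esub>k\<in>{1..N}. pure_tensor W W (p i k) (p k j))"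
    and "i \<in> {1..N} \<Longrightarrow> g \<in> carrier \<Gamma> \<Longrightarrow> \<Delta> (nu i g) = (\<Oplus>\<^bsub>WW\<^esub>k\<in>{1..N}. pure_tensor W W (nu i g \<otimes>\<^bsub>W\<^esub> p i
        k) (nu k g))"
proof -
  interpret X: star_alg_pair W W by (intro star_alg_pairI star_alg_W)
  obtain h where h: "star_hom W X.T h"
    "\<And>i g. i \<in> {1..N} \<Longrightarrow> g \<in> carrier \<Gamma> \<Longrightarrow> h (nu i g)
        = X.sum_pt N (\<lambda>k. nu i g \<otimes>\<^bsub>W\<^esub> p i k) (\<lambda>k. nu k g)"
    "\<And>i j. i \<in> {1..N} \<Longrightarrow> j \<in> {1..N} \<Longrightarrow> h (p i j) = X.sum_pt N (p i) (\<lambda>k. p k j)"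
    by (rule wreath_universal[OF X.T.star_alg_axioms
      X.wreath_data_tensor[OF group_axioms \<Lambda>_closed wreath_data_W wreath_data_W]]) blast
  let ?P = "\<lambda>\<Delta>. (\<forall>i\<in>{1..N}. \<forall>j\<in>{1..N}. \<Delta> (p i j) = X.sum_pt N (\<lambda>k. p i k) (\<lambda>k. p k j)) \<and>
    (\<forall>i\<in>{1..N}. \<forall>g\<in>carrier \<Gamma>. \<Delta> (nu i g) = X.sum_pt N (\<lambda>k. nu i g \<otimes>\<^bsub>W\<^esub> p i k) (\<lambda>k. nu k g))"
  have "star_hom W X.T \<Delta> \<and> ?P \<Delta>"
    unfolding amalg_free_wreath_def Let_def with_comult_sel
  proof (rule the_star_homI[OF star_alg_W h(1)])
    show "?P (restrict h (carrier W))"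
      by (simp add: h(2,3))
  qed (rule wreath_hom_unique, auto)
  then show "star_hom W X.T \<Delta>"
    "i \<in> {1..N} \<Longrightarrow> j \<in> {1..N} \<Longrightarrow> \<Delta> (p i j) = X.sum_pt N (\<lambda>k. p i k) (\<lambda>k. p k j)"
    "i \<in> {1..N} \<Longrightarrow> g \<in> carrier \<Gamma> \<Longrightarrow> \<Delta> (nu i g) = X.sum_pt N (\<lambda>k. nu i g \<otimes>\<^bsub>W\<^esub> p i k) (\<lambda>k. nu k g)"
    by blast+
qed

section \<open>The quantum subgroup \<open>\<Gamma> \<times> S\<^sub>N\<^sup>+\<close>\<close>

abbreviation H1 where "H1 \<equiv> product_quantum_group (dual_group \<Gamma>) (quantum_perm_group N)"
abbreviation P1 where "P1 \<equiv> tensor_algebra CG SN"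
abbreviation pt1 where "pt1 \<equiv> pure_tensor CG SN"
abbreviation \<pi>1 where "\<pi>1 \<equiv> wreath_to_product \<Gamma> \<Lambda> N"

lemma pair1: "star_alg_pair CG SN"
  by (intro star_alg_pairI star_alg_group_algebra star_alg_qperm)

lemma product_quantum_group_eq: "H1 = with_comult P1 (the_star_hom P1 (tensor_algebra P1 P1)
   (\<lambda>\<Delta>. (\<forall>a\<in>carrier CG. \<Delta> (pt1 a \<one>\<^bsub>SN\<^esub>) =
        tensor_map CG CG P1 P1 (\<lambda>a. pt1 a \<one>\<^bsub>SN\<^esub>) (\<lambda>a. pt1 a \<one>\<^bsub>SN\<^esub>) (comult (dual_group \<Gamma>) a)) \<and>
      (\<forall>b\<in>carrier SN. \<Delta> (pt1 \<one>\<^bsub>CG\<^esub> b) =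
        tensor_map SN SN P1 P1 (pt1 \<one>\<^bsub>CG\<^esub>) (pt1 \<one>\<^bsub>CG\<^esub>) (comult (quantum_perm_group N) b))))"
proof -
  obtain D where D: "dual_group \<Gamma> = with_comult CG D" unfolding dual_group_def Let_def by blast
  obtain E where E: "quantum_perm_group N = with_comult SN E"
      unfolding quantum_perm_group_def Let_def by blast
  show ?thesis unfolding product_quantum_group_def Let_def D E by simp
qed

end

lemma carrier_subset_star_span: "carrier A \<subseteq> star_span A (carrier A)"
  by (auto intro: star_span.gen)

context wreath begin

lemma H1_eq: "H1 = with_comult P1 (comult H1)"
  by (subst (1 2) product_quantum_group_eq) simp

lemma star_hom_CG_P1: "star_hom CG P1 (\<lambda>a. pt1 a \<one>\<^bsub>SN\<^esub>)"
  and star_hom_SN_P1: "star_hom SN P1 (pt1 \<one>\<^bsub>CG\<^esub>)"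
  using star_alg_pair.star_hom_left[OF pair1] star_alg_pair.star_hom_right[OF pair1] .

lemma star_alg_P1: "star_alg P1"
  by (intro star_alg_tensor star_alg_group_algebra star_alg_qperm)

abbreviation PP1 where "PP1 \<equiv> tensor_algebra P1 P1"
abbreviation ptt1 where "ptt1 \<equiv> pure_tensor P1 P1"

text \<open>The prescriptions on the two tensor factors combine to one homomorphism as soon as their
  ranges commute, and this can be tested on group elements and magic generators.\<close>

lemma comult_product:
  shows "star_hom P1 PP1 (comult H1)"
    and "g \<in> carrier \<Gamma> \<Longrightarrow> comult H1 (pt1 (group_elem g) \<one>\<^bsub>SN\<^esub>) =
      ptt1 (pt1 (group_elem g) \<one>\<^bsub>SN\<^esub>) (pt1 (group_elem g) \<one>\<^bsub>SN\<^esub>)"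
    and "i \<in> {1..N} \<Longrightarrow> j \<in> {1..N} \<Longrightarrow> comult H1 (pt1 \<one>\<^bsub>CG\<^esub> (qperm_gen N i j)) =
      (\<Oplus>\<^bsub>PP1\<^esub>k\<in>{1..N}. ptt1 (pt1 \<one>\<^bsub>CG\<^esub> (qperm_gen N i k)) (pt1 \<one>\<^bsub>CG\<^esub> (qperm_gen N k j)))"
proof -
  interpret X: star_alg_pair CG SN by (rule pair1)
  interpret Y: star_alg_pair P1 P1 by (intro star_alg_pairI star_alg_P1)
  let ?f = "\<lambda>a. tensor_map CG CG P1 P1 (\<lambda>a. pt1 a \<one>\<^bsub>SN\<^esub>) (\<lambda>a. pt1 a \<one>\<^bsub>SN\<^esub>) (comult (dual_group \<Gamma>) a)"
  let ?g = "\<lambda>b. tensor_map SN SN P1 P1 (pt1 \<one>\<^bsub>CG\<^esub>) (pt1 \<one>\<^bsub>CG\<^esub>) (comult (quantum_perm_group N) b)"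
  note tm1 = tensor_map[OF X.A.star_alg_axioms X.A.star_alg_axioms star_alg_P1 star_alg_P1
      star_hom_CG_P1 star_hom_CG_P1]
  note tm2 = tensor_map[OF star_alg_qperm star_alg_qperm star_alg_P1 star_alg_P1 star_hom_SN_P1
      star_hom_SN_P1]
  have f: "star_hom CG Y.T ?f" by (rule star_hom_comp[OF comult_dual_group(1) tm1(1)])
  have g: "star_hom SN Y.T ?g" by (rule star_hom_comp[OF comult_quantum_perm(1) tm2(1)])
  have fv: "?f (group_elem a) = ptt1 (pt1 (group_elem a) \<one>\<^bsub>SN\<^esub>) (pt1 (group_elem a) \<one>\<^bsub>SN\<^esub>)"
      if "a \<in> carrier \<Gamma>" for a
    using that by (simp add: comult_dual_group(2) tm1(2) group_elem_closed)
  note pc = magicD(1)[OF magic_qperm, of _ N]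
  have gv: "?g (qperm_gen N i j) = Y.sum_pt N (\<lambda>k. pt1 \<one>\<^bsub>CG\<^esub> (qperm_gen N i k)) (\<lambda>k. pt1 \<one>\<^bsub>CG\<^esub>
      (qperm_gen N k j))"
    if "i \<in> {1..N}" "j \<in> {1..N}" for i j
    unfolding comult_quantum_perm(2)[OF that]
    by (rule tensor_map_sum[OF star_alg_qperm star_alg_qperm star_alg_P1 star_alg_P1
        star_hom_SN_P1 star_hom_SN_P1])
      (use that pc in auto)
  \<comment> \<open>Either product is the sum over k of (g \<otimes> p_ik) \<otimes> (g \<otimes>
    p_kj).\<close>
  have comm0: "?f s \<otimes>\<^bsub>Y.T\<^esub> ?g t = ?g t \<otimes>\<^bsub>Y.T\<^esub> ?f s" if s: "s \<in> group_elem ` carrier \<Gamma>"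
      and t: "t \<in> qperm_gens N" for s t
  proof -
    obtain a where a: "a \<in> carrier \<Gamma>" "s = group_elem a" using s by auto
    obtain i j where ij: "i \<in> {1..N}" "j \<in> {1..N}" "t = qperm_gen N i j" using t by auto
    show ?thesis unfolding a(2) ij(3) fv[OF a(1)] gv[OF ij(1,2)]
      using a(1) ij(1,2) pc group_elem_closed[OF a(1)]
      by (subst Y.T.finsum_rdistr Y.T.finsum_ldistr)
        (simp_all add: Pi_def Y.pt_mult X.pt_mult Y.T.finsum_rdistr Y.T.finsum_ldistr cong:
            Y.T.finsum_cong)
  qed
  \<comment> \<open>Passing from generators to spans also requires commutation with adjoints; the
    images of the p_ij are self-adjoint.\<close>
  have star_t: "star Y.T (?g t) = ?g t" if t: "t \<in> qperm_gens N" for t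
    using t magicD(1,2)[OF magic_qperm] by (auto simp flip: star_hom_star[OF g])
  have comm: "?f a \<otimes>\<^bsub>Y.T\<^esub> ?g b = ?g b \<otimes>\<^bsub>Y.T\<^esub> ?f a" if "a \<in> carrier CG" "b \<in> carrier SN" for a b
  proof (rule Y.T.commute_spans[of "?f ` group_elem ` carrier \<Gamma>" "?g ` qperm_gens N"])
    show "?f ` group_elem ` carrier \<Gamma> \<subseteq> carrier Y.T" "?g ` qperm_gens N \<subseteq> carrier Y.T"
      using star_hom_closed[OF f] star_hom_closed[OF g] group_elem_closed qperm_gens_closed by
          blast+
    show "?f a \<in> star_span Y.T (?f ` group_elem ` carrier \<Gamma>)"
      using star_hom_image_span[OF X.A.star_alg_axioms _ f, of "group_elem ` carrier \<Gamma>" a] that(1)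
        group_algebra_span group_elem_closed by blast
    show "?g b \<in> star_span Y.T (?g ` qperm_gens N)"
      using star_hom_image_span[OF star_alg_qperm qperm_gens_closed g, of b] that(2) qperm_span by
          blast
  next
    fix s t assume "s \<in> ?f ` group_elem ` carrier \<Gamma>" "t \<in> ?g ` qperm_gens N"
    then obtain s' t' where st: "s' \<in> group_elem ` carrier \<Gamma>" "s = ?f s'" "t' \<in> qperm_gens N" "t
        = ?g t'"
      by (elim imageE[of s] imageE[of t]) blast
    show "s \<otimes>\<^bsub>Y.T\<^esub> t = t \<otimes>\<^bsub>Y.T\<^esub> s" "s \<otimes>\<^bsub>Y.T\<^esub> star Y.T t = star Y.T t \<otimes>\<^bsub>Y.T\<^esub> s"
      unfolding st(2,4) star_t[OF st(3)] by (rule comm0[OF st(1,3)])+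
  qed
  obtain h where h: "star_hom P1 Y.T h" "\<And>a b. a \<in> carrier CG \<Longrightarrow> b \<in> carrier SN \<Longrightarrow> h (pt1 a b)
      = ?f a \<otimes>\<^bsub>Y.T\<^esub> ?g b"
    by (rule X.tensor_hom_universal[OF Y.T.star_alg_axioms f g comm]) blast+
  let ?P = "\<lambda>\<Delta>. (\<forall>a\<in>carrier CG. \<Delta> (pt1 a \<one>\<^bsub>SN\<^esub>) = ?f a) \<and> (\<forall>b\<in>carrier SN. \<Delta> (pt1 \<one>\<^bsub>CG\<^esub> b) = ?g b)"
  have "star_hom P1 PP1 (comult H1) \<and> ?P (comult H1)"
    unfolding product_quantum_group_eq with_comult_sel(8)
  proof (rule the_star_homI[OF star_alg_P1 h(1)])
    show "?P (restrict h (carrier P1))"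
      using star_homD(1,4)[OF f] star_homD(1,4)[OF g] by (simp add: h(2))
  next
    fix k l x assume kl: "star_hom P1 PP1 k" "star_hom P1 PP1 l" "?P k" "?P l" "x \<in> carrier P1"
    show "k x = l x"
      by (rule star_hom_unique[OF star_alg_P1 _ X.tensor_span[OF order.refl
          carrier_subset_star_span order.refl
            carrier_subset_star_span] kl(1,2) _ kl(5)])
        (use kl(3,4) in auto)
  qed
  then show "star_hom P1 PP1 (comult H1)"
    "g \<in> carrier \<Gamma> \<Longrightarrow> comult H1 (pt1 (group_elem g) \<one>\<^bsub>SN\<^esub>) =
      ptt1 (pt1 (group_elem g) \<one>\<^bsub>SN\<^esub>) (pt1 (group_elem g) \<one>\<^bsub>SN\<^esub>)"
    "i \<in> {1..N} \<Longrightarrow> j \<in> {1..N} \<Longrightarrow> comult H1 (pt1 \<one>\<^bsub>CG\<^esub> (qperm_gen N i j)) =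
      Y.sum_pt N (\<lambda>k. pt1 \<one>\<^bsub>CG\<^esub> (qperm_gen N i k)) (\<lambda>k. pt1 \<one>\<^bsub>CG\<^esub> (qperm_gen N k j))"
    using fv gv pc group_elem_closed by auto
qed

text \<open>All copies of \<Gamma> are sent to the same elements g \<otimes> 1, so they agree on
  \<Lambda> and commute with every 1 \<otimes> p_ij.\<close>

lemma wreath_to_product:
  shows "star_hom W P1 \<pi>1"
    and "i \<in> {1..N} \<Longrightarrow> g \<in> carrier \<Gamma> \<Longrightarrow> \<pi>1 (nu i g) = pt1 (group_elem g) \<one>\<^bsub>SN\<^esub>"
    and "i \<in> {1..N} \<Longrightarrow> j \<in> {1..N} \<Longrightarrow> \<pi>1 (p i j) = pt1 \<one>\<^bsub>CG\<^esub> (qperm_gen N i j)"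
proof -
  interpret X: star_alg_pair CG SN by (rule pair1)
  have "wreath_data P1 \<Gamma> \<Lambda> N (\<lambda>i g. pt1 (group_elem g) \<one>\<^bsub>SN\<^esub>) (\<lambda>i j. pt1 \<one>\<^bsub>CG\<^esub> (qperm_gen N i j))"
    unfolding wreath_data_def
    using unitary_rep_hom[OF unitary_rep_group_elem star_hom_CG_P1]
      star_alg_hom.magic_hom[OF star_alg_homI[OF star_alg_qperm star_alg_P1 star_hom_SN_P1]
          magic_qperm]
    by (simp add: X.pt_mult group_elem_closed magicD(1)[OF magic_qperm])
  from wreath_universal[OF star_alg_P1 this] obtain h where h: "star_hom W P1 h"
    "\<And>i g. i \<in> {1..N} \<Longrightarrow> g \<in> carrier \<Gamma> \<Longrightarrow> h (nu i g) = pt1 (group_elem g) \<one>\<^bsub>SN\<^esub>"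
    "\<And>i j. i \<in> {1..N} \<Longrightarrow> j \<in> {1..N} \<Longrightarrow> h (p i j) = pt1 \<one>\<^bsub>CG\<^esub> (qperm_gen N i j)" by blast
  let ?P = "\<lambda>\<pi>. (\<forall>i\<in>{1..N}. \<forall>g\<in>carrier \<Gamma>. \<pi> (nu i g) = pt1 (group_elem g) \<one>\<^bsub>SN\<^esub>) \<and>
     (\<forall>i\<in>{1..N}. \<forall>j\<in>{1..N}. \<pi> (p i j) = pt1 \<one>\<^bsub>CG\<^esub> (qperm_gen N i j))"
  have "star_hom W P1 \<pi>1 \<and> ?P \<pi>1"
    unfolding wreath_to_product_def Let_def
  proof (rule the_star_homI[OF star_alg_W h(1)])
    show "?P (restrict h (carrier W))" by (simp add: h(2,3))
  qed (rule wreath_hom_unique, auto)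
  then show "star_hom W P1 \<pi>1"
    "i \<in> {1..N} \<Longrightarrow> g \<in> carrier \<Gamma> \<Longrightarrow> \<pi>1 (nu i g) = pt1 (group_elem g) \<one>\<^bsub>SN\<^esub>"
    "i \<in> {1..N} \<Longrightarrow> j \<in> {1..N} \<Longrightarrow> \<pi>1 (p i j) = pt1 \<one>\<^bsub>CG\<^esub> (qperm_gen N i j)" by blast+
qed

abbreviation G where "G \<equiv> amalg_free_wreath \<Gamma> \<Lambda> N"

lemma wreath_group_eq: "G = with_comult W \<Delta>"
  unfolding amalg_free_wreath_def Let_def by simp

lemma quantum_subgroup_product:
  assumes "N \<ge> 1" shows "quantum_subgroup G H1 \<pi>1"
proof -
  interpret X: star_alg_pair CG SN by (rule pair1)
  interpret Y: star_alg_pair P1 P1 by (intro star_alg_pairI star_alg_P1)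
  interpret Z: star_alg_pair W W by (intro star_alg_pairI star_alg_W)
  interpret Z: star_alg W by (rule star_alg_W)
  note \<pi> = wreath_to_product
  note pc = magicD(1)[OF magic_qperm, of _ N]
  note tm = tensor_map[OF star_alg_W star_alg_W star_alg_P1 star_alg_P1 \<pi>(1) \<pi>(1)]
    and tms = tensor_map_sum[OF star_alg_W star_alg_W star_alg_P1 star_alg_P1 \<pi>(1) \<pi>(1)]
  have "comult H1 (\<pi>1 x) = tensor_map W W P1 P1 \<pi>1 \<pi>1 (\<Delta> x)" if "x \<in> carrier W" for x
  proof (rule wreath_hom_unique[OF star_hom_comp[OF \<pi>(1) comult_product(1)] star_hom_comp[OF
      comult_wreath(1) tm(1)] _ _ that])
    fix i g assume ig: "i \<in> {1..N}" "g \<in> carrier \<Gamma>"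
    have "tensor_map W W P1 P1 \<pi>1 \<pi>1 (\<Delta> (nu i g)) = Y.sum_pt N (\<lambda>k. \<pi>1 (nu i g \<otimes>\<^bsub>W\<^esub> p i k))
        (\<lambda>k. \<pi>1 (nu k g))"
      unfolding comult_wreath(3)[OF ig] by (rule tms) (use ig in auto)
    also have "\<dots> = Y.sum_pt N (\<lambda>k. pt1 (group_elem g) (qperm_gen N i k)) (\<lambda>k. pt1 (group_elem g)
        \<one>\<^bsub>SN\<^esub>)"
      using ig pc group_elem_closed by (intro Y.sum_pt_cong) (auto simp: star_hom_mult[OF \<pi>(1)]
          \<pi>(2,3) X.pt_mult)
    \<comment> \<open>The second factor no longer depends on k, so the row sum of the magic unitary
      leaves (g \<otimes> 1) \<otimes> (g \<otimes> 1).\<close>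
    also have "\<dots> = ptt1 (\<Oplus>\<^bsub>P1\<^esub>k\<in>{1..N}. pt1 (group_elem g) (qperm_gen N i k)) (pt1 (group_elem g)
        \<one>\<^bsub>SN\<^esub>)"
      using ig pc group_elem_closed by (intro Y.sum_pt_const_right) auto
    also have "(\<Oplus>\<^bsub>P1\<^esub>k\<in>{1..N}. pt1 (group_elem g) (qperm_gen N i k)) = pt1 (group_elem g) \<one>\<^bsub>SN\<^esub>"
      using ig pc group_elem_closed magicD(3)[OF magic_qperm ig(1)]
      by (subst X.pt_finsum_right[symmetric]) auto
    finally show "comult H1 (\<pi>1 (nu i g)) = tensor_map W W P1 P1 \<pi>1 \<pi>1 (\<Delta> (nu i g))"
      using ig by (simp add: \<pi>(2) comult_product(2))
  next
    fix i j assume ij: "i \<in> {1..N}" "j \<in> {1..N}"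
    have "tensor_map W W P1 P1 \<pi>1 \<pi>1 (\<Delta> (p i j)) = Y.sum_pt N (\<lambda>k. \<pi>1 (p i k)) (\<lambda>k. \<pi>1 (p k j))"
      unfolding comult_wreath(2)[OF ij] by (rule tms) (use ij in auto)
    also have "\<dots> = comult H1 (\<pi>1 (p i j))"
      unfolding \<pi>(3)[OF ij] comult_product(3)[OF ij]
      using ij pc by (intro Y.sum_pt_cong) (auto simp: \<pi>(3))
    finally show "comult H1 (\<pi>1 (p i j)) = tensor_map W W P1 P1 \<pi>1 \<pi>1 (\<Delta> (p i j))" ..
  qed
  moreover have "\<pi>1 ` carrier W = carrier P1"
  proof (rule star_hom_surj[OF star_alg_W \<pi>(1)])
    show "carrier P1 \<subseteq> star_span P1 ((\<lambda>a. pt1 a \<one>\<^bsub>SN\<^esub>) ` group_elem ` carrier \<Gamma> \<union> pt1 \<one>\<^bsub>CG\<^esub> `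
        qperm_gens N)"
      by (rule X.tensor_span[OF _ group_algebra_span qperm_gens_closed qperm_span])
          (use group_elem_closed in auto)
    \<comment> \<open>An index is needed to reach g \<otimes> 1: it is the image of
      \<open>nu 1 g\<close>.\<close>
    have 1: "1 \<in> {1..N}" using assms by (simp add: atLeastAtMost_iff)
    have "pt1 (group_elem g) \<one>\<^bsub>SN\<^esub> \<in> \<pi>1 ` carrier W" if "g \<in> carrier \<Gamma>" for g
      using \<pi>(2)[OF 1 that] nu_closed[OF 1 that] by (metis image_eqI)
    moreover have "pt1 \<one>\<^bsub>CG\<^esub> (qperm_gen N i j) \<in> \<pi>1 ` carrier W" if "i \<in> {1..N}" "j \<in> {1..N}" for i j
      using \<pi>(3)[OF that] p_closed[OF that] by (metis image_eqI)
    ultimately show "(\<lambda>a. pt1 a \<one>\<^bsub>SN\<^esub>) ` group_elem ` carrier \<Gamma> \<union> pt1 \<one>\<^bsub>CG\<^esub> ` qperm_gens N \<subseteq> \<pi>1 `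
        carrier W"
      by auto
  qed
  ultimately have "quantum_subgroup (with_comult W \<Delta>) (with_comult P1 (comult H1)) \<pi>1"
    unfolding quantum_subgroup_def hopf_star_hom_def by (simp add: \<pi>(1))
  then show ?thesis unfolding wreath_group_eq[symmetric] H1_eq[symmetric] .
qed

end

section \<open>The quantum subgroup given by \<open>\<Gamma>/\<Lambda>\<close>\<close>

text \<open>\<open>N_pos\<close> supplies the copy of \<Gamma> with index 1, in which the elements
  of \<Lambda> are written down.\<close>

locale normal_wreath = normal \<Lambda> \<Gamma> for \<Lambda> and \<Gamma> :: "('g, 'c) monoid_scheme" (structure) +
  fixes N :: nat
  assumes N_pos: "N \<ge> 1"
begin

abbreviation \<Theta> where "\<Theta> \<equiv> \<Gamma> Mod \<Lambda>"
abbreviation coset where "coset g \<equiv> \<Lambda> #>\<^bsub>\<Gamma>\<^esub> g"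

sublocale W: wreath \<Gamma> \<Lambda> N
  by unfold_locales (rule subset)

sublocale Q: wreath \<Theta> "{\<one>\<^bsub>\<Theta>\<^esub>}" N
  by (intro wreath.intro factorgroup_is_group wreath_axioms.intro) (simp add: FactGroup_def
      subgroup_in_rcosets[OF group_axioms] subset)

lemma one_in [simp]: "1 \<in> {1..N}"
  using N_pos by (simp add: atLeastAtMost_iff)

text \<open>The unit of \<Gamma>/\<Lambda> stays a unit instead of becoming the set \<Lambda>, so
  that the trivial subgroup of the second wreath product remains recognisable.\<close>

declare one_FactGroup [simp del]

lemma coset_closed [simp]: "g \<in> carrier \<Gamma> \<Longrightarrow> coset g \<in> carrier \<Theta>"
  by (auto simp: carrier_FactGroup)

lemma coset_mult: "g \<in> carrier \<Gamma> \<Longrightarrow> h \<in> carrier \<Gamma> \<Longrightarrow> coset g \<otimes>\<^bsub>\<Theta>\<^esub> coset h = coset (g \<otimes> h)"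
  by (simp add: rcos_sum)

lemma coset_inv: "g \<in> carrier \<Gamma> \<Longrightarrow> inv\<^bsub>\<Theta>\<^esub> coset g = coset (inv g)"
  by (simp add: inv_FactGroup rcos_inv)

lemma coset_subgroup: "g \<in> \<Lambda> \<Longrightarrow> coset g = \<one>\<^bsub>\<Theta>\<^esub>"
  using coset_join2[of g \<Lambda>] subgroup_axioms subset by (auto simp: one_FactGroup)

abbreviation \<pi>2 where "\<pi>2 \<equiv> wreath_to_quotient \<Gamma> \<Lambda> N"
abbreviation H2 where "H2 \<equiv> free_wreath \<Theta> N"

lemma H2_eq: "H2 = with_comult Q.W Q.\<Delta>"
  unfolding free_wreath_def using Q.wreath_group_eq .

text \<open>Precomposition with the quotient map. An element of \<Lambda> becomes the unit coset, on
  which all representations take the same value.\<close>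

lemma wreath_data_pullback:
  assumes "wreath_data B \<Theta> {\<one>\<^bsub>\<Theta>\<^esub>} N n q"
  shows "wreath_data B \<Gamma> \<Lambda> N (\<lambda>i g. n i (coset g)) q"
proof -
  note D = wreath_dataD[OF assms] and u = unitary_repD[OF wreath_dataD(1)[OF assms]]
  have one: "coset \<one> = \<one>\<^bsub>\<Theta>\<^esub>" by (rule coset_subgroup) (rule subgroup.one_closed[OF subgroup_axioms])
  have "unitary_rep \<Gamma> B (\<lambda>g. n i (coset g))" if i: "i \<in> {1..N}" for i
    unfolding unitary_rep_def one
  proof (intro conjI ballI)
    fix g assume g: "g \<in> carrier \<Gamma>"
    show "n i (coset g) \<in> carrier B" by (rule u(1)[OF i coset_closed[OF g]])
    show "n i (coset (inv g)) = star B (n i (coset g))"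
      unfolding coset_inv[OF g, symmetric] by (rule u(2)[OF i coset_closed[OF g]])
    fix h assume h: "h \<in> carrier \<Gamma>"
    show "n i (coset (g \<otimes> h)) = n i (coset g) \<otimes>\<^bsub>B\<^esub> n i (coset h)"
      unfolding coset_mult[OF g h, symmetric] by (rule u(4)[OF i coset_closed[OF g]
          coset_closed[OF h]])
  qed (rule u(3)[OF i])
  moreover have "n i (coset g) = n j (coset g)" if "i \<in> {1..N}" "j \<in> {1..N}" "g \<in> \<Lambda>" for i j g
    unfolding coset_subgroup[OF that(3)] by (rule D(2)[OF that(1,2) insertI1])
  ultimately show ?thesis
    unfolding wreath_data_def by (intro conjI ballI D(3) D(4) coset_closed)
qed

lemma wreath_to_quotient:
  shows "star_hom W.W Q.W \<pi>2"
    and "i \<in> {1..N} \<Longrightarrow> g \<in> carrier \<Gamma> \<Longrightarrow> \<pi>2 (W.nu i g) = Q.nu i (coset g)"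
    and "i \<in> {1..N} \<Longrightarrow> j \<in> {1..N} \<Longrightarrow> \<pi>2 (W.p i j) = Q.p i j"
proof -
  obtain h where h: "star_hom W.W Q.W h"
    "\<And>i g. i \<in> {1..N} \<Longrightarrow> g \<in> carrier \<Gamma> \<Longrightarrow> h (W.nu i g) = Q.nu i (coset g)"
    "\<And>i j. i \<in> {1..N} \<Longrightarrow> j \<in> {1..N} \<Longrightarrow> h (W.p i j) = Q.p i j"
    by (rule W.wreath_universal[OF Q.star_alg_W wreath_data_pullback[OF Q.wreath_data_W]]) blast
  let ?P = "\<lambda>\<pi>. (\<forall>i\<in>{1..N}. \<forall>g\<in>carrier \<Gamma>. \<pi> (W.nu i g) = Q.nu i (coset g)) \<and>
     (\<forall>i\<in>{1..N}. \<forall>j\<in>{1..N}. \<pi> (W.p i j) = Q.p i j)"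
  have "star_hom W.W Q.W \<pi>2 \<and> ?P \<pi>2"
    unfolding wreath_to_quotient_def Let_def H2_eq the_star_hom_with_comult
  proof (rule the_star_homI[OF W.star_alg_W h(1)])
    show "?P (restrict h (carrier W.W))" by (simp add: h(2,3))
  qed (rule W.wreath_hom_unique, auto)
  then show "star_hom W.W Q.W \<pi>2"
    "i \<in> {1..N} \<Longrightarrow> g \<in> carrier \<Gamma> \<Longrightarrow> \<pi>2 (W.nu i g) = Q.nu i (coset g)"
    "i \<in> {1..N} \<Longrightarrow> j \<in> {1..N} \<Longrightarrow> \<pi>2 (W.p i j) = Q.p i j" by blast+
qed

lemma wreath_to_quotient_surj: "\<pi>2 ` carrier W.W = carrier Q.W"
proof (rule star_hom_surj[OF W.star_alg_W wreath_to_quotient(1) _ Q.wreath_span])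
  have "Q.nu i X \<in> \<pi>2 ` carrier W.W" if "i \<in> {1..N}" "X \<in> carrier \<Theta>" for i X
  proof -
    from that(2) obtain g where g: "g \<in> carrier \<Gamma>" "X = coset g" by (auto simp: carrier_FactGroup)
    show ?thesis unfolding g(2) wreath_to_quotient(2)[OF that(1) g(1), symmetric]
        using that(1) g(1) by blast
  qed
  moreover have "Q.p i j \<in> \<pi>2 ` carrier W.W" if "i \<in> {1..N}" "j \<in> {1..N}" for i j
    unfolding wreath_to_quotient(3)[OF that, symmetric] using that by blast
  ultimately show "Q.wreath_gens \<subseteq> \<pi>2 ` carrier W.W" by auto
qed

text \<open>Both coproducts obey the same formulas on generators, with g replaced by its coset, so
  the two sides agree term by term.\<close>

lemma quantum_subgroup_quotient: "quantum_subgroup W.G H2 \<pi>2"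
proof -
  interpret Y: star_alg_pair Q.W Q.W by (intro star_alg_pairI Q.star_alg_W)
  interpret A: star_alg W.W by (rule W.star_alg_W)
  note \<pi> = wreath_to_quotient
  note tm = tensor_map[OF W.star_alg_W W.star_alg_W Q.star_alg_W Q.star_alg_W \<pi>(1) \<pi>(1)]
    and tms = tensor_map_sum[OF W.star_alg_W W.star_alg_W Q.star_alg_W Q.star_alg_W \<pi>(1) \<pi>(1)]
  have "Q.\<Delta> (\<pi>2 x) = tensor_map W.W W.W Q.W Q.W \<pi>2 \<pi>2 (W.\<Delta> x)" if "x \<in> carrier W.W" for x
  proof (rule W.wreath_hom_unique[OF star_hom_comp[OF \<pi>(1) Q.comult_wreath(1)] star_hom_comp[OF
      W.comult_wreath(1) tm(1)] _ _ that])
    fix i g assume ig: "i \<in> {1..N}" "g \<in> carrier \<Gamma>"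
    have "tensor_map W.W W.W Q.W Q.W \<pi>2 \<pi>2 (W.\<Delta> (W.nu i g))
      = Y.sum_pt N (\<lambda>k. \<pi>2 (W.nu i g \<otimes>\<^bsub>W.W\<^esub> W.p i k)) (\<lambda>k. \<pi>2 (W.nu k g))"
      unfolding W.comult_wreath(3)[OF ig] by (rule tms) (use ig in auto)
    also have "\<dots> = Q.\<Delta> (\<pi>2 (W.nu i g))"
      unfolding \<pi>(2)[OF ig] Q.comult_wreath(3)[OF ig(1) coset_closed[OF ig(2)]]
      using ig by (intro Y.sum_pt_cong) (auto simp: star_hom_mult[OF \<pi>(1)] \<pi>(2,3)
          intro!: Y.A.m_closed)
    finally show "Q.\<Delta> (\<pi>2 (W.nu i g)) = tensor_map W.W W.W Q.W Q.W \<pi>2 \<pi>2 (W.\<Delta> (W.nu i g))" ..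
  next
    fix i j assume ij: "i \<in> {1..N}" "j \<in> {1..N}"
    have "tensor_map W.W W.W Q.W Q.W \<pi>2 \<pi>2 (W.\<Delta> (W.p i j))
        = Y.sum_pt N (\<lambda>k. \<pi>2 (W.p i k)) (\<lambda>k. \<pi>2 (W.p k j))"
      unfolding W.comult_wreath(2)[OF ij] by (rule tms) (use ij in auto)
    also have "\<dots> = Q.\<Delta> (\<pi>2 (W.p i j))"
      unfolding \<pi>(3)[OF ij] Q.comult_wreath(2)[OF ij]
      using ij by (intro Y.sum_pt_cong) (auto simp: \<pi>(3))
    finally show "Q.\<Delta> (\<pi>2 (W.p i j)) = tensor_map W.W W.W Q.W Q.W \<pi>2 \<pi>2 (W.\<Delta> (W.p i j))" ..
  qed
  then have "quantum_subgroup (with_comult W.W W.\<Delta>) (with_comult Q.W Q.\<Delta>) \<pi>2"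
    unfolding quantum_subgroup_def hopf_star_hom_def
        using wreath_to_quotient_surj by (simp add: \<pi>(1))
  then show ?thesis unfolding W.wreath_group_eq[symmetric] H2_eq[symmetric] .
qed

end

context normal_wreath begin

abbreviation CG where "CG \<equiv> W.CG"
abbreviation WA where "WA \<equiv> W.W"
abbreviation QA where "QA \<equiv> Q.W"
abbreviation nu where "nu \<equiv> W.nu"
text \<open>On \<Lambda> all \<open>nu i\<close> coincide, and copy 1 stands for the common
  image.\<close>

abbreviation lam where "lam x \<equiv> nu 1 x"

sublocale WA: star_alg WA by (rule W.star_alg_W)
sublocale QA: star_alg QA by (rule Q.star_alg_W)
sublocale CG: star_alg CG by (rule star_alg_group_algebra)
sublocale GW: star_alg_pair CG WA by unfold_locales
sublocale GQ: star_alg_pair CG QA by unfold_locales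
sublocale \<pi>2: star_alg_hom WA QA \<pi>2 by unfold_locales (rule wreath_to_quotient(1))

lemmas nu_rep = unitary_repD[OF wreath_dataD(1)[OF W.wreath_data_W]]
lemmas nu_agree = wreath_dataD(2)[OF W.wreath_data_W]
lemmas elem_rep = unitary_repD[OF unitary_rep_group_elem]

subsection \<open>The grading of the amalgamated free wreath product\<close>

text \<open>A \<Gamma>-grading is encoded as a coaction of the group algebra. It exists because
  every defining relation is homogeneous when \<open>nu i g\<close> has degree g and
  \<open>p i j\<close> has degree 1; in particular the identified copies of \<Lambda> carry equal
  degrees.\<close>

lemma wreath_grading:
  obtains \<gamma> where "star_hom WA GW.T \<gamma>"
    "\<And>i g. i \<in> {1..N} \<Longrightarrow> g \<in> carrier \<Gamma> \<Longrightarrow> \<gamma> (nu i g) = GW.pt (group_elem g) (nu i g)"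
    "\<And>i j. i \<in> {1..N} \<Longrightarrow> j \<in> {1..N} \<Longrightarrow> \<gamma> (W.p i j) = GW.pt \<one>\<^bsub>CG\<^esub> (W.p i j)"
proof (rule W.wreath_universal[OF GW.T.star_alg_axioms])
  note D = wreath_dataD[OF W.wreath_data_W]
  show "wreath_data GW.T \<Gamma> \<Lambda> N (\<lambda>i g. GW.pt (group_elem g) (nu i g)) (\<lambda>i j. GW.pt \<one>\<^bsub>CG\<^esub> (W.p i j))"
    unfolding wreath_data_def
  proof (intro conjI ballI)
    fix i assume i: "i \<in> {1..N}"
    show "unitary_rep \<Gamma> GW.T (\<lambda>g. GW.pt (group_elem g) (nu i g))"
      unfolding unitary_rep_def using i
      by (simp add: GW.pt_star GW.pt_mult GW.pt_one elem_rep(1) nu_rep flip: elem_rep(2-4))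
  next
    fix i j g assume "i \<in> {1..N}" "j \<in> {1..N}" "g \<in> \<Lambda>"
    then show "GW.pt (group_elem g) (nu i g) = GW.pt (group_elem g) (nu j g)"
      using nu_agree by metis
  next
    show "magic GW.T N (\<lambda>i j. GW.pt \<one>\<^bsub>CG\<^esub> (W.p i j))"
      by (rule star_alg_hom.magic_hom[OF star_alg_homI[OF WA.star_alg_axioms GW.T.star_alg_axioms
          GW.star_hom_right] D(3)])
  next
    fix i j g assume ijg: "i \<in> {1..N}" "j \<in> {1..N}" "g \<in> carrier \<Gamma>"
    then show "GW.pt (group_elem g) (nu i g) \<otimes>\<^bsub>GW.T\<^esub> GW.pt \<one>\<^bsub>CG\<^esub> (W.p i j)
      = GW.pt \<one>\<^bsub>CG\<^esub> (W.p i j) \<otimes>\<^bsub>GW.T\<^esub> GW.pt (group_elem g) (nu i g)"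
      using D(4)[OF ijg] by (simp add: GW.pt_mult elem_rep(1))
  qed
qed blast

lemma lam_mult: "g \<in> carrier \<Gamma> \<Longrightarrow> h \<in> carrier \<Gamma> \<Longrightarrow> lam g \<otimes>\<^bsub>WA\<^esub> lam h = lam (g \<otimes> h)"
  by (simp add: nu_rep(4)[OF one_in])

text \<open>Normality enters the commutation rule for homogeneous elements here.\<close>

lemma conj_subgroup: "l \<in> \<Lambda> \<Longrightarrow> g \<in> carrier \<Gamma> \<Longrightarrow> inv g \<otimes> l \<otimes> g \<in> \<Lambda>"
  by (rule inv_op_closed1)

end

text \<open>
  \<open>\<gamma>\<close> records the \<open>\<Gamma>\<close>-degree and \<open>\<alpha>\<close> is its composite with \<open>id \<otimes> \<pi>\<^sub>2\<close>.
\<close>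

locale graded_wreath = normal_wreath \<Lambda> \<Gamma> N
  for \<Lambda> and \<Gamma> :: "('g, 'c) monoid_scheme" (structure) and N +
  fixes \<gamma> \<alpha>
  assumes \<gamma>: "star_hom WA GW.T \<gamma>"
    "\<And>i g. i \<in> {1..N} \<Longrightarrow> g \<in> carrier \<Gamma> \<Longrightarrow> \<gamma> (nu i g) = GW.pt (group_elem g) (nu i g)"
    "\<And>i j. i \<in> {1..N} \<Longrightarrow> j \<in> {1..N} \<Longrightarrow> \<gamma> (W.p i j) = GW.pt \<one>\<^bsub>CG\<^esub> (W.p i j)"
  assumes \<alpha>: "star_hom WA GQ.T \<alpha>"
    "\<And>i g. i \<in> {1..N} \<Longrightarrow> g \<in> carrier \<Gamma> \<Longrightarrow> \<alpha> (nu i g) = GQ.pt (group_elem g) (Q.nu i (coset g))"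
    "\<And>i j. i \<in> {1..N} \<Longrightarrow> j \<in> {1..N} \<Longrightarrow> \<alpha> (W.p i j) = GQ.pt \<one>\<^bsub>CG\<^esub> (Q.p i j)"
begin

text \<open>The degree condition is bundled with the value of \<open>\<alpha>\<close> and with the
  rule for moving \<Lambda> past the element. All three survive products, adjoints and scaling, so
  it is enough to know them on generators.\<close>

definition homogeneous :: "'g \<Rightarrow> 'g wreath_elem \<Rightarrow> bool"
  where "homogeneous g a \<longleftrightarrow> g \<in> carrier \<Gamma> \<and> a \<in> carrier WA \<and>
    \<gamma> a = GW.pt (group_elem g) a \<and> \<alpha> a = GQ.pt (group_elem g) (\<pi>2 a) \<and>
    (\<forall>l\<in>\<Lambda>. lam l \<otimes>\<^bsub>WA\<^esub> a = a \<otimes>\<^bsub>WA\<^esub> lam (inv g \<otimes> l \<otimes> g))"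

lemma homogeneousD:
  assumes "homogeneous g a"
  shows "g \<in> carrier \<Gamma>" "a \<in> carrier WA" "\<gamma> a = GW.pt (group_elem g) a" "\<alpha> a
      = GQ.pt (group_elem g) (\<pi>2 a)"
    "l \<in> \<Lambda> \<Longrightarrow> lam l \<otimes>\<^bsub>WA\<^esub> a = a \<otimes>\<^bsub>WA\<^esub> lam (inv g \<otimes> l \<otimes> g)"
  using assms unfolding homogeneous_def by auto

text \<open>Moving an element of \<Lambda> past a and then past b conjugates it by g and then by h,
  that is, by the product of the degrees.\<close>

lemma homogeneous_mult:
  assumes "homogeneous g a" "homogeneous h b" shows "homogeneous (g \<otimes> h) (a \<otimes>\<^bsub>WA\<^esub> b)"
  unfolding homogeneous_def
proof (intro conjI ballI)
  note a = homogeneousD[OF assms(1)] and b = homogeneousD[OF assms(2)]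
  show "g \<otimes> h \<in> carrier \<Gamma>" "a \<otimes>\<^bsub>WA\<^esub> b \<in> carrier WA" using a b by auto
  show "\<gamma> (a \<otimes>\<^bsub>WA\<^esub> b) = GW.pt (group_elem (g \<otimes> h)) (a \<otimes>\<^bsub>WA\<^esub> b)"
    using a b by (simp add: star_hom_mult[OF \<gamma>(1)] GW.pt_mult elem_rep)
  show "\<alpha> (a \<otimes>\<^bsub>WA\<^esub> b) = GQ.pt (group_elem (g \<otimes> h)) (\<pi>2 (a \<otimes>\<^bsub>WA\<^esub> b))"
    using a b by (simp add: star_hom_mult[OF \<alpha>(1)] GQ.pt_mult elem_rep \<pi>2.hom_mult)
  fix l assume l: "l \<in> \<Lambda>"
  have l': "l \<in> carrier \<Gamma>" using l subset by auto
  have "lam l \<otimes>\<^bsub>WA\<^esub> (a \<otimes>\<^bsub>WA\<^esub> b) = a \<otimes>\<^bsub>WA\<^esub> (lam (inv g \<otimes> l \<otimes> g) \<otimes>\<^bsub>WA\<^esub> b)"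
    using a(1,2) b(1,2) l' by (simp add: a(5)[OF l] flip: WA.m_assoc)
  also have "\<dots> = (a \<otimes>\<^bsub>WA\<^esub> b) \<otimes>\<^bsub>WA\<^esub> lam (inv h \<otimes> (inv g \<otimes> l \<otimes> g) \<otimes> h)"
    using a(1,2) b(1,2) l' by (simp add: b(5)[OF conj_subgroup[OF l a(1)]] WA.m_assoc)
  also have "inv h \<otimes> (inv g \<otimes> l \<otimes> g) \<otimes> h = inv (g \<otimes> h) \<otimes> l \<otimes> (g \<otimes> h)"
    using a(1) b(1) l' by (simp add: inv_mult_group m_assoc)
  finally show "lam l \<otimes>\<^bsub>WA\<^esub> (a \<otimes>\<^bsub>WA\<^esub> b) = (a \<otimes>\<^bsub>WA\<^esub> b) \<otimes>\<^bsub>WA\<^esub> lam (inv (g \<otimes> h) \<otimes> l \<otimes> (g \<otimes> h))" .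
qed

lemma homogeneous_star:
  assumes "homogeneous g a" shows "homogeneous (inv g) (star WA a)"
  unfolding homogeneous_def
proof (intro conjI ballI)
  note a = homogeneousD[OF assms]
  show "inv g \<in> carrier \<Gamma>" "star WA a \<in> carrier WA" using a by auto
  show "\<gamma> (star WA a) = GW.pt (group_elem (inv g)) (star WA a)"
    using a by (simp add: star_hom_star[OF \<gamma>(1)] GW.pt_star elem_rep)
  show "\<alpha> (star WA a) = GQ.pt (group_elem (inv g)) (\<pi>2 (star WA a))"
    using a by (simp add: star_hom_star[OF \<alpha>(1)] GQ.pt_star elem_rep \<pi>2.hom_star)
  fix l assume l: "l \<in> \<Lambda>"
  have l': "l \<in> carrier \<Gamma>" using l subset by auto
  \<comment> \<open>Chosen so that conjugation by g turns \<open>?m\<close> into the inverse of l.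
    The adjoint of the rule for \<open>?m\<close> and a is then the rule for l and the adjoint of
    a.\<close>
  let ?m = "g \<otimes> inv l \<otimes> inv g"
  have m: "?m \<in> \<Lambda>" using inv_op_closed2[OF a(1), of "inv l"] l by simp
  have "inv g \<otimes> ?m \<otimes> g = inv l" using a(1) l' by (simp add: m_assoc) (simp add: inv_solve_left'
      flip: m_assoc)
  then have "lam ?m \<otimes>\<^bsub>WA\<^esub> a = a \<otimes>\<^bsub>WA\<^esub> lam (inv l)" using a(5)[OF m] by simp
  from arg_cong[OF this, of "star WA"]
  have "star WA a \<otimes>\<^bsub>WA\<^esub> lam (inv ?m) = lam l \<otimes>\<^bsub>WA\<^esub> star WA a"
    using a(1,2) l' nu_rep(2)[OF one_in, of "inv l"] nu_rep(2)[OF one_in, of ?m] by (simp add: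
        WA.star_mult)
  moreover have "inv ?m = inv (inv g) \<otimes> l \<otimes> inv g" using a(1) l' by (simp add: inv_mult_group
      m_assoc)
  ultimately show "lam l \<otimes>\<^bsub>WA\<^esub> star WA a = star WA a \<otimes>\<^bsub>WA\<^esub> lam (inv (inv g) \<otimes> l \<otimes> inv g)" by simp
qed

text \<open>An element of \<Lambda> may be read in copy i, where moving it past g is the identity l
  g = g (g^-1 l g). The conjugate is again in \<Lambda> and can be read back in copy 1.\<close>

lemma homogeneous_nu: "i \<in> {1..N} \<Longrightarrow> g \<in> carrier \<Gamma> \<Longrightarrow> homogeneous g (nu i g)"
  unfolding homogeneous_def
proof (intro conjI ballI)
  fix l assume ig: "i \<in> {1..N}" "g \<in> carrier \<Gamma>" and l: "l \<in> \<Lambda>"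
  then have l': "l \<in> carrier \<Gamma>" using subset by auto
  have "lam l \<otimes>\<^bsub>WA\<^esub> nu i g = nu i (l \<otimes> g)"
    unfolding nu_agree[OF one_in ig(1) l] using ig l' by (simp add: nu_rep(4)[OF ig(1)])
  also have "l \<otimes> g = g \<otimes> (inv g \<otimes> l \<otimes> g)" using ig l' by (simp flip: m_assoc)
  also have "nu i \<dots> = nu i g \<otimes>\<^bsub>WA\<^esub> nu i (inv g \<otimes> l \<otimes> g)"
      using ig l' by (simp add: nu_rep(4)[OF ig(1)])
  also have "nu i (inv g \<otimes> l \<otimes> g) = lam (inv g \<otimes> l \<otimes> g)"
    by (rule nu_agree[OF ig(1) one_in conj_subgroup[OF l ig(2)]])
  finally show "lam l \<otimes>\<^bsub>WA\<^esub> nu i g = nu i g \<otimes>\<^bsub>WA\<^esub> lam (inv g \<otimes> l \<otimes> g)" .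
qed (simp_all add: \<gamma>(2) \<alpha>(2) wreath_to_quotient(2))

lemma homogeneous_p: "i \<in> {1..N} \<Longrightarrow> j \<in> {1..N} \<Longrightarrow> homogeneous \<one> (W.p i j)"
  unfolding homogeneous_def
proof (intro conjI ballI)
  fix l assume ij: "i \<in> {1..N}" "j \<in> {1..N}" and l: "l \<in> \<Lambda>"
  then have l': "l \<in> carrier \<Gamma>" using subset by auto
  \<comment> \<open>Reading l in the copy given by the row index i, where it commutes with the entry
    by the defining relation.\<close>
  show "lam l \<otimes>\<^bsub>WA\<^esub> W.p i j = W.p i j \<otimes>\<^bsub>WA\<^esub> lam (inv \<one> \<otimes> l \<otimes> \<one>)"
    using wreath_dataD(4)[OF W.wreath_data_W ij l'] nu_agree[OF one_in ij(1) l] l' by simp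
qed (simp_all add: \<gamma>(3) \<alpha>(3) wreath_to_quotient(3) elem_rep(3))

lemma homogeneous_one: "homogeneous \<one> \<one>\<^bsub>WA\<^esub>"
  using homogeneous_nu[OF one_in one_closed] by (simp add: nu_rep(3)[OF one_in])

lemma homogeneous_smult:
  assumes "homogeneous g a" shows "homogeneous g (c \<odot>\<^bsub>WA\<^esub> a)"
proof -
  note a = homogeneousD[OF assms]
  have "inv g \<otimes> l \<otimes> g \<in> carrier \<Gamma>" if "l \<in> \<Lambda>" for l using that a(1) subset by auto
  then show ?thesis
    unfolding homogeneous_def using a subset
    by (auto simp: star_hom_smult[OF \<gamma>(1)] star_hom_smult[OF \<alpha>(1)] GW.pt_smult_right
        GQ.pt_smult_right
        elem_rep(1) \<pi>2.hom_smult WA.mult_smult WA.smult_mult)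
qed

text \<open>The algebra is the sum of its homogeneous parts: finite sums of homogeneous elements
  form a star subalgebra that contains the generators. Directness of the sum is not
  asserted.\<close>

lemma homogeneous_span_induct [consumes 1, case_names homogeneous add]:
  assumes "x \<in> carrier WA" "\<And>g a. homogeneous g a \<Longrightarrow> P a"
    "\<And>x y. x \<in> carrier WA \<Longrightarrow> y \<in> carrier WA \<Longrightarrow> P x \<Longrightarrow> P y \<Longrightarrow> P (x \<oplus>\<^bsub>WA\<^esub> y)"
  shows "P x"
proof -
  \<comment> \<open>The additive closure of the homogeneous elements, as the set of elements
    satisfying every predicate that holds on homogeneous elements and passes to sums.\<close>
  define S where "S = {x. \<forall>P. (\<forall>g a. homogeneous g a \<longrightarrow> P a) \<longrightarrow>
    (\<forall>x y. x \<in> carrier WA \<longrightarrow> y \<in> carrier WA \<longrightarrow> P x \<longrightarrow> P y \<longrightarrow> P (x \<oplus>\<^bsub>WA\<^esub> y)) \<longrightarrow> P x}"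
  have SI: "a \<in> S" if "homogeneous g a" for g a using that unfolding S_def by blast
  have S_ind: "P x" if "x \<in> S" "\<And>g a. homogeneous g a \<Longrightarrow> P a"
    "\<And>x y. x \<in> carrier WA \<Longrightarrow> y \<in> carrier WA \<Longrightarrow> P x \<Longrightarrow> P y \<Longrightarrow> P (x \<oplus>\<^bsub>WA\<^esub> y)" for x P
    using that unfolding S_def by blast
  have S_closed: "x \<in> carrier WA" if "x \<in> S" for x
    using that by (rule S_ind) (auto dest: homogeneousD)
  have S_add: "x \<oplus>\<^bsub>WA\<^esub> y \<in> S" if "x \<in> S" "y \<in> S" for x y
    using that S_closed[OF that(1)] S_closed[OF that(2)] unfolding S_def by blast
  \<comment> \<open>Products are treated in two stages, with a homogeneous right factor and then
    with an arbitrary one, so that each induction varies one factor.\<close>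
  have S_mult_hom: "x \<otimes>\<^bsub>WA\<^esub> b \<in> S" if "x \<in> S" "homogeneous h b" for x b h
  proof -
    have "x \<in> carrier WA \<and> x \<otimes>\<^bsub>WA\<^esub> b \<in> S"
      using that(1)
    proof (rule S_ind)
      fix x y assume "x \<in> carrier WA \<and> x \<otimes>\<^bsub>WA\<^esub> b \<in> S" "y \<in> carrier WA \<and> y \<otimes>\<^bsub>WA\<^esub> b \<in> S"
      then show "x \<oplus>\<^bsub>WA\<^esub> y \<in> carrier WA \<and> (x \<oplus>\<^bsub>WA\<^esub> y) \<otimes>\<^bsub>WA\<^esub> b \<in> S"
        using S_add homogeneousD(2)[OF that(2)] by (simp add: WA.l_distr)
    qed (use SI[OF homogeneous_mult[OF _ that(2)]] homogeneousD(2) in blast)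
    then show ?thesis ..
  qed
  have S_mult: "x \<otimes>\<^bsub>WA\<^esub> y \<in> S" if "x \<in> S" "y \<in> S" for x y
  proof -
    have "y \<in> carrier WA \<and> x \<otimes>\<^bsub>WA\<^esub> y \<in> S"
      using that(2)
    proof (rule S_ind)
      fix y z assume "y \<in> carrier WA \<and> x \<otimes>\<^bsub>WA\<^esub> y \<in> S" "z \<in> carrier WA \<and> x \<otimes>\<^bsub>WA\<^esub> z \<in> S"
      then show "y \<oplus>\<^bsub>WA\<^esub> z \<in> carrier WA \<and> x \<otimes>\<^bsub>WA\<^esub> (y \<oplus>\<^bsub>WA\<^esub> z) \<in> S"
        using S_add S_closed[OF that(1)] by (simp add: WA.r_distr)
    qed (use S_mult_hom[OF that(1)] homogeneousD(2) in blast)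
    then show ?thesis ..
  qed
  have S_smult: "c \<odot>\<^bsub>WA\<^esub> x \<in> S" if "x \<in> S" for c x
  proof -
    have "x \<in> carrier WA \<and> c \<odot>\<^bsub>WA\<^esub> x \<in> S"
      using that by (rule S_ind) (use SI[OF homogeneous_smult] homogeneousD(2) S_add in \<open>auto
          simp: WA.smult_add\<close>)
    then show ?thesis ..
  qed
  have S_star: "star WA x \<in> S" if "x \<in> S" for x
  proof -
    have "x \<in> carrier WA \<and> star WA x \<in> S"
      using that by (rule S_ind) (use SI[OF homogeneous_star] homogeneousD(2) S_add in \<open>auto simp:
          WA.star_add\<close>)
    then show ?thesis ..
  qed
  have "x \<in> star_span WA W.wreath_gens" using assms(1) W.wreath_span by blast
  then have "x \<in> S"
  proof (induction rule: star_span.induct)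
    case (gen x) then show ?case using SI[OF homogeneous_nu] SI[OF homogeneous_p] by auto
  next
    case one then show ?case using SI[OF homogeneous_one] .
  qed (use S_add S_mult S_smult S_star in auto)
  from S_ind[of x P, OF this assms(2,3)] show ?thesis .
qed

end

lemma (in group) lin_ext_linear:
  assumes "star_alg B" "\<And>g. g \<in> carrier G \<Longrightarrow> b g \<in> carrier B"
  shows "linear_map (group_algebra G) B (star_alg.lin_ext B b)"
proof -
  interpret B: star_alg B by fact
  have Pi: "b \<in> carrier G \<rightarrow> carrier B" using assms(2) by auto
  show ?thesis
    using B.lin_ext_closed[OF Pi] B.lin_ext_add[OF Pi] B.lin_ext_scale[OF Pi]
    by (simp add: linear_map_def group_algebra_def monoid_star_algebra_def)
qed

section \<open>Coset representatives and the map L\<close>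

context graded_wreath begin

definition rep where "rep X = (SOME x. x \<in> X)"

abbreviation s where "s g \<equiv> rep (coset g)"

lemma s_closed: 
  assumes "g \<in> carrier \<Gamma>" shows "s g \<in> carrier \<Gamma>" "inv g \<otimes> s g \<in> \<Lambda>" "inv (s g) \<otimes> g \<in> \<Lambda>"
proof -
  have "s g \<in> coset g" unfolding rep_def by (rule someI[of _ g]) (rule rcos_self[OF assms
      subgroup_axioms])
  then obtain l where l: "l \<in> \<Lambda>" "s g = l \<otimes> g" by (auto simp: r_coset_def)
  then have l': "l \<in> carrier \<Gamma>" using subset by auto
  show 1: "s g \<in> carrier \<Gamma>" using l l' assms by simp
  show 2: "inv g \<otimes> s g \<in> \<Lambda>" using conj_subgroup[OF l(1) assms] l(2) l' assms by (simp add: m_assoc)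
  have "inv (s g) \<otimes> g = inv (inv g \<otimes> s g)" using 1 assms by (simp add: inv_mult_group)
  then show "inv (s g) \<otimes> g \<in> \<Lambda>" using 2 by simp
qed

text \<open>The representative depends only on the coset, and in \<Gamma>/\<Lambda> the factor l
  disappears even from the middle of a product.\<close>

lemma s_insert:
  assumes "g \<in> carrier \<Gamma>" "h \<in> carrier \<Gamma>" "l \<in> \<Lambda>" shows "s (g \<otimes> l \<otimes> h) = s (g \<otimes> h)"
proof -
  have l: "l \<in> carrier \<Gamma>" using assms subset by auto
  have "coset (g \<otimes> l \<otimes> h) = coset g \<otimes>\<^bsub>\<Theta>\<^esub> coset l \<otimes>\<^bsub>\<Theta>\<^esub> coset h"
    using assms l by (simp add: coset_mult del: mult_FactGroup)
  also have "\<dots> = coset (g \<otimes> h)"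
    using assms by (simp add: coset_subgroup coset_mult Q.r_one del: mult_FactGroup)
  finally show ?thesis by simp
qed

text \<open>
  The twist moves all degrees of one coset of \<open>\<Lambda>\<close> to a common degree, so that \<open>L\<close> does not see the
  difference between \<open>x \<lambda> y\<close> and \<open>x y\<close> for \<open>\<lambda> \<in> \<Lambda>\<close>.
\<close>

lemma coset_functional:
  obtains L where "linear_map WA WA L"
    "\<And>g a. homogeneous g a \<Longrightarrow> L a = a \<otimes>\<^bsub>WA\<^esub> lam (inv g \<otimes> s g)"
proof -
  \<comment> \<open>The twist depends on the degree, which \<open>\<gamma>\<close> displays in the
    first tensor factor. Thus \<open>L\<close> is \<open>\<gamma>\<close> followed by the linear map
    c \<otimes> x \<mapsto> x \<open>?\<psi>\<close>(c), which makes sense for inhomogeneous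
    elements too.\<close>
  let ?\<psi> = "WA.lin_ext (\<lambda>g. lam (inv g \<otimes> s g))"
  have \<psi>: "linear_map CG WA ?\<psi>"
    by (rule lin_ext_linear[OF WA.star_alg_axioms]) (simp add: s_closed)
  have "bilinear_map CG WA WA (\<lambda>c x. x \<otimes>\<^bsub>WA\<^esub> ?\<psi> c)"
    unfolding bilinear_map_def
    by (simp add: linear_mapD[OF \<psi>] WA.l_distr WA.r_distr WA.smult_mult WA.mult_smult)
  then obtain h where h: "linear_map GW.T WA h"
    "\<And>c x. c \<in> carrier CG \<Longrightarrow> x \<in> carrier WA \<Longrightarrow> h (GW.pt c x) = x \<otimes>\<^bsub>WA\<^esub> ?\<psi> c"
    by (rule GW.tensor_linear_universal[OF WA.star_alg_axioms]) blast
  note \<gamma>' = star_homD[OF \<gamma>(1)]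
  have "linear_map WA WA (\<lambda>x. h (\<gamma> x))"
    unfolding linear_map_def by (simp add: \<gamma>' linear_mapD[OF h(1)])
  then show thesis
  proof (rule that)
    fix g a assume "homogeneous g a"
    note a = homogeneousD[OF this]
    show "h (\<gamma> a) = a \<otimes>\<^bsub>WA\<^esub> lam (inv g \<otimes> s g)"
      unfolding a(3) using a(1,2) by (simp add: h(2) elem_rep(1) s_closed)
  qed
qed

section \<open>The kernel of the map onto the wreath product of \<Gamma>/\<Lambda>\<close>

definition subgroup_rels where "subgroup_rels = (\<lambda>l. lam l \<ominus>\<^bsub>WA\<^esub> \<one>\<^bsub>WA\<^esub>) ` \<Lambda>"

lemma subgroup_rels_closed: "subgroup_rels \<subseteq> carrier WA"
  unfolding subgroup_rels_def using subset by auto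

text \<open>The adjoint of \<lambda> - 1 is \<lambda>^-1 - 1.\<close>

lemma star_subgroup_rels: "star WA ` subgroup_rels \<subseteq> subgroup_rels"
proof -
  have "star WA (lam l \<ominus>\<^bsub>WA\<^esub> \<one>\<^bsub>WA\<^esub>) = lam (inv l) \<ominus>\<^bsub>WA\<^esub> \<one>\<^bsub>WA\<^esub>" if "l \<in> \<Lambda>" for l
    using that subset by (auto simp: WA.star_diff nu_rep(2)[OF one_in])
  then show ?thesis unfolding subgroup_rels_def by force
qed

sublocale SR: star_presentation WA subgroup_rels
  by unfold_locales (rule subgroup_rels_closed)

text \<open>The map \<open>L\<close> is not multiplicative, so its kernel has to be tested against
  products from both sides: it suffices that x \<lambda> y and x y have the same image for all x, y
  and all \<lambda> in \<Lambda>.\<close>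

lemma functional_vanishes:
  assumes L: "linear_map WA WA L" "\<And>g a. homogeneous g a \<Longrightarrow> L a = a \<otimes>\<^bsub>WA\<^esub> lam (inv g \<otimes> s g)"
    and x: "x \<in> star_ideal WA subgroup_rels"
  shows "L x = \<zero>\<^bsub>WA\<^esub>"
proof -
  note Ll = linear_mapD[OF L(1)]
  have L0: "L \<zero>\<^bsub>WA\<^esub> = \<zero>\<^bsub>WA\<^esub>" using Ll(3)[OF WA.zero_closed, of 0] Ll(1)[OF WA.zero_closed] by simp
  \<comment> \<open>By linearity x and y may be taken homogeneous, of degrees g and h. The degrees g
    l h and g h then share their coset representative, and only the twisting elements have to be
    compared.\<close>
  have swap: "L (x \<otimes>\<^bsub>WA\<^esub> (lam l \<otimes>\<^bsub>WA\<^esub> y)) = L (x \<otimes>\<^bsub>WA\<^esub> y)"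
    if l: "l \<in> \<Lambda>" and x: "x \<in> carrier WA" and y: "y \<in> carrier WA" for l x y
    using x
  proof (induction rule: homogeneous_span_induct)
    case (homogeneous g x)
    have l': "l \<in> carrier \<Gamma>" using l subset by auto
    from y show ?case
    proof (induction rule: homogeneous_span_induct)
      case (homogeneous h y)
      note X = homogeneousD[OF \<open>homogeneous g x\<close>] and Y = homogeneousD[OF homogeneous]
      have "homogeneous (g \<otimes> (l \<otimes> h)) (x \<otimes>\<^bsub>WA\<^esub> (lam l \<otimes>\<^bsub>WA\<^esub> y))"
        by (intro homogeneous_mult \<open>homogeneous g x\<close> homogeneous homogeneous_nu one_in l')
      then have "L (x \<otimes>\<^bsub>WA\<^esub> (lam l \<otimes>\<^bsub>WA\<^esub> y))
        = (x \<otimes>\<^bsub>WA\<^esub> (lam l \<otimes>\<^bsub>WA\<^esub> y)) \<otimes>\<^bsub>WA\<^esub> lam (inv (g \<otimes> l \<otimes> h) \<otimes> s (g \<otimes> l \<otimes> h))"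
        using L(2) X(1) Y(1) l' by (simp add: m_assoc)
      also have "\<dots> = (x \<otimes>\<^bsub>WA\<^esub> y) \<otimes>\<^bsub>WA\<^esub> (lam (inv h \<otimes> l \<otimes> h) \<otimes>\<^bsub>WA\<^esub> lam (inv (g \<otimes> l \<otimes> h) \<otimes> s (g \<otimes> h)))"
        unfolding Y(5)[OF l] s_insert[OF X(1) Y(1) l]
        using X(1,2) Y(1,2) l' by (simp add: WA.m_assoc s_closed)
      also have "lam (inv h \<otimes> l \<otimes> h) \<otimes>\<^bsub>WA\<^esub> lam (inv (g \<otimes> l \<otimes> h) \<otimes> s (g \<otimes> h))
        = lam (inv h \<otimes> l \<otimes> h \<otimes> (inv (g \<otimes> l \<otimes> h) \<otimes> s (g \<otimes> h)))"
        using X(1) Y(1) l' by (intro lam_mult) (simp_all add: s_closed)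
      \<comment> \<open>Moving l to the right of y produces h^-1 l h, which cancels the l contained
        in the inverse of g l h.\<close>
      also have "inv h \<otimes> l \<otimes> h \<otimes> (inv (g \<otimes> l \<otimes> h) \<otimes> s (g \<otimes> h)) = inv (g \<otimes> h) \<otimes> s (g \<otimes> h)"
      proof -
        have "inv h \<otimes> l \<otimes> h \<otimes> inv (g \<otimes> l \<otimes> h) = inv (g \<otimes> h)"
          using X(1) Y(1) l' by (simp add: inv_mult_group m_assoc) (simp flip: m_assoc)
        then show ?thesis using X(1) Y(1) l' by (simp add: s_closed flip: m_assoc)
      qed
      also have "(x \<otimes>\<^bsub>WA\<^esub> y) \<otimes>\<^bsub>WA\<^esub> lam (inv (g \<otimes> h) \<otimes> s (g \<otimes> h)) = L (x \<otimes>\<^bsub>WA\<^esub> y)"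
        using L(2)[OF homogeneous_mult[OF \<open>homogeneous g x\<close> homogeneous]] by simp
      finally show ?case .
    next
      case (add y z)
      then show ?case using homogeneousD(2)[OF homogeneous] l' by (simp add: WA.r_distr Ll)
    qed
  next
    case (add x z)
    then show ?case using y l subset by (auto simp: WA.l_distr Ll)
  qed
  \<comment> \<open>The largest two-sided ideal on which \<open>L\<close> vanishes; surrounding x by
    arbitrary factors builds in the ideal property.\<close>
  let ?K = "{x \<in> carrier WA. \<forall>a\<in>carrier WA. \<forall>b\<in>carrier WA. L (a \<otimes>\<^bsub>WA\<^esub> (x \<otimes>\<^bsub>WA\<^esub> b)) = \<zero>\<^bsub>WA\<^esub>}"
  have "ideal ?K WA"
  proof (rule WA.ideal_by_closure)
    fix a x assume a: "a \<in> ?K" and x: "x \<in> carrier WA"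
    have "L (c \<otimes>\<^bsub>WA\<^esub> ((x \<otimes>\<^bsub>WA\<^esub> a) \<otimes>\<^bsub>WA\<^esub> b)) = L ((c \<otimes>\<^bsub>WA\<^esub> x) \<otimes>\<^bsub>WA\<^esub> (a \<otimes>\<^bsub>WA\<^esub> b))"
      if "b \<in> carrier WA" "c \<in> carrier WA" for b c
      using a x that by (simp add: WA.m_assoc)
    then show "x \<otimes>\<^bsub>WA\<^esub> a \<in> ?K" using a x by simp
    show "a \<otimes>\<^bsub>WA\<^esub> x \<in> ?K" using a x by (simp add: WA.m_assoc)
  qed (auto simp: L0 WA.l_distr WA.r_distr Ll)
  moreover have K: "subgroup_rels \<subseteq> ?K"
  proof -
    have "L (a \<otimes>\<^bsub>WA\<^esub> ((lam l \<ominus>\<^bsub>WA\<^esub> \<one>\<^bsub>WA\<^esub>) \<otimes>\<^bsub>WA\<^esub> b)) = \<zero>\<^bsub>WA\<^esub>" if "l \<in> \<Lambda>" "a \<in> carrier WA" "b \<in> carrier WA"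
        for l a b
    proof -
      have l: "lam l \<in> carrier WA" using that(1) subset by auto
      have "a \<otimes>\<^bsub>WA\<^esub> (lam l \<otimes>\<^bsub>WA\<^esub> b) = a \<otimes>\<^bsub>WA\<^esub> ((lam l \<ominus>\<^bsub>WA\<^esub> \<one>\<^bsub>WA\<^esub>) \<otimes>\<^bsub>WA\<^esub> b) \<oplus>\<^bsub>WA\<^esub> a \<otimes>\<^bsub>WA\<^esub> b"
        using l that by algebra
      then have "L (a \<otimes>\<^bsub>WA\<^esub> ((lam l \<ominus>\<^bsub>WA\<^esub> \<one>\<^bsub>WA\<^esub>) \<otimes>\<^bsub>WA\<^esub> b)) \<oplus>\<^bsub>WA\<^esub> L (a \<otimes>\<^bsub>WA\<^esub> b) = L (a \<otimes>\<^bsub>WA\<^esub> b)"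
        using swap[OF that] l that by (simp add: Ll)
      then show ?thesis using l that Ll(1) by (simp add: WA.add.l_cancel_one)
    qed
    then show ?thesis using subgroup_rels_closed unfolding subgroup_rels_def by blast
  qed
  moreover have "star WA ` subgroup_rels \<subseteq> ?K" using K star_subgroup_rels by blast
  ultimately have "star_ideal WA subgroup_rels \<subseteq> ?K" by (rule WA.star_ideal_minimal)
  then have "x \<in> ?K" using x by blast
  then have "L (\<one>\<^bsub>WA\<^esub> \<otimes>\<^bsub>WA\<^esub> (x \<otimes>\<^bsub>WA\<^esub> \<one>\<^bsub>WA\<^esub>)) = \<zero>\<^bsub>WA\<^esub>" "x \<in> carrier WA" by blast+
  then show ?thesis by simp
qed

text \<open>Modulo the relations \<lambda> = 1, the values of \<open>nu i\<close> depend on cosets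
  only. The universal property of the wreath product over \<Gamma>/\<Lambda> therefore gives a map
  \<open>\<rho>\<close> back to this quotient, and \<open>\<rho>\<close> after \<open>\<pi>2\<close>
  is the quotient map.\<close>

lemma kernel_wreath_to_quotient:
  assumes x: "x \<in> carrier WA" and "\<pi>2 x = \<zero>\<^bsub>QA\<^esub>"
  shows "x \<in> star_ideal WA subgroup_rels"
proof -
  interpret S: star_alg SR.Q by (rule SR.quot_star_alg)
  interpret cls: star_alg_hom WA SR.Q SR.cls by unfold_locales (rule SR.star_hom_cls)
  note D = wreath_dataD[OF W.wreath_data_W]
  have cls_lam: "SR.cls (lam l) = \<one>\<^bsub>SR.Q\<^esub>" if "l \<in> \<Lambda>" for l
  proof -
    have l: "lam l \<in> carrier WA" using that subset by auto
    have "SR.cls (lam l \<ominus>\<^bsub>WA\<^esub> \<one>\<^bsub>WA\<^esub>) = \<zero>\<^bsub>SR.Q\<^esub>"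
      by (rule SR.cls_rel) (use that in \<open>simp add: subgroup_rels_def\<close>)
    then show ?thesis using l by (simp add: cls.hom_diff S.diff_eq_zero_iff)
  qed
  \<comment> \<open>The correcting factor g^-1 s(g) lies in \<Lambda> and becomes the unit in the
    quotient, so the choice of representative leaves no trace there.\<close>
  have key: "SR.cls (nu i (s g)) = SR.cls (nu i g)" if "i \<in> {1..N}" "g \<in> carrier \<Gamma>" for i g
  proof -
    note sg = s_closed[OF that(2)]
    have "nu i (s g) = nu i g \<otimes>\<^bsub>WA\<^esub> nu i (inv g \<otimes> s g)"
      using that sg by (simp flip: nu_rep(4) add: m_assoc[symmetric])
    also have "nu i (inv g \<otimes> s g) = lam (inv g \<otimes> s g)" by (rule nu_agree[OF that(1) one_in sg(2)])
    finally show ?thesis using that sg cls_lam[OF sg(2)] by (simp add: cls.hom_mult)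
  qed
  have "wreath_data SR.Q \<Theta> {\<one>\<^bsub>\<Theta>\<^esub>} N (\<lambda>i X. SR.cls (nu i (rep X))) (\<lambda>i j. SR.cls (W.p i j))"
    unfolding wreath_data_def
  proof (intro conjI ballI)
    fix i assume i: "i \<in> {1..N}"
    have u: "unitary_rep \<Gamma> SR.Q (\<lambda>g. SR.cls (nu i g))"
      by (rule unitary_rep_hom[OF D(1)[OF i] SR.star_hom_cls])
    note u = unitary_repD[OF u]
    show "unitary_rep \<Theta> SR.Q (\<lambda>X. SR.cls (nu i (rep X)))"
      unfolding unitary_rep_def
    proof (intro conjI ballI)
      fix X assume "X \<in> carrier \<Theta>"
      then obtain g where g: "g \<in> carrier \<Gamma>" "X = coset g" by (auto simp: carrier_FactGroup)
      show "SR.cls (nu i (rep X)) \<in> carrier SR.Q"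
        unfolding g(2) key[OF i g(1)] by (rule u(1)[OF g(1)])
      show "SR.cls (nu i (rep (inv\<^bsub>\<Theta>\<^esub> X))) = star SR.Q (SR.cls (nu i (rep X)))"
        unfolding g(2) coset_inv[OF g(1)] key[OF i g(1)] key[OF i inv_closed[OF g(1)]]
            by (rule u(2)[OF g(1)])
      fix Y assume "Y \<in> carrier \<Theta>"
      then obtain h where h: "h \<in> carrier \<Gamma>" "Y = coset h" by (auto simp: carrier_FactGroup)
      show "SR.cls (nu i (rep (X \<otimes>\<^bsub>\<Theta>\<^esub> Y))) = SR.cls (nu i (rep X)) \<otimes>\<^bsub>SR.Q\<^esub> SR.cls (nu i (rep Y))"
        unfolding g(2) h(2) coset_mult[OF g(1) h(1)] key[OF i g(1)] key[OF i h(1)]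
            key[OF i m_closed[OF g(1) h(1)]]
        by (rule u(4)[OF g(1) h(1)])
    next
      have "\<one>\<^bsub>\<Theta>\<^esub> = coset \<one>" by (rule coset_subgroup[symmetric]) (rule subgroup.one_closed[OF
          subgroup_axioms])
      then show "SR.cls (nu i (rep \<one>\<^bsub>\<Theta>\<^esub>)) = \<one>\<^bsub>SR.Q\<^esub>"
        using key[OF i one_closed] u(3) by simp
    qed
    fix j X assume j: "j \<in> {1..N}"
    { assume "X \<in> {\<one>\<^bsub>\<Theta>\<^esub>}"
      then have "X = coset \<one>"
        using coset_subgroup[OF subgroup.one_closed[OF subgroup_axioms]] by simp
      then show "SR.cls (nu i (rep X)) = SR.cls (nu j (rep X))"
        using key[OF i one_closed] key[OF j one_closed] nu_rep(3)[OF i] nu_rep(3)[OF j] by simp }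
    assume "X \<in> carrier \<Theta>"
    then obtain g where g: "g \<in> carrier \<Gamma>" "X = coset g" by (auto simp: carrier_FactGroup)
    show "SR.cls (nu i (rep X)) \<otimes>\<^bsub>SR.Q\<^esub> SR.cls (W.p i j)
        = SR.cls (W.p i j) \<otimes>\<^bsub>SR.Q\<^esub> SR.cls (nu i (rep X))"
      unfolding g(2) key[OF i g(1)] using D(4)[OF i j g(1)] i j g(1) by (simp flip: cls.hom_mult)
  next
    show "magic SR.Q N (\<lambda>i j. SR.cls (W.p i j))" by (rule cls.magic_hom[OF D(3)])
  qed
  then obtain \<rho> where \<rho>: "star_hom QA SR.Q \<rho>"
    "\<And>i X. i \<in> {1..N} \<Longrightarrow> X \<in> carrier \<Theta> \<Longrightarrow> \<rho> (Q.nu i X) = SR.cls (nu i (rep X))"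
    "\<And>i j. i \<in> {1..N} \<Longrightarrow> j \<in> {1..N} \<Longrightarrow> \<rho> (Q.p i j) = SR.cls (W.p i j)"
    by (rule Q.wreath_universal[OF SR.quot_star_alg]) blast
  interpret \<rho>: star_alg_hom QA SR.Q \<rho> by unfold_locales (rule \<rho>(1))
  have "\<rho> (\<pi>2 x) = SR.cls x"
    by (rule W.wreath_hom_unique[OF star_hom_comp[OF wreath_to_quotient(1) \<rho>(1)] SR.star_hom_cls _
        _ x])
      (simp_all add: wreath_to_quotient \<rho>(2,3) key)
  then have "SR.cls x = SR.cls \<zero>\<^bsub>WA\<^esub>" using assms(2) by simp
  then have "x \<ominus>\<^bsub>WA\<^esub> \<zero>\<^bsub>WA\<^esub> \<in> star_ideal WA subgroup_rels" using SR.cls_eq_iff x by blast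
  then show ?thesis using x by (simp add: a_minus_def)
qed

section \<open>Injectivity of \<alpha>\<close>

text \<open>A linear left inverse of \<open>\<alpha>\<close> is built on the tensor product and
  verified on homogeneous elements, which suffices because they span.\<close>

lemma degree_map_inj:
  assumes "x \<in> carrier WA" "y \<in> carrier WA" "\<alpha> x = \<alpha> y"
  shows "x = y"
proof -
  obtain L where L: "linear_map WA WA L" "\<And>g a. homogeneous g a \<Longrightarrow> L a = a \<otimes>\<^bsub>WA\<^esub> lam (inv g \<otimes> s g)"
    by (rule coset_functional) blast
  note Ll = linear_mapD[OF L(1)]
  have Ldiff: "L (a \<ominus>\<^bsub>WA\<^esub> b) = L a \<ominus>\<^bsub>WA\<^esub> L b" if "a \<in> carrier WA" "b \<in> carrier WA" for a b
    using that by (simp add: a_minus_def Ll flip: WA.minus_one_smult)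
  have Leq: "L a = L b" if "\<pi>2 a = \<pi>2 b" "a \<in> carrier WA" "b \<in> carrier WA" for a b
  proof -
    have "\<pi>2 (a \<ominus>\<^bsub>WA\<^esub> b) = \<zero>\<^bsub>QA\<^esub>" using that by (simp add: \<pi>2.hom_diff QA.diff_eq_zero_iff)
    then have "L (a \<ominus>\<^bsub>WA\<^esub> b) = \<zero>\<^bsub>WA\<^esub>"
      using functional_vanishes[OF L kernel_wreath_to_quotient] that by blast
    then show ?thesis using that by (simp add: Ldiff WA.diff_eq_zero_iff Ll)
  qed
  \<comment> \<open>\<open>L\<close> vanishes on the kernel of \<open>\<pi>2\<close>, so it factors
    as \<open>M\<close> after \<open>\<pi>2\<close>. Surjectivity of \<open>\<pi>2\<close> makes
    \<open>M\<close> linear on the whole target.\<close>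
  define M where "M y = L (SOME a. a \<in> carrier WA \<and> \<pi>2 a = y)" for y
  have M: "M (\<pi>2 a) = L a" if "a \<in> carrier WA" for a
  proof -
    have "(SOME b. b \<in> carrier WA \<and> \<pi>2 b = \<pi>2 a) \<in> carrier WA \<and> \<pi>2 (SOME b. b \<in> carrier WA \<and> \<pi>2 b
        = \<pi>2 a) = \<pi>2 a"
      by (rule someI[of _ a]) (use that in auto)
    then show ?thesis unfolding M_def using Leq that by blast
  qed
  have "linear_map QA WA M"
    unfolding linear_map_def wreath_to_quotient_surj[symmetric]
    by (simp add: M Ll flip: \<pi>2.hom_add \<pi>2.hom_smult)
  note Ml = linear_mapD[OF this]
  \<comment> \<open>The inverse twist: s(g)^-1 g undoes the factor g^-1 s(g), and the degree g is
    available from the first tensor factor of \<open>\<alpha>\<close>.\<close>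
  let ?\<psi> = "WA.lin_ext (\<lambda>g. lam (inv (s g) \<otimes> g))"
  have \<psi>: "linear_map CG WA ?\<psi>"
    by (rule lin_ext_linear[OF WA.star_alg_axioms]) (simp add: s_closed)
  have "bilinear_map CG QA WA (\<lambda>c y. M y \<otimes>\<^bsub>WA\<^esub> ?\<psi> c)"
    unfolding bilinear_map_def
    by (simp add: linear_mapD[OF \<psi>] Ml WA.l_distr WA.r_distr WA.smult_mult WA.mult_smult)
  then obtain h where h: "linear_map GQ.T WA h"
    "\<And>c y. c \<in> carrier CG \<Longrightarrow> y \<in> carrier QA \<Longrightarrow> h (GQ.pt c y) = M y \<otimes>\<^bsub>WA\<^esub> ?\<psi> c"
    by (rule GQ.tensor_linear_universal[OF WA.star_alg_axioms]) blast
  have inverse: "h (\<alpha> x) = x" if "x \<in> carrier WA" for x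
    using that
  proof (induction rule: homogeneous_span_induct)
    case (homogeneous g a)
    note a = homogeneousD[OF homogeneous] and sg = s_closed[OF homogeneousD(1)[OF homogeneous]]
    have "h (\<alpha> a) = (a \<otimes>\<^bsub>WA\<^esub> lam (inv g \<otimes> s g)) \<otimes>\<^bsub>WA\<^esub> lam (inv (s g) \<otimes> g)"
      unfolding a(4) using a(1,2) sg by (simp add: h(2) elem_rep(1) M L(2)[OF homogeneous])
    also have "\<dots> = a \<otimes>\<^bsub>WA\<^esub> lam (inv g \<otimes> s g \<otimes> (inv (s g) \<otimes> g))"
      using a(1,2) sg by (simp add: WA.m_assoc lam_mult)
    also have "inv g \<otimes> s g \<otimes> (inv (s g) \<otimes> g) = \<one>"
      using a(1) sg by (simp add: m_assoc) (simp flip: m_assoc)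
    finally show ?case using a(2) by (simp add: nu_rep(3)[OF one_in])
  next
    case (add x y)
    then show ?case by (simp add: star_hom_add[OF \<alpha>(1)] star_hom_closed[OF \<alpha>(1)] linear_mapD(2)[OF
        h(1)])
  qed
  have "x = h (\<alpha> x)" by (rule inverse[OF assms(1), symmetric])
  also have "\<dots> = y" unfolding assms(3) by (rule inverse[OF assms(2)])
  finally show ?thesis .
qed

end

section \<open>Topological generation\<close>

lemma Mor_with_comult [simp]: "Mor (with_comult A D) n u m v = Mor A n u m v"
  by (simp add: Mor_def)

text \<open>The intertwining equations are linear in the coefficients with complex scalars, so they
  persist under \<open>f\<close>.\<close>

lemma (in star_alg_hom) Mor_subset:
  assumes "\<And>i j. i \<in> {1..n} \<Longrightarrow> j \<in> {1..n} \<Longrightarrow> u i j \<in> carrier A"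
    "\<And>i j. i \<in> {1..m} \<Longrightarrow> j \<in> {1..m} \<Longrightarrow> v i j \<in> carrier A"
  shows "Mor A n u m v \<subseteq> Mor B n (\<lambda>i j. f (u i j)) m (\<lambda>i j. f (v i j))"
proof
  fix T assume T: "T \<in> Mor A n u m v"
  have "(\<Oplus>\<^bsub>B\<^esub>k\<in>{1..n}. T i k \<odot>\<^bsub>B\<^esub> f (u k j)) = (\<Oplus>\<^bsub>B\<^esub>k\<in>{1..m}. T k j \<odot>\<^bsub>B\<^esub> f (v i k))"
    if ij: "i \<in> {1..m}" "j \<in> {1..n}" for i j
  proof -
    have "(\<Oplus>\<^bsub>B\<^esub>k\<in>{1..n}. T i k \<odot>\<^bsub>B\<^esub> f (u k j)) = (\<Oplus>\<^bsub>B\<^esub>k\<in>{1..n}. f (T i k \<odot>\<^bsub>A\<^esub> u k j))"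
      using ij assms by (intro B.finsum_cong'[OF refl]) (auto simp: hom_smult)
    also have "\<dots> = f (\<Oplus>\<^bsub>A\<^esub>k\<in>{1..n}. T i k \<odot>\<^bsub>A\<^esub> u k j)"
      using ij assms by (intro hom_finsum[symmetric]) auto
    also have "(\<Oplus>\<^bsub>A\<^esub>k\<in>{1..n}. T i k \<odot>\<^bsub>A\<^esub> u k j) = (\<Oplus>\<^bsub>A\<^esub>k\<in>{1..m}. T k j \<odot>\<^bsub>A\<^esub> v i k)"
      using T ij unfolding Mor_def by blast
    also have "f \<dots> = (\<Oplus>\<^bsub>B\<^esub>k\<in>{1..m}. f (T k j \<odot>\<^bsub>A\<^esub> v i k))"
      using ij assms by (intro hom_finsum) auto
    also have "\<dots> = (\<Oplus>\<^bsub>B\<^esub>k\<in>{1..m}. T k j \<odot>\<^bsub>B\<^esub> f (v i k))"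
      using ij assms by (intro B.finsum_cong'[OF refl]) (auto simp: hom_smult)
    finally show ?thesis .
  qed
  then show "T \<in> Mor B n (\<lambda>i j. f (u i j)) m (\<lambda>i j. f (v i j))"
    using T unfolding Mor_def by blast
qed

text \<open>The identity matrix is the magic unitary that defines the counit of S_N^+.\<close>

lemma (in star_alg) magic_delta: "magic A N (\<lambda>i j. if i = j then \<one> else \<zero>)"
proof -
  have "(\<Oplus>k\<in>{1..N}. if i = k then \<one> else \<zero>) = \<one>" if "i \<in> {1..N}" for i
    using finsum_singleton[of i "{1..N}" "\<lambda>_. \<one>"] that by simp
  moreover have "(\<Oplus>k\<in>{1..N}. if k = i then \<one> else \<zero>) = \<one>" if "i \<in> {1..N}" for i
    using finsum_singleton[of i "{1..N}" "\<lambda>_. \<one>"] that by (simp add: eq_commute[of i])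
  ultimately show ?thesis unfolding magic_def by auto
qed

text \<open>Writing ab for the matrix with entries given by the sums of a_ik \<otimes> b_kj, this is
  the chain X(ab) = (Xa)b = (a'X)b = a'(Xb) = a'(b'X) = (a'b')X.\<close>

lemma (in star_alg_pair) Mor_convolution:
  assumes a: "\<And>i j. i \<in> {1..n} \<Longrightarrow> j \<in> {1..n} \<Longrightarrow> a i j \<in> carrier A"
    and a': "\<And>i j. i \<in> {1..m} \<Longrightarrow> j \<in> {1..m} \<Longrightarrow> a' i j \<in> carrier A"
    and b: "\<And>i j. i \<in> {1..n} \<Longrightarrow> j \<in> {1..n} \<Longrightarrow> b i j \<in> carrier B"
    and b': "\<And>i j. i \<in> {1..m} \<Longrightarrow> j \<in> {1..m} \<Longrightarrow> b' i j \<in> carrier B"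
    and TA: "X \<in> Mor A n a m a'" and TB: "X \<in> Mor B n b m b'"
  shows "X \<in> Mor T n (\<lambda>i j. sum_pt n (a i) (\<lambda>k. b k j)) m (\<lambda>i j. sum_pt m (a' i) (\<lambda>k. b' k j))"
proof -
  have XA: "(\<Oplus>\<^bsub>A\<^esub>k\<in>{1..n}. X i k \<odot>\<^bsub>A\<^esub> a k j) = (\<Oplus>\<^bsub>A\<^esub>k\<in>{1..m}. X k j \<odot>\<^bsub>A\<^esub> a' i k)"
    and XB: "(\<Oplus>\<^bsub>B\<^esub>k\<in>{1..n}. X i k \<odot>\<^bsub>B\<^esub> b k j) = (\<Oplus>\<^bsub>B\<^esub>k\<in>{1..m}. X k j \<odot>\<^bsub>B\<^esub> b' i k)"
    if "i \<in> {1..m}" "j \<in> {1..n}" for i j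
    using TA TB that unfolding Mor_def by blast+
  have "(\<Oplus>\<^bsub>T\<^esub>k\<in>{1..n}. X i k \<odot>\<^bsub>T\<^esub> sum_pt n (a k) (\<lambda>l. b l j))
      = (\<Oplus>\<^bsub>T\<^esub>k\<in>{1..m}. X k j \<odot>\<^bsub>T\<^esub> sum_pt m (a' i) (\<lambda>l. b' l k))"
    if ij: "i \<in> {1..m}" "j \<in> {1..n}" for i j
  proof -
    have "(\<Oplus>\<^bsub>T\<^esub>k\<in>{1..n}. X i k \<odot>\<^bsub>T\<^esub> sum_pt n (a k) (\<lambda>l. b l j))
      = (\<Oplus>\<^bsub>T\<^esub>k\<in>{1..n}. \<Oplus>\<^bsub>T\<^esub>l\<in>{1..n}. pt (X i k \<odot>\<^bsub>A\<^esub> a k l) (b l j))"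
      using ij a b by (intro T.finsum_cong'[OF refl]) (auto simp: T.smult_finsum pt_smult_left
          Pi_def cong: T.finsum_cong)
    also have "\<dots> = (\<Oplus>\<^bsub>T\<^esub>l\<in>{1..n}. \<Oplus>\<^bsub>T\<^esub>k\<in>{1..n}. pt (X i k \<odot>\<^bsub>A\<^esub> a k l) (b l j))"
      using ij a b by (intro T.finsum_swap) auto
    also have "\<dots> = (\<Oplus>\<^bsub>T\<^esub>l\<in>{1..n}. \<Oplus>\<^bsub>T\<^esub>k\<in>{1..m}. pt (a' i k) (X k l \<odot>\<^bsub>B\<^esub> b l j))"
    proof (rule T.finsum_cong'[OF refl])
      fix l assume l: "l \<in> {1..n}"
      have "(\<Oplus>\<^bsub>T\<^esub>k\<in>{1..n}. pt (X i k \<odot>\<^bsub>A\<^esub> a k l) (b l j)) = pt (\<Oplus>\<^bsub>A\<^esub>k\<in>{1..n}. X i k \<odot>\<^bsub>A\<^esub> a k l) (b l j)"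
        using ij l a b by (intro pt_finsum_left[symmetric]) auto
      also have "\<dots> = (\<Oplus>\<^bsub>T\<^esub>k\<in>{1..m}. pt (X k l \<odot>\<^bsub>A\<^esub> a' i k) (b l j))"
        unfolding XA[OF ij(1) l] using ij l a' b by (intro pt_finsum_left) auto
      \<comment> \<open>The step (a'X)b = a'(Xb): the scalar moves from the left tensor factor to
        the right one.\<close>
      also have "\<dots> = (\<Oplus>\<^bsub>T\<^esub>k\<in>{1..m}. pt (a' i k) (X k l \<odot>\<^bsub>B\<^esub> b l j))"
        using ij l a' b by (intro T.finsum_cong'[OF refl]) (auto simp: pt_smult_left pt_smult_right)
      finally show "(\<Oplus>\<^bsub>T\<^esub>k\<in>{1..n}. pt (X i k \<odot>\<^bsub>A\<^esub> a k l) (b l j))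
          = (\<Oplus>\<^bsub>T\<^esub>k\<in>{1..m}. pt (a' i k) (X k l \<odot>\<^bsub>B\<^esub> b l j))" .
    qed (use ij a' b in \<open>auto intro!: T.finsum_closed\<close>)
    also have "\<dots> = (\<Oplus>\<^bsub>T\<^esub>k\<in>{1..m}. \<Oplus>\<^bsub>T\<^esub>l\<in>{1..n}. pt (a' i k) (X k l \<odot>\<^bsub>B\<^esub> b l j))"
      using ij a' b by (intro T.finsum_swap) auto
    also have "\<dots> = (\<Oplus>\<^bsub>T\<^esub>k\<in>{1..m}. \<Oplus>\<^bsub>T\<^esub>l\<in>{1..m}. X l j \<odot>\<^bsub>T\<^esub> pt (a' i k) (b' k l))"
    proof (rule T.finsum_cong'[OF refl])
      fix k assume k: "k \<in> {1..m}"
      have "(\<Oplus>\<^bsub>T\<^esub>l\<in>{1..n}. pt (a' i k) (X k l \<odot>\<^bsub>B\<^esub> b l j)) = pt (a' i k) (\<Oplus>\<^bsub>B\<^esub>l\<in>{1..n}. X k l \<odot>\<^bsub>B\<^esub> b l j)"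
        using ij k a' b by (intro pt_finsum_right[symmetric]) auto
      also have "\<dots> = (\<Oplus>\<^bsub>T\<^esub>l\<in>{1..m}. pt (a' i k) (X l j \<odot>\<^bsub>B\<^esub> b' k l))"
        unfolding XB[OF k ij(2)] using ij k a' b' by (intro pt_finsum_right) auto
      also have "\<dots> = (\<Oplus>\<^bsub>T\<^esub>l\<in>{1..m}. X l j \<odot>\<^bsub>T\<^esub> pt (a' i k) (b' k l))"
        using ij k a' b' by (intro T.finsum_cong'[OF refl]) (auto simp: pt_smult_right)
      finally show "(\<Oplus>\<^bsub>T\<^esub>l\<in>{1..n}. pt (a' i k) (X k l \<odot>\<^bsub>B\<^esub> b l j)) = (\<Oplus>\<^bsub>T\<^esub>l\<in>{1..m}. X l j \<odot>\<^bsub>T\<^esub> pt (a' i k)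
          (b' k l))" .
    qed (use ij a' b' in \<open>auto intro!: T.finsum_closed\<close>)
    also have "\<dots> = (\<Oplus>\<^bsub>T\<^esub>l\<in>{1..m}. \<Oplus>\<^bsub>T\<^esub>k\<in>{1..m}. X l j \<odot>\<^bsub>T\<^esub> pt (a' i k) (b' k l))"
      using ij a' b' by (intro T.finsum_swap) auto
    also have "\<dots> = (\<Oplus>\<^bsub>T\<^esub>l\<in>{1..m}. X l j \<odot>\<^bsub>T\<^esub> sum_pt m (a' i) (\<lambda>k. b' k l))"
      using ij a' b' by (intro T.finsum_cong'[OF refl]) (auto simp: T.smult_finsum Pi_def intro!:
          T.finsum_closed)
    finally show ?thesis .
  qed
  then show ?thesis using TA unfolding Mor_def by blast
qed

context normal_wreath begin

section \<open>The counit and the degree map\<close>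

text \<open>The map id \<otimes> \<epsilon>, with the counit taken as a map into the group algebra
  so that the universal property of the tensor product applies.\<close>

lemma product_counit:
  obtains e where "star_hom W.P1 CG e"
    "\<And>g. g \<in> carrier \<Gamma> \<Longrightarrow> e (W.pt1 (group_elem g) \<one>\<^bsub>W.SN\<^esub>) = group_elem g"
    "\<And>i j. i \<in> {1..N} \<Longrightarrow> j \<in> {1..N} \<Longrightarrow> e (W.pt1 \<one>\<^bsub>CG\<^esub> (qperm_gen N i j)) = (if i
        = j then \<one>\<^bsub>CG\<^esub> else \<zero>\<^bsub>CG\<^esub>)"
proof -
  interpret X: star_alg_pair CG W.SN by (rule W.pair1)
  obtain \<epsilon> where \<epsilon>: "star_hom W.SN CG \<epsilon>"
    "\<And>i j. i \<in> {1..N} \<Longrightarrow> j \<in> {1..N} \<Longrightarrow> \<epsilon> (qperm_gen N i j) = (if i = j then \<one>\<^bsub>CG\<^esub> else \<zero>\<^bsub>CG\<^esub>)"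
    by (rule qperm_universal[OF CG.star_alg_axioms CG.magic_delta]) blast
  have "a \<otimes>\<^bsub>CG\<^esub> \<epsilon> b = \<epsilon> b \<otimes>\<^bsub>CG\<^esub> a" if a: "a \<in> carrier CG" and b: "b \<in> carrier W.SN" for a b
  proof -
    \<comment> \<open>The generators go to 0 or 1, so the image of \<open>\<epsilon>\<close> is
      generated by central elements and commutes with everything.\<close>
    have "\<epsilon> ` carrier W.SN \<subseteq> star_span CG {\<zero>\<^bsub>CG\<^esub>, \<one>\<^bsub>CG\<^esub>}"
      by (rule star_hom_span_subset[OF star_alg_qperm qperm_gens_closed qperm_span \<epsilon>(1)])
          (auto simp: \<epsilon>(2))
    then have "\<epsilon> b \<in> star_span CG {\<zero>\<^bsub>CG\<^esub>, \<one>\<^bsub>CG\<^esub>}" using b by blast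
    then have "\<epsilon> b \<otimes>\<^bsub>CG\<^esub> a = a \<otimes>\<^bsub>CG\<^esub> \<epsilon> b \<and> \<epsilon> b \<otimes>\<^bsub>CG\<^esub> star CG a = star CG a \<otimes>\<^bsub>CG\<^esub> \<epsilon> b"
      by (rule CG.commute_span[OF _ a, rotated -1]) (use a in auto)
    then show ?thesis by simp
  qed
  then obtain e where e: "star_hom W.P1 CG e"
    "\<And>a b. a \<in> carrier CG \<Longrightarrow> b \<in> carrier W.SN \<Longrightarrow> e (W.pt1 a b) = a \<otimes>\<^bsub>CG\<^esub> \<epsilon> b"
    by (rule X.tensor_hom_universal[OF CG.star_alg_axioms star_hom_id \<epsilon>(1)]) blast+
  from e(1) show thesis
    by (rule that) (simp_all add: e(2) elem_rep(1) star_hom_one[OF \<epsilon>(1)] \<epsilon>(2) magicD(1)[OF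
        magic_qperm])
qed

text \<open>Besides injectivity, the factorisation of \<open>\<chi>\<close> through
  \<open>W.\<pi>1\<close> is recorded: it is what makes the condition over \<Gamma> \<times> S_N^+
  available to \<open>\<chi>\<close>.\<close>

lemma degree_map:
  obtains \<chi> e where "star_hom W.P1 CG e" "star_hom WA CG \<chi>" "\<And>x. \<chi> x = e (W.\<pi>1 x)"
    "inj_on (\<lambda>x. tensor_map WA WA CG QA \<chi> \<pi>2 (W.\<Delta> x)) (carrier WA)"
proof -
  obtain e where e: "star_hom W.P1 CG e"
    "\<And>g. g \<in> carrier \<Gamma> \<Longrightarrow> e (W.pt1 (group_elem g) \<one>\<^bsub>W.SN\<^esub>) = group_elem g"
    "\<And>i j. i \<in> {1..N} \<Longrightarrow> j \<in> {1..N} \<Longrightarrow> e (W.pt1 \<one>\<^bsub>CG\<^esub> (qperm_gen N i j)) = (if i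
        = j then \<one>\<^bsub>CG\<^esub> else \<zero>\<^bsub>CG\<^esub>)"
    by (rule product_counit) blast
  define \<chi> where "\<chi> x = e (W.\<pi>1 x)" for x
  have \<chi>: "star_hom WA CG \<chi>"
    unfolding \<chi>_def by (rule star_hom_comp[OF W.wreath_to_product(1) e(1)])
  have \<chi>v: "\<chi> (nu i g) = group_elem g" if "i \<in> {1..N}" "g \<in> carrier \<Gamma>" for i g
    unfolding \<chi>_def using that by (simp add: W.wreath_to_product(2) e(2))
  have \<chi>p: "\<chi> (W.p i j) = (if i = j then \<one>\<^bsub>CG\<^esub> else \<zero>\<^bsub>CG\<^esub>)" if "i \<in> {1..N}" "j \<in> {1..N}" for i j
    unfolding \<chi>_def using that by (simp add: W.wreath_to_product(3) e(3))
  let ?F = "tensor_map WA WA CG QA \<chi> \<pi>2"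
  define \<alpha> where "\<alpha> x = ?F (W.\<Delta> x)" for x
  note tm = tensor_map[OF WA.star_alg_axioms WA.star_alg_axioms CG.star_alg_axioms
      QA.star_alg_axioms \<chi> wreath_to_quotient(1)]
    and tms = tensor_map_sum[OF WA.star_alg_axioms WA.star_alg_axioms CG.star_alg_axioms
        QA.star_alg_axioms \<chi> wreath_to_quotient(1)]
  have \<alpha>: "star_hom WA GQ.T \<alpha>" unfolding \<alpha>_def by (rule star_hom_comp[OF W.comult_wreath(1) tm(1)])
  \<comment> \<open>As \<open>\<chi>\<close> sends p_ik to the Kronecker delta, only the term k = i
    of a coproduct sum survives.\<close>
  have collapse: "GQ.sum_pt N (\<lambda>k. if i = k then c else \<zero>\<^bsub>CG\<^esub>) y = GQ.pt c (y i)"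
    if "i \<in> {1..N}" "c \<in> carrier CG" "\<And>k. k \<in> {1..N} \<Longrightarrow> y k \<in> carrier QA" for i c y
  proof -
    have "GQ.sum_pt N (\<lambda>k. if i = k then c else \<zero>\<^bsub>CG\<^esub>) y = (\<Oplus>\<^bsub>GQ.T\<^esub>k\<in>{1..N}. if i
        = k then GQ.pt c (y k) else \<zero>\<^bsub>GQ.T\<^esub>)"
      using that by (intro GQ.T.finsum_cong'[OF refl]) auto
    also have "\<dots> = GQ.pt c (y i)" using that by (intro GQ.T.finsum_singleton) auto
    finally show ?thesis .
  qed
  have \<alpha>n: "\<alpha> (nu i g) = GQ.pt (group_elem g) (Q.nu i (coset g))" if ig: "i \<in> {1..N}"
      "g \<in> carrier \<Gamma>" for i g
  proof -
    have "\<alpha> (nu i g) = GQ.sum_pt N (\<lambda>k. \<chi> (nu i g \<otimes>\<^bsub>WA\<^esub> W.p i k)) (\<lambda>k. \<pi>2 (nu k g))"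
      unfolding \<alpha>_def W.comult_wreath(3)[OF ig] by (rule tms) (use ig in auto)
    also have "\<dots> = GQ.sum_pt N (\<lambda>k. if i = k then group_elem g else \<zero>\<^bsub>CG\<^esub>) (\<lambda>k. Q.nu k (coset g))"
      using ig by (intro GQ.sum_pt_cong) (auto simp: star_hom_mult[OF \<chi>]
          \<chi>v \<chi>p wreath_to_quotient(2) elem_rep(1))
    also have "\<dots> = GQ.pt (group_elem g) (Q.nu i (coset g))"
      using ig by (intro collapse) (auto simp: elem_rep(1))
    finally show ?thesis .
  qed
  have \<alpha>p: "\<alpha> (W.p i j) = GQ.pt \<one>\<^bsub>CG\<^esub> (Q.p i j)" if ij: "i \<in> {1..N}" "j \<in> {1..N}" for i j
  proof -
    have "\<alpha> (W.p i j) = GQ.sum_pt N (\<lambda>k. \<chi> (W.p i k)) (\<lambda>k. \<pi>2 (W.p k j))"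
      unfolding \<alpha>_def W.comult_wreath(2)[OF ij] by (rule tms) (use ij in auto)
    also have "\<dots> = GQ.sum_pt N (\<lambda>k. if i = k then \<one>\<^bsub>CG\<^esub> else \<zero>\<^bsub>CG\<^esub>) (\<lambda>k. Q.p k j)"
      using ij by (intro GQ.sum_pt_cong) (auto simp: \<chi>p wreath_to_quotient(3))
    also have "\<dots> = GQ.pt \<one>\<^bsub>CG\<^esub> (Q.p i j)"
      using ij by (intro collapse) auto
    finally show ?thesis .
  qed
  obtain \<gamma> where \<gamma>: "star_hom WA GW.T \<gamma>"
    "\<And>i g. i \<in> {1..N} \<Longrightarrow> g \<in> carrier \<Gamma> \<Longrightarrow> \<gamma> (nu i g) = GW.pt (group_elem g) (nu i g)"
    "\<And>i j. i \<in> {1..N} \<Longrightarrow> j \<in> {1..N} \<Longrightarrow> \<gamma> (W.p i j) = GW.pt \<one>\<^bsub>CG\<^esub> (W.p i j)"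
    by (rule wreath_grading) blast
  interpret graded_wreath \<Lambda> \<Gamma> N \<gamma> \<alpha>
    by unfold_locales (use \<gamma> \<alpha> \<alpha>n \<alpha>p in auto)
  have "inj_on \<alpha> (carrier WA)" by (rule inj_onI) (rule degree_map_inj)
  then show thesis using that[OF e(1) \<chi> \<chi>_def] unfolding \<alpha>_def by blast
qed

lemma Mor_inter:
  assumes u: "representation W.G n u" and v: "representation W.G m v"
  shows "Mor WA n u m v = Mor W.P1 n (\<lambda>i j. W.\<pi>1 (u i j)) m (\<lambda>i j. W.\<pi>1 (v i j)) \<inter>
    Mor QA n (\<lambda>i j. \<pi>2 (u i j)) m (\<lambda>i j. \<pi>2 (v i j))"
proof -
  interpret Z: star_alg_pair WA WA by unfold_locales
  interpret \<pi>1: star_alg_hom WA W.P1 W.\<pi>1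
    by (rule star_alg_homI[OF WA.star_alg_axioms W.star_alg_P1 W.wreath_to_product(1)])
  obtain \<chi> e where e: "star_hom W.P1 CG e" and \<chi>: "star_hom WA CG \<chi>" "\<And>x. \<chi> x = e (W.\<pi>1 x)"
    and inj: "inj_on (\<lambda>x. tensor_map WA WA CG QA \<chi> \<pi>2 (W.\<Delta> x)) (carrier WA)"
    by (rule degree_map) blast
  interpret e: star_alg_hom W.P1 CG e
    by (rule star_alg_homI[OF W.star_alg_P1 CG.star_alg_axioms e])
  define \<alpha> where "\<alpha> x = tensor_map WA WA CG QA \<chi> \<pi>2 (W.\<Delta> x)" for x
  note tm = tensor_map[OF WA.star_alg_axioms WA.star_alg_axioms CG.star_alg_axioms
      QA.star_alg_axioms \<chi>(1) wreath_to_quotient(1)]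
    and tms = tensor_map_sum[OF WA.star_alg_axioms WA.star_alg_axioms CG.star_alg_axioms
        QA.star_alg_axioms \<chi>(1) wreath_to_quotient(1)]
  have \<alpha>: "star_hom WA GQ.T \<alpha>" unfolding \<alpha>_def by (rule star_hom_comp[OF W.comult_wreath(1) tm(1)])
  interpret \<alpha>: star_alg_hom WA GQ.T \<alpha>
    by (rule star_alg_homI[OF WA.star_alg_axioms GQ.T.star_alg_axioms \<alpha>])
  have rep: "w i j \<in> carrier WA" "W.\<Delta> (w i j) = (\<Oplus>\<^bsub>Z.T\<^esub>k\<in>{1..d}. Z.pt (w i k) (w k j))"
    if "representation W.G d w" "i \<in> {1..d}" "j \<in> {1..d}" for w d i j
  proof -
    have "representation (with_comult WA W.\<Delta>) d w"
        using that(1) unfolding W.wreath_group_eq[symmetric] .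
    then show "w i j \<in> carrier WA" "W.\<Delta> (w i j) = (\<Oplus>\<^bsub>Z.T\<^esub>k\<in>{1..d}. Z.pt (w i k) (w k j))"
      using that(2,3) by (simp_all add: representation_def)
  qed
  have \<alpha>w: "\<alpha> (w i j) = GQ.sum_pt d (\<lambda>k. \<chi> (w i k)) (\<lambda>k. \<pi>2 (w k j))"
    if w: "representation W.G d w" and ij: "i \<in> {1..d}" "j \<in> {1..d}" for w d i j
    unfolding \<alpha>_def rep(2)[OF w ij] by (rule tms) (use rep(1)[OF w] ij in auto)
  note uc = rep(1)[OF u] and vc = rep(1)[OF v]
  show ?thesis
  proof
    show "Mor WA n u m v \<subseteq> Mor W.P1 n (\<lambda>i j. W.\<pi>1 (u i j)) m (\<lambda>i j. W.\<pi>1 (v i j)) \<inter>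
      Mor QA n (\<lambda>i j. \<pi>2 (u i j)) m (\<lambda>i j. \<pi>2 (v i j))"
      using \<pi>1.Mor_subset[OF uc vc] \<pi>2.Mor_subset[OF uc vc] by simp
  next
    show "Mor W.P1 n (\<lambda>i j. W.\<pi>1 (u i j)) m (\<lambda>i j. W.\<pi>1 (v i j)) \<inter>
      Mor QA n (\<lambda>i j. \<pi>2 (u i j)) m (\<lambda>i j. \<pi>2 (v i j)) \<subseteq> Mor WA n u m v"
    proof
      fix X assume X: "X \<in> Mor W.P1 n (\<lambda>i j. W.\<pi>1 (u i j)) m (\<lambda>i j. W.\<pi>1 (v i j)) \<inter>
        Mor QA n (\<lambda>i j. \<pi>2 (u i j)) m (\<lambda>i j. \<pi>2 (v i j))"
      \<comment> \<open>The first intertwining condition is pushed along \<open>e\<close>, since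
        \<open>\<chi>\<close> is \<open>e\<close> after \<open>W.\<pi>1\<close>.\<close>
      then have "X \<in> Mor CG n (\<lambda>i j. \<chi> (u i j)) m (\<lambda>i j. \<chi> (v i j))"
        unfolding \<chi>(2) using e.Mor_subset[of n "\<lambda>i j. W.\<pi>1 (u i j)"
            m "\<lambda>i j. W.\<pi>1 (v i j)"] uc vc by blast
      then have conv: "X \<in> Mor GQ.T n (\<lambda>i j. GQ.sum_pt n (\<lambda>k. \<chi> (u i k)) (\<lambda>k. \<pi>2 (u k j)))
          m (\<lambda>i j. GQ.sum_pt m (\<lambda>k. \<chi> (v i k)) (\<lambda>k. \<pi>2 (v k j)))"
        using X uc vc star_hom_closed[OF \<chi>(1)] by (intro GQ.Mor_convolution) auto
      have "(\<Oplus>\<^bsub>WA\<^esub>k\<in>{1..n}. X i k \<odot>\<^bsub>WA\<^esub> u k j) = (\<Oplus>\<^bsub>WA\<^esub>k\<in>{1..m}. X k j \<odot>\<^bsub>WA\<^esub> v i k)"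
        if ij: "i \<in> {1..m}" "j \<in> {1..n}" for i j
      proof -
        have "\<alpha> (\<Oplus>\<^bsub>WA\<^esub>k\<in>{1..n}. X i k \<odot>\<^bsub>WA\<^esub> u k j)
          = (\<Oplus>\<^bsub>GQ.T\<^esub>k\<in>{1..n}. X i k \<odot>\<^bsub>GQ.T\<^esub> GQ.sum_pt n (\<lambda>l. \<chi> (u k l)) (\<lambda>l. \<pi>2 (u l j)))"
          using ij uc by (simp add: \<alpha>.hom_finsum Pi_def \<alpha>.hom_smult flip: \<alpha>w[OF u]
              cong: GQ.T.finsum_cong)
        also have "\<dots> = (\<Oplus>\<^bsub>GQ.T\<^esub>k\<in>{1..m}. X k j \<odot>\<^bsub>GQ.T\<^esub> GQ.sum_pt m (\<lambda>l. \<chi> (v i l)) (\<lambda>l. \<pi>2 (v l k)))"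
          using conv ij unfolding Mor_def by blast
        also have "\<dots> = \<alpha> (\<Oplus>\<^bsub>WA\<^esub>k\<in>{1..m}. X k j \<odot>\<^bsub>WA\<^esub> v i k)"
          using ij vc by (simp add: \<alpha>.hom_finsum Pi_def \<alpha>.hom_smult flip: \<alpha>w[OF v]
              cong: GQ.T.finsum_cong)
        \<comment> \<open>Each side of the wanted equation lies in the algebra itself, and their
          images under \<open>\<alpha>\<close> agree.\<close>
        finally show ?thesis
          using inj ij uc vc unfolding \<alpha>_def[symmetric]
          by (elim inj_onD) (auto intro!: WA.finsum_closed)
      qed
      then show "X \<in> Mor WA n u m v" using X unfolding Mor_def by blast
    qed
  qed
qed

lemma generated_by_quotients: "topologically_generated_by_two W.G W.H1 W.\<pi>1 H2 \<pi>2"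
proof -
  have Mor_eq: "Mor W.G n u m v = Mor WA n u m v" for n u m v
    by (subst W.wreath_group_eq) simp
  have Mor_H1: "Mor W.H1 n u m v = Mor W.P1 n u m v" for n u m v
    by (subst W.H1_eq) simp
  have Mor_H2: "Mor H2 n u m v = Mor QA n u m v" for n u m v
    by (subst H2_eq) simp
  show ?thesis
    unfolding topologically_generated_by_two_def Mor_eq Mor_H1 Mor_H2
    using W.quantum_subgroup_product[OF N_pos] quantum_subgroup_quotient Mor_inter by blast
qed

end

theorem theorem4p4:
  fixes \<Gamma> :: "('g, 'c) monoid_scheme" and \<Lambda> :: "'g set" and N :: nat
  assumes "group \<Gamma>"
    and "subgroup \<Lambda> \<Gamma>"
    and "\<Lambda> \<lhd> \<Gamma>"
    and "N \<ge> 4"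
  shows "topologically_generated_by_two
           (amalg_free_wreath \<Gamma> \<Lambda> N)
           (product_quantum_group (dual_group \<Gamma>) (quantum_perm_group N))
           (wreath_to_product \<Gamma> \<Lambda> N)
           (free_wreath (\<Gamma> Mod \<Lambda>) N)
           (wreath_to_quotient \<Gamma> \<Lambda> N)"
proof -
  interpret normal_wreath \<Lambda> \<Gamma> N
    using assms by (simp add: normal_wreath_def normal_wreath_axioms_def)
  show ?thesis by (rule generated_by_quotients)
qed

end
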